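(* Let $f_\oplus$ be a probability density on $\mathbb{R}$ with finite second moment whose support $D_\oplus$ is an interval (possibly unbounded), and let $\mathcal{T}_{f_\oplus}$ be its Wasserstein tangent space (defined in the context). Let $\beta\in\mathbb{R}$ and let $\{\epsilon_t\}_{t\in\mathbb{Z}}$ be random elements of $\mathcal{T}_{f_\oplus}$ with $\mathbb{E}[\epsilon_t(u)]=0$ for all $u\in D_\oplus$ and covariance kernel $C_\epsilon(u,v)=\operatorname{Cov}(\epsilon_t(u),\epsilon_t(v))$. Consider the model $$V_t=\beta V_{t-1}+\epsilon_t,\qquad t\in\mathbb{Z},$$ for random elements $V_t\in\mathcal{T}_{f_\oplus}$. Assume (A1) $|\beta|<1$; (A2) the $\epsilon_t$ are i.i.d. elements of $\mathcal{T}_{f_\oplus}$ with mean zero and $\int_{\mathbb{R}}C_\epsilon(u,u)f_\oplus(u)\,du<\infty$. Then $V_t=\sum_{i=0}^\infty\beta^i\epsilon_{t-i}$ defines a unique, strictly stationary solution in $\mathcal{T}_{f_\oplus}$ of the model, and this series converges both almost surely and in mean square: $\lim_{n\to\infty}\|V_t-\sum_{i=0}^n\beta^i\epsilon_{t-i}\|=0$ almost surely and $\lim_{n\to\infty}\mathbb{E}\|V_t-\sum_{i=0}^n\beta^i\epsilon_{t-i}\|^2=0$, where $\|\cdot\|$ is the norm of $L^2(\mathbb{R},f_\oplus(u)\,du)$. If in addition (A3) almost surely $V_t$ is differentiable and $V_t'(u)>-1$ for all $u\in D_\oplus$, then the measures $\mu_t=\operatorname{Exp}_{f_\oplus}(V_t)$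 possess densities $f_t$ which form a strictly stationary sequence $\{f_t,t\in\mathbb{Z}\}$ with common Wasserstein mean $f_\oplus$, and $V_t=T_t-\mathrm{id}$ almost surely, where $T_t=F_t^{-1}\circ F_\oplus$ with $F_t,F_\oplus$ the cdfs of $f_t,f_\oplus$.
   Context: $\mathcal{W}_2$ is the set of Borel probability measures on $\mathbb{R}$ with finite second moment, and $\mathcal{D}\subset\mathcal{W}_2$ the subset of those having a Lebesgue density (identified with densities). For $f,g\in\mathcal{D}$ with cdfs $F,G$ and quantile functions $F^{-1},G^{-1}$, the Wasserstein distance is $d_W(f,g)=\{\int_0^1(G^{-1}(s)-F^{-1}(s))^2ds\}^{1/2}$, and $G^{-1}\circ F$ is the optimal transport map from $f$ to $g$. For $\mu\in\mathcal{W}_2$, the tangent space $\mathcal{T}_\mu$ is the closure in $L^2(\mathbb{R},d\mu)$ of $\{\lambda(T-\mathrm{id}):T$ is the optimal transport map from $\mu$ to some $\nu\in\mathcal{W}_2,\ \lambda>0\}$; for $\mu$ with density $f$ write $\mathcal{T}_f$; it is a separable Hilbert space with inner product $\langle h,g\rangle=\int h g f\,du$. The exponential map is $\operatorname{Exp}_f(V)=(V+\mathrm{id})_\#\mu_f$, i.e. the measure $A\mapsto\mu_f((V+\mathrm{id})^{-1}(A))$, where $\mu_f$ has density $f$. For a random density $f$ (a random element of $\mathcal{D}$) with $\mathbb{E}d_W^2(f,g)<\infty$, its Wasserstein mean is $\arg\min_{g\in\mathcal{D}}\mathbb{E}d_W^2(f,g)$. A sequence of random elements is strictly stationary if all finite-dimensional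 joint distributions are invariant under time shifts. *)

theory Defs
  imports "HOL-Probability.Probability"
begin

definition W2_measure :: "real measure \<Rightarrow> bool" where
  "W2_measure \<mu> \<longleftrightarrow> prob_space \<mu> \<and> sets \<mu> = sets borel \<and>
      (\<integral>\<^sup>+ x. ennreal (x\<^sup>2) \<partial>\<mu>) < \<infinity>"

definition is_density :: "(real \<Rightarrow> real) \<Rightarrow> bool" where
  "is_density f \<longleftrightarrow> f \<in> borel_measurable borel \<and> (\<forall>x. 0 \<le> f x) \<and>
      (\<integral>\<^sup>+ x. ennreal (f x) \<partial>lborel) = 1"

definition dens_W2 :: "(real \<Rightarrow> real) \<Rightarrow> bool" where
  "dens_W2 f \<longleftrightarrow> is_density f \<and> W2_measure (density lborel f)"

definition Dens :: "(real \<Rightarrow> real) set" where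
  "Dens = {f. dens_W2 f}"

definition dens_support :: "(real \<Rightarrow> real) \<Rightarrow> real set" where
  "dens_support f = {u. \<forall>e>0. emeasure (density lborel f) (ball u e) > 0}"

definition dens_cdf :: "(real \<Rightarrow> real) \<Rightarrow> real \<Rightarrow> real" where
  "dens_cdf f x = measure (density lborel f) {..x}"

definition dens_quantile :: "(real \<Rightarrow> real) \<Rightarrow> real \<Rightarrow> real" where
  "dens_quantile f s = Inf {x. s \<le> dens_cdf f x}"

definition dW :: "(real \<Rightarrow> real) \<Rightarrow> (real \<Rightarrow> real) \<Rightarrow> real" where
  "dW f g = sqrt (enn2real (\<integral>\<^sup>+ s. ennreal ((dens_quantile g s - dens_quantile f s)\<^sup>2
                * indicator {0<..<1} s) \<partial>lborel))"

definition wass_borel :: "(real \<Rightarrow> real) measure" where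
  "wass_borel = sigma Dens {Dens \<inter> {g. dW h g < r} | h r. h \<in> Dens}"

definition L2norm :: "(real \<Rightarrow> real) \<Rightarrow> (real \<Rightarrow> real) \<Rightarrow> real" where
  "L2norm f h = sqrt (enn2real (\<integral>\<^sup>+ u. ennreal (f u * (h u)\<^sup>2) \<partial>lborel))"

definition optimal_map :: "real measure \<Rightarrow> real measure \<Rightarrow> (real \<Rightarrow> real) \<Rightarrow> bool" where
  "optimal_map \<mu> \<nu> T \<longleftrightarrow> T \<in> borel_measurable borel \<and> distr \<mu> borel T = \<nu> \<and>
     (\<forall>S \<in> borel_measurable borel. distr \<mu> borel S = \<nu> \<longrightarrow>
        (\<integral>\<^sup>+ x. ennreal ((T x - x)\<^sup>2) \<partial>\<mu>) \<le> (\<integral>\<^sup>+ x. ennreal ((S x - x)\<^sup>2) \<partial>\<mu>))"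

text \<open>Tangent space at f: closure in L^2(f) of the set of lambda (T - id), T optimal.
  Elements are represented by Borel functions, square integrable w.r.t. f.\<close>
definition tangent :: "(real \<Rightarrow> real) \<Rightarrow> (real \<Rightarrow> real) set" where
  "tangent f = {g. g \<in> borel_measurable borel \<and>
      (\<integral>\<^sup>+ u. ennreal (f u * (g u)\<^sup>2) \<partial>lborel) < \<infinity> \<and>
      (\<forall>e>0. \<exists>lam>0. \<exists>\<nu> T. W2_measure \<nu> \<and> optimal_map (density lborel f) \<nu> T \<and>
          L2norm f (\<lambda>u. g u - lam * (T u - u)) < e)}"

definition tangent_borel :: "(real \<Rightarrow> real) \<Rightarrow> (real \<Rightarrow> real) measure" where
  "tangent_borel f = sigma (tangent f)
      {tangent f \<inter> {h. L2norm f (\<lambda>u. h u - g u) < r} | g r. g \<in> tangent f}"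

definition Exp_map :: "(real \<Rightarrow> real) \<Rightarrow> (real \<Rightarrow> real) \<Rightarrow> real measure" where
  "Exp_map f V = distr (density lborel f) borel (\<lambda>u. V u + u)"

definition strictly_stationary ::
  "'a measure \<Rightarrow> 'b measure \<Rightarrow> (int \<Rightarrow> 'a \<Rightarrow> 'b) \<Rightarrow> bool" where
  "strictly_stationary M N X \<longleftrightarrow> (\<forall>t. X t \<in> measurable M N) \<and>
     (\<forall>h. distr M (PiM (UNIV::int set) (\<lambda>_. N)) (\<lambda>\<omega> t. X (t + h) \<omega>) =
          distr M (PiM (UNIV::int set) (\<lambda>_. N)) (\<lambda>\<omega> t. X t \<omega>))"

definition wasserstein_mean :: "'a measure \<Rightarrow> ('a \<Rightarrow> real \<Rightarrow> real) \<Rightarrow> (real \<Rightarrow> real) \<Rightarrow> bool" where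
  "wasserstein_mean M X f0 \<longleftrightarrow> f0 \<in> Dens \<and>
     (\<integral>\<^sup>+ \<omega>. ennreal ((dW (X \<omega>) f0)\<^sup>2) \<partial>M) < \<infinity> \<and>
     (\<forall>g \<in> Dens. (\<integral>\<^sup>+ \<omega>. ennreal ((dW (X \<omega>) f0)\<^sup>2) \<partial>M) \<le> (\<integral>\<^sup>+ \<omega>. ennreal ((dW (X \<omega>) g)\<^sup>2) \<partial>M)) \<and>
     (\<forall>g \<in> Dens. (\<integral>\<^sup>+ \<omega>. ennreal ((dW (X \<omega>) g)\<^sup>2) \<partial>M) = (\<integral>\<^sup>+ \<omega>. ennreal ((dW (X \<omega>) f0)\<^sup>2) \<partial>M)
        \<longrightarrow> density lborel g = density lborel f0)"

end

theory Submission
  imports Defs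
begin

text \<open>In dimension one every small Lipschitz perturbation of the identity is an optimal map, so the
  tangent space at \<open>f\<^sub>\<oplus>\<close> is all of \<open>L\<^sup>2(f\<^sub>\<oplus>)\<close>, a separable Hilbert space. By the
  Cauchy--Schwarz inequality with weights \<open>\<bar>\<beta>\<bar>\<^sup>i\<close>, the function \<open>\<Sum>\<^sub>i \<bar>\<beta>\<bar>\<^sup>i \<bar>\<epsilon>\<^sub>t\<^sub>-\<^sub>i(u)\<bar>\<close> is square
  integrable in \<open>(\<omega>, u)\<close>; it dominates the series, which therefore converges pointwise almost
  everywhere, in \<open>L\<^sup>2(f\<^sub>\<oplus>)\<close> almost surely, and in mean square. The difference \<open>D\<^sub>t\<close> of two stationary
  solutions satisfies \<open>\<parallel>D\<^sub>t\<parallel> \<le> \<bar>\<beta>\<bar>\<^sup>n \<parallel>D\<^sub>t\<^sub>-\<^sub>n\<parallel>\<close>, which tends to \<open>0\<close> in probability.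

  Under (A3) the map \<open>T\<^sub>t = V\<^sub>t + id\<close> is increasing with positive derivative, hence pulls null sets back
  to null sets and equals the quantile transform \<open>F\<^sub>t\<^sup>-\<^sup>1 \<circ> F\<^sub>\<oplus>\<close>. The Wasserstein distance from
  \<open>f\<^sub>t\<close> to a density \<open>g\<close> is thus \<open>\<parallel>V\<^sub>t - \<psi>\<parallel>\<close> with \<open>\<psi> = G\<^sup>-\<^sup>1 \<circ> F\<^sub>\<oplus> - id\<close>, and since \<open>V\<^sub>t\<close> is
  centred, the expectation of its square is that of \<open>\<parallel>V\<^sub>t\<parallel>\<^sup>2\<close> plus \<open>\<parallel>\<psi>\<parallel>\<^sup>2\<close>, which is
  smallest exactly when \<open>\<psi> = 0\<close>.\<close>

subsection \<open>Square integrable functions\<close>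

text \<open>Tangent vectors are functions here, and random ones are measurable for the
  \<sigma>-algebra generated by balls. Two obstacles follow. Intersections of balls need not be
  balls, so laws of paths are not compared on an intersection-stable generator. And the
  measurability of a sum has to be won from a countable dense set, for which explicit piecewise
  linear functions are built; being bounded and Lipschitz, the same functions also yield the optimal
  maps.

  Expectations at a fixed point \<open>u\<close> make sense for the jointly measurable noise, but
  not for an arbitrary limit \<open>V t\<close> of the series. All such computations are made with
  one jointly measurable version \<open>sol\<close>; a general \<open>V t\<close> enters
  expectations only through its distances to fixed functions, which agree almost surely with those
  of \<open>sol\<close>. Distances also suffice for the image densities: composition with
  \<open>dens_cdf f\<close> turns \<open>dW\<close> into a distance in \<open>L2 f\<close>, so that
  densities picked separately for each \<omega> are still random elements.\<close>

abbreviation dmeas :: "(real \<Rightarrow> real) \<Rightarrow> real measure" where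
  "dmeas f \<equiv> density lborel (\<lambda>x. ennreal (f x))"

text \<open>Members are functions, not classes modulo null sets. Since \<open>enn2real\<close> sends
  infinity to 0, a small \<open>L2norm\<close> alone does not show membership, which is therefore
  tracked beside the norm estimates.\<close>

definition L2 :: "(real \<Rightarrow> real) \<Rightarrow> (real \<Rightarrow> real) set" where
  "L2 f = {h. h \<in> borel_measurable borel \<and> integrable (dmeas f) (\<lambda>u. (h u)\<^sup>2)}"

locale w2_density =
  fixes f :: "real \<Rightarrow> real"
  assumes dens: "dens_W2 f"
begin

abbreviation \<mu> :: "real measure" where "\<mu> \<equiv> dmeas f"

lemma f_measurable [measurable]: "f \<in> borel_measurable borel"
  and f_nonneg: "0 \<le> f x"
  using dens by (auto simp: dens_W2_def is_density_def)

sublocale prob_space \<mu>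
  using dens by (simp add: dens_W2_def W2_measure_def)

lemma id_in_L2: "(\<lambda>x. x) \<in> L2 f"
proof -
  have "(\<integral>\<^sup>+ x. ennreal (x\<^sup>2) \<partial>\<mu>) < \<infinity>"
    using dens by (simp add: dens_W2_def W2_measure_def)
  then have "integrable \<mu> (\<lambda>x. x\<^sup>2)"
    by (intro integrableI_bounded) auto
  then show ?thesis by (auto simp: L2_def)
qed

lemma L2_measurable: "h \<in> L2 f \<Longrightarrow> h \<in> borel_measurable borel"
  by (simp add: L2_def)

lemma L2_integrable: "h \<in> L2 f \<Longrightarrow> integrable \<mu> (\<lambda>u. (h u)\<^sup>2)"
  by (simp add: L2_def)

lemma nn_integral_weight:
  assumes "h \<in> borel_measurable borel"
  shows "(\<integral>\<^sup>+ u. ennreal (f u * (h u)\<^sup>2) \<partial>lborel) = (\<integral>\<^sup>+ u. ennreal ((h u)\<^sup>2) \<partial>\<mu>)"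
  using assms by (subst nn_integral_density) (auto simp: ennreal_mult' f_nonneg)

lemma L2_iff_nn_integral:
  "h \<in> L2 f \<longleftrightarrow> h \<in> borel_measurable borel \<and> (\<integral>\<^sup>+ u. ennreal ((h u)\<^sup>2) \<partial>\<mu>) < \<infinity>"
  by (auto simp: L2_def integrable_iff_bounded)

lemma L2norm_eq:
  assumes "h \<in> borel_measurable borel"
  shows "L2norm f h = sqrt (\<integral>u. (h u)\<^sup>2 \<partial>\<mu>)"
  unfolding L2norm_def nn_integral_weight[OF assms]
  using assms by (subst integral_eq_nn_integral) auto

lemma L2norm_nonneg [simp]: "0 \<le> L2norm f h"
  by (simp add: L2norm_def)

lemma L2norm_power2:
  "h \<in> borel_measurable borel \<Longrightarrow> (L2norm f h)\<^sup>2 = (\<integral>u. (h u)\<^sup>2 \<partial>\<mu>)"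
  by (simp add: L2norm_eq)

lemma ennreal_L2norm_power2:
  assumes "h \<in> L2 f"
  shows "ennreal ((L2norm f h)\<^sup>2) = (\<integral>\<^sup>+ u. ennreal ((h u)\<^sup>2) \<partial>\<mu>)"
  using assms by (simp add: L2norm_power2 L2_measurable L2_integrable nn_integral_eq_integral)

lemma L2_mult_integrable:
  assumes "g \<in> L2 f" "h \<in> L2 f"
  shows "integrable \<mu> (\<lambda>u. g u * h u)"
proof (rule Bochner_Integration.integrable_bound)
  show "integrable \<mu> (\<lambda>u. (g u)\<^sup>2 + (h u)\<^sup>2)"
    using assms by (simp add: L2_def)
  show "(\<lambda>u. g u * h u) \<in> borel_measurable \<mu>"
    using L2_measurable[OF assms(1)] L2_measurable[OF assms(2)] by simp
  show "AE u in \<mu>. norm (g u * h u) \<le> norm ((g u)\<^sup>2 + (h u)\<^sup>2)"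
  proof (rule AE_I2)
    fix u
    have "\<bar>g u\<bar> * \<bar>h u\<bar> \<le> (g u)\<^sup>2 + (h u)\<^sup>2"
      using sum_squares_bound[of "\<bar>g u\<bar>" "\<bar>h u\<bar>"]
        mult_nonneg_nonneg[OF abs_ge_zero[of "g u"] abs_ge_zero[of "h u"]]
      unfolding power2_abs by linarith
    then show "norm (g u * h u) \<le> norm ((g u)\<^sup>2 + (h u)\<^sup>2)"
      by (simp add: abs_mult)
  qed
qed

lemma L2_add: "g \<in> L2 f \<Longrightarrow> h \<in> L2 f \<Longrightarrow> (\<lambda>u. g u + h u) \<in> L2 f"
  using L2_mult_integrable[of g h]
  by (auto simp: L2_def power2_sum mult.assoc)

lemma L2_scale: "h \<in> L2 f \<Longrightarrow> (\<lambda>u. c * h u) \<in> L2 f"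
  by (auto simp: L2_def power_mult_distrib)

lemma L2_uminus: "h \<in> L2 f \<Longrightarrow> (\<lambda>u. - h u) \<in> L2 f"
  using L2_scale[of h "-1"] by simp

lemma L2_diff: "g \<in> L2 f \<Longrightarrow> h \<in> L2 f \<Longrightarrow> (\<lambda>u. g u - h u) \<in> L2 f"
  using L2_add[OF _ L2_uminus, of g h] by simp

lemma L2_sum: "finite I \<Longrightarrow> (\<And>i. i \<in> I \<Longrightarrow> h i \<in> L2 f) \<Longrightarrow> (\<lambda>u. \<Sum>i\<in>I. h i u) \<in> L2 f"
proof (induction I rule: finite_induct)
  case empty
  then show ?case by (simp add: L2_def)
next
  case (insert i I)
  then show ?case using L2_add[of "h i" "\<lambda>u. \<Sum>i\<in>I. h i u"] by simp
qed

lemma L2_bound: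
  assumes "h \<in> L2 f" "g \<in> borel_measurable borel" "AE u in \<mu>. \<bar>g u\<bar> \<le> \<bar>h u\<bar>"
  shows "g \<in> L2 f"
proof -
  have "integrable \<mu> (\<lambda>u. (g u)\<^sup>2)"
  proof (rule Bochner_Integration.integrable_bound[OF L2_integrable[OF assms(1)]])
    show "AE u in \<mu>. norm ((g u)\<^sup>2) \<le> norm ((h u)\<^sup>2)"
      using assms(3) by eventually_elim (simp add: abs_le_square_iff)
  qed (use assms(2) in simp)
  then show ?thesis using assms(2) by (simp add: L2_def)
qed

lemma L2_const: "(\<lambda>u. c) \<in> L2 f"
  by (simp add: L2_def)

lemma L2_bounded:
  assumes "g \<in> borel_measurable borel" "\<And>u. \<bar>g u\<bar> \<le> B"
  shows "g \<in> L2 f"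
proof (rule L2_bound[OF L2_const[of B] assms(1)], rule AE_I2)
  show "\<bar>g u\<bar> \<le> \<bar>B\<bar>" for u using assms(2)[of u] by linarith
qed

text \<open>Minkowski's inequality: expand the square and bound the cross term by the Cauchy-Schwarz
  inequality for the absolute values.\<close>

lemma L2norm_triangle:
  assumes g: "g \<in> L2 f" and h: "h \<in> L2 f"
  shows "L2norm f (\<lambda>u. g u + h u) \<le> L2norm f g + L2norm f h"
proof -
  let ?a = "L2norm f g" and ?b = "L2norm f h"
  note [measurable] = L2_measurable[OF g] L2_measurable[OF h]
  have gh: "integrable \<mu> (\<lambda>u. g u * h u)" by (rule L2_mult_integrable[OF g h])
  have fin: "(\<integral>\<^sup>+ u. ennreal \<bar>g u\<bar> * ennreal \<bar>h u\<bar> \<partial>\<mu>) = ennreal (\<integral>u. \<bar>g u * h u\<bar> \<partial>\<mu>)"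
    using integrable_abs[OF gh]
    by (subst nn_integral_eq_integral[symmetric]) (auto simp: abs_mult ennreal_mult)
  have "(\<integral>\<^sup>+ u. ennreal \<bar>g u\<bar> * ennreal \<bar>h u\<bar> \<partial>\<mu>)\<^sup>2
      \<le> (\<integral>\<^sup>+ u. (ennreal \<bar>g u\<bar>)\<^sup>2 \<partial>\<mu>) * (\<integral>\<^sup>+ u. (ennreal \<bar>h u\<bar>)\<^sup>2 \<partial>\<mu>)"
    by (rule Cauchy_Schwarz_nn_integral) auto
  also have "\<dots> = ennreal (?a\<^sup>2) * ennreal (?b\<^sup>2)"
    using g h by (simp add: ennreal_L2norm_power2 ennreal_power)
  finally have "(\<integral>u. \<bar>g u * h u\<bar> \<partial>\<mu>)\<^sup>2 \<le> (?a * ?b)\<^sup>2"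
    unfolding fin by (simp add: ennreal_power ennreal_mult[symmetric] power_mult_distrib)
  then have "(\<integral>u. \<bar>g u * h u\<bar> \<partial>\<mu>) \<le> ?a * ?b"
    by (rule power2_le_imp_le) simp
  moreover have "(\<integral>u. g u * h u \<partial>\<mu>) \<le> (\<integral>u. \<bar>g u * h u\<bar> \<partial>\<mu>)"
    using gh by (intro integral_mono) auto
  moreover have "(L2norm f (\<lambda>u. g u + h u))\<^sup>2 = ?a\<^sup>2 + ?b\<^sup>2 + 2 * (\<integral>u. g u * h u \<partial>\<mu>)"
    using gh L2_integrable[OF g] L2_integrable[OF h]
    by (simp add: L2norm_power2 power2_sum mult.assoc)
  ultimately have "(L2norm f (\<lambda>u. g u + h u))\<^sup>2 \<le> (?a + ?b)\<^sup>2"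
    by (simp add: power2_sum)
  then show ?thesis by (rule power2_le_imp_le) simp
qed

lemma L2norm_scale:
  "h \<in> borel_measurable borel \<Longrightarrow> L2norm f (\<lambda>u. c * h u) = \<bar>c\<bar> * L2norm f h"
  by (simp add: L2norm_eq power_mult_distrib real_sqrt_mult)

lemma L2norm_minus_commute: "L2norm f (\<lambda>u. g u - h u) = L2norm f (\<lambda>u. h u - g u)"
  by (simp add: L2norm_def power2_commute)

lemma L2norm_triangle_diff:
  assumes "g \<in> L2 f" "h \<in> L2 f" "k \<in> L2 f"
  shows "L2norm f (\<lambda>u. g u - k u) \<le> L2norm f (\<lambda>u. g u - h u) + L2norm f (\<lambda>u. h u - k u)"
  using L2norm_triangle[OF L2_diff[OF assms(1,2)] L2_diff[OF assms(2,3)]] by simp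

lemma L2norm_cong_AE:
  assumes "g \<in> borel_measurable borel" "h \<in> borel_measurable borel" "AE u in \<mu>. g u = h u"
  shows "L2norm f g = L2norm f h"
proof -
  have "(\<integral>u. (g u)\<^sup>2 \<partial>\<mu>) = (\<integral>u. (h u)\<^sup>2 \<partial>\<mu>)"
    using assms by (intro integral_cong_AE) auto
  then show ?thesis using assms by (simp add: L2norm_eq)
qed

lemma L2norm_eq_0_iff:
  assumes "h \<in> L2 f"
  shows "L2norm f h = 0 \<longleftrightarrow> (AE u in \<mu>. h u = 0)"
  using integral_nonneg_eq_0_iff_AE[OF L2_integrable[OF assms]]
  by (simp add: L2norm_eq L2_measurable[OF assms])

lemma L2norm_tendsto_dominated:
  assumes G: "G \<in> L2 f" and h: "\<And>n. h n \<in> borel_measurable borel"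
    and lim: "AE u in \<mu>. (\<lambda>n. h n u) \<longlonglongrightarrow> 0"
    and bd: "\<And>n. AE u in \<mu>. \<bar>h n u\<bar> \<le> \<bar>G u\<bar>"
  shows "(\<lambda>n. L2norm f (h n)) \<longlonglongrightarrow> 0"
proof -
  have "(\<lambda>n. \<integral>u. (h n u)\<^sup>2 \<partial>\<mu>) \<longlonglongrightarrow> (\<integral>u. 0 \<partial>\<mu>)"
  proof (rule integral_dominated_convergence[where w = "\<lambda>u. (G u)\<^sup>2"])
    show "AE u in \<mu>. (\<lambda>n. (h n u)\<^sup>2) \<longlonglongrightarrow> 0"
      using lim by eventually_elim (auto intro: tendsto_eq_intros)
    show "AE u in \<mu>. norm ((h n u)\<^sup>2) \<le> (G u)\<^sup>2" for n
      using bd[of n] by eventually_elim (simp add: abs_le_square_iff)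
  qed (use h L2_integrable[OF G] in auto)
  then have "(\<lambda>n. sqrt (\<integral>u. (h n u)\<^sup>2 \<partial>\<mu>)) \<longlonglongrightarrow> sqrt 0"
    by (intro tendsto_real_sqrt) simp
  then show ?thesis using h by (simp add: L2norm_eq)
qed

end

subsection \<open>A countable dense set of Lipschitz functions\<close>

text \<open>A Lipschitz stand-in for the indicator of \<open>{..q}\<close>: for positive
  \<open>n\<close> it is 1 up to \<open>q\<close>, 0 from \<open>q + 1/n\<close> on, and linear in
  between.\<close>

definition ramp :: "real \<Rightarrow> nat \<Rightarrow> real \<Rightarrow> real" where
  "ramp q n x = max 0 (min 1 (1 - real n * (x - q)))"

text \<open>Indexing by lists of rational and natural parameters makes the family countable, which
  the countable union in \<open>tangent_borel_add\<close> relies on.\<close>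

definition ramp_comb :: "(rat \<times> rat \<times> nat) list \<Rightarrow> real \<Rightarrow> real" where
  "ramp_comb l x = (\<Sum>(c, q, n)\<leftarrow>l. real_of_rat c * ramp (real_of_rat q) n x)"

lemma ramp_bounds: "0 \<le> ramp q n x" "ramp q n x \<le> 1" "\<bar>ramp q n x\<bar> \<le> 1"
  by (auto simp: ramp_def)

lemma ramp_lipschitz: "\<bar>ramp q n x - ramp q n y\<bar> \<le> real n * \<bar>x - y\<bar>"
proof -
  have "\<bar>ramp q n x - ramp q n y\<bar> \<le> \<bar>real n * (x - q) - real n * (y - q)\<bar>"
    unfolding ramp_def by linarith
  also have "\<dots> = real n * \<bar>x - y\<bar>"
    by (simp add: abs_mult flip: right_diff_distrib)
  finally show ?thesis .
qed

lemma ramp_measurable [measurable]: "ramp q n \<in> borel_measurable borel"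
  unfolding ramp_def by measurable

lemma ramp_comb_Nil [simp]: "ramp_comb [] x = 0"
  and ramp_comb_Cons: "ramp_comb ((c, q, n) # l) x = real_of_rat c * ramp (real_of_rat q) n x + ramp_comb l x"
  and ramp_comb_append: "ramp_comb (l @ l') x = ramp_comb l x + ramp_comb l' x"
  by (auto simp: ramp_comb_def)

lemma ramp_comb_scale:
  "ramp_comb (map (\<lambda>(c, p). (r * c, p)) l) x = real_of_rat r * ramp_comb l x"
  by (induction l) (auto simp: ramp_comb_def of_rat_mult algebra_simps)

text \<open>After scaling, these are the two properties under which the identity plus such a
  function is an optimal map.\<close>

lemma ramp_comb_bounded_lipschitz:
  "\<exists>B K. 0 \<le> B \<and> 0 \<le> K \<and> (\<forall>x. \<bar>ramp_comb l x\<bar> \<le> B) \<and> (\<forall>x y. \<bar>ramp_comb l x - ramp_comb l y\<bar> \<le> K * \<bar>x - y\<bar>)"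
proof (induction l)
  case Nil
  show ?case by (intro exI[of _ 0]) auto
next
  case (Cons p l)
  obtain c q n where p: "p = (c, q, n)" by (cases p)
  obtain B K where BK: "0 \<le> B" "0 \<le> K" "\<And>x. \<bar>ramp_comb l x\<bar> \<le> B"
    "\<And>x y. \<bar>ramp_comb l x - ramp_comb l y\<bar> \<le> K * \<bar>x - y\<bar>"
    using Cons.IH by blast
  let ?c = "real_of_rat c" and ?r = "ramp (real_of_rat q) n"
  have "\<bar>ramp_comb (p # l) x\<bar> \<le> \<bar>?c\<bar> + B" for x
  proof -
    have "\<bar>?c * ?r x\<bar> \<le> \<bar>?c\<bar> * 1"
      unfolding abs_mult by (intro mult_left_mono ramp_bounds) auto
    then show ?thesis using BK(3)[of x] by (simp add: p ramp_comb_Cons)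
  qed
  moreover have "\<bar>ramp_comb (p # l) x - ramp_comb (p # l) y\<bar> \<le> (\<bar>?c\<bar> * real n + K) * \<bar>x - y\<bar>" for x y
  proof -
    have "\<bar>?c * (?r x - ?r y)\<bar> \<le> \<bar>?c\<bar> * (real n * \<bar>x - y\<bar>)"
      unfolding abs_mult by (intro mult_left_mono ramp_lipschitz) auto
    moreover have "ramp_comb (p # l) x - ramp_comb (p # l) y
        = ?c * (?r x - ?r y) + (ramp_comb l x - ramp_comb l y)"
      by (simp add: p ramp_comb_Cons algebra_simps)
    ultimately show ?thesis using BK(4)[of x y] by (simp add: algebra_simps)
  qed
  moreover have "0 \<le> \<bar>?c\<bar> + B" "0 \<le> \<bar>?c\<bar> * real n + K" using BK by auto
  ultimately show ?case by blast
qed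

lemma ramp_comb_measurable [measurable]: "ramp_comb l \<in> borel_measurable borel"
proof (induction l)
  case (Cons p l)
  obtain c q n where p: "p = (c, q, n)" by (cases p)
  have "ramp_comb (p # l) = (\<lambda>x. real_of_rat c * ramp (real_of_rat q) n x + ramp_comb l x)"
    by (auto simp: p ramp_comb_Cons)
  then show ?case using Cons.IH by simp
next
  case Nil
  have "ramp_comb [] = (\<lambda>x. 0)" by auto
  then show ?case by simp
qed

context w2_density
begin

lemma ramp_comb_L2: "ramp_comb l \<in> L2 f"
  using ramp_comb_bounded_lipschitz[of l] L2_bounded[OF ramp_comb_measurable] by blast

text \<open>Auxiliary to the density proof, at whose end it is seen to contain all of
  \<open>L2 f\<close>.\<close>

definition ramp_closure :: "(real \<Rightarrow> real) set" where
  "ramp_closure = {g \<in> L2 f. \<forall>e>0. \<exists>l. L2norm f (\<lambda>u. g u - ramp_comb l u) < e}"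

lemma ramp_closure_subset: "g \<in> ramp_closure \<Longrightarrow> g \<in> L2 f"
  by (simp add: ramp_closure_def)

lemma ramp_closure_closed:
  assumes g: "g \<in> L2 f" and ap: "\<And>e. e > 0 \<Longrightarrow> \<exists>h\<in>ramp_closure. L2norm f (\<lambda>u. g u - h u) < e"
  shows "g \<in> ramp_closure"
proof -
  have "\<exists>l. L2norm f (\<lambda>u. g u - ramp_comb l u) < e" if e: "e > 0" for e
  proof -
    obtain h where h: "h \<in> ramp_closure" "L2norm f (\<lambda>u. g u - h u) < e/2"
      using ap[of "e/2"] e by auto
    obtain l where l: "L2norm f (\<lambda>u. h u - ramp_comb l u) < e/2"
      using h(1) half_gt_zero[OF e] unfolding ramp_closure_def by blast
    show ?thesis
      using L2norm_triangle_diff[OF g ramp_closure_subset[OF h(1)] ramp_comb_L2[of l]] h(2) l by (intro exI[of _ l]) linarith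
  qed
  then show ?thesis using g by (simp add: ramp_closure_def)
qed

lemma ramp_closure_limit:
  assumes "g \<in> L2 f" "\<And>n. h n \<in> ramp_closure" "(\<lambda>n. L2norm f (\<lambda>u. g u - h n u)) \<longlonglongrightarrow> 0"
  shows "g \<in> ramp_closure"
proof (rule ramp_closure_closed[OF assms(1)])
  fix e :: real assume "e > 0"
  then have "\<forall>\<^sub>F n in sequentially. L2norm f (\<lambda>u. g u - h n u) < e"
    using assms(3) by (rule order_tendstoD(2)[rotated])
  then show "\<exists>h\<in>ramp_closure. L2norm f (\<lambda>u. g u - h u) < e"
    using assms(2) by (auto simp: eventually_sequentially)
qed

lemma ramp_closure_0: "(\<lambda>u. 0) \<in> ramp_closure"
  unfolding ramp_closure_def
  by (auto simp: L2_const L2norm_def intro!: exI[of _ "[]"])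

lemma ramp_closure_add:
  assumes g: "g \<in> ramp_closure" and h: "h \<in> ramp_closure"
  shows "(\<lambda>u. g u + h u) \<in> ramp_closure"
proof -
  have "\<exists>l. L2norm f (\<lambda>u. g u + h u - ramp_comb l u) < e" if e: "e > 0" for e
  proof -
    obtain l where l: "L2norm f (\<lambda>u. g u - ramp_comb l u) < e/2"
      using g half_gt_zero[OF e] unfolding ramp_closure_def by blast
    obtain l' where l': "L2norm f (\<lambda>u. h u - ramp_comb l' u) < e/2"
      using h half_gt_zero[OF e] unfolding ramp_closure_def by blast
    have "(\<lambda>u. g u + h u - ramp_comb (l @ l') u)
        = (\<lambda>u. (g u - ramp_comb l u) + (h u - ramp_comb l' u))"
      by (auto simp: ramp_comb_append)
    then have "L2norm f (\<lambda>u. g u + h u - ramp_comb (l @ l') u) < e"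
      using L2norm_triangle[OF L2_diff[OF ramp_closure_subset[OF g] ramp_comb_L2[of l]]
          L2_diff[OF ramp_closure_subset[OF h] ramp_comb_L2[of l']]] l l' by simp
    then show ?thesis by blast
  qed
  then show ?thesis using g h by (simp add: ramp_closure_def L2_add)
qed

lemma ramp_closure_scale:
  assumes g: "g \<in> ramp_closure"
  shows "(\<lambda>u. c * g u) \<in> ramp_closure"
proof -
  have "\<exists>l. L2norm f (\<lambda>u. c * g u - ramp_comb l u) < e" if e: "e > 0" for e
  proof -
    \<comment> \<open>The error is split in halves: one for approximating \<open>g\<close> and
      multiplying by \<open>c\<close>, one for replacing the real \<open>c\<close> by a rational
      \<open>r\<close>. The added 1 keeps both denominators positive when \<open>c\<close> or the
      norm \<open>m\<close> is 0.\<close>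
    have "e / (2 * (\<bar>c\<bar> + 1)) > 0" using e by simp
    then obtain l where l: "L2norm f (\<lambda>u. g u - ramp_comb l u) < e / (2 * (\<bar>c\<bar> + 1))"
      using g unfolding ramp_closure_def by blast
    define m where "m = L2norm f (ramp_comb l)"
    have m: "m \<ge> 0" by (simp add: m_def)
    obtain r where r: "c - e / (2 * (m + 1)) < real_of_rat r" "real_of_rat r < c"
      using of_rat_dense[of "c - e / (2 * (m + 1))" c] e m by auto
    let ?l = "map (\<lambda>(c, p). (r * c, p)) l"
    have "L2norm f (\<lambda>u. c * g u - ramp_comb ?l u)
       = L2norm f (\<lambda>u. c * (g u - ramp_comb l u) + (c - real_of_rat r) * ramp_comb l u)"
      by (simp only: ramp_comb_scale) (simp add: algebra_simps)
    also have "\<dots> \<le> L2norm f (\<lambda>u. c * (g u - ramp_comb l u)) + L2norm f (\<lambda>u. (c - real_of_rat r) * ramp_comb l u)"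
      by (intro L2norm_triangle L2_scale L2_diff ramp_comb_L2 ramp_closure_subset g)
    also have "\<dots> = \<bar>c\<bar> * L2norm f (\<lambda>u. g u - ramp_comb l u) + \<bar>c - real_of_rat r\<bar> * m"
      unfolding m_def
      by (intro arg_cong2[of _ _ _ _ "(+)"] L2norm_scale L2_measurable L2_diff ramp_comb_L2 ramp_closure_subset g)
    also have "\<dots> < e"
    proof -
      have "\<bar>c\<bar> * L2norm f (\<lambda>u. g u - ramp_comb l u) \<le> \<bar>c\<bar> * (e / (2 * (\<bar>c\<bar> + 1)))"
        using l by (intro mult_left_mono) auto
      also have "\<dots> < e / 2" using e by (simp add: field_simps)
      finally have 1: "\<bar>c\<bar> * L2norm f (\<lambda>u. g u - ramp_comb l u) < e / 2" .
      have "\<bar>c - real_of_rat r\<bar> * m \<le> e / (2 * (m + 1)) * m"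
        using r m by (intro mult_right_mono) auto
      also have "\<dots> \<le> e / 2" using e m by (simp add: field_simps)
      finally show ?thesis using 1 by simp
    qed
    finally show ?thesis by blast
  qed
  then show ?thesis using g by (simp add: ramp_closure_def L2_scale)
qed

lemma ramp_in_closure: "ramp (real_of_rat q) n \<in> ramp_closure"
proof -
  have "ramp_comb [(1, q, n)] = ramp (real_of_rat q) n"
    by (auto simp: ramp_comb_def)
  then show ?thesis
    using ramp_comb_L2[of "[(1, q, n)]"] unfolding ramp_closure_def
    by (auto simp: L2norm_def intro!: exI[of _ "[(1, q, n)]"])
qed

lemma indicator_atMost_in_closure: "indicat_real {..x} \<in> ramp_closure"
proof -
  \<comment> \<open>A breakpoint strictly to the right of \<open>x\<close> together with slope
    \<open>Suc n\<close> makes the ramp equal to 1 up to \<open>x\<close> and 0 beyond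
    \<open>x + 2 / Suc n\<close>.\<close>
  have "\<exists>q. x < real_of_rat q \<and> real_of_rat q < x + 1 / real (Suc n)" for n
    by (rule of_rat_dense) simp
  then obtain q where q: "\<And>n. x < real_of_rat (q n)" "\<And>n. real_of_rat (q n) < x + 1 / real (Suc n)"
    by metis
  let ?r = "\<lambda>n. ramp (real_of_rat (q n)) (Suc n)"
  have lim: "(\<lambda>n. indicat_real {..x} u - ?r n u) \<longlonglongrightarrow> 0" for u
  proof (cases "u \<le> x")
    case True
    have "?r n u = 1" for n
    proof -
      have "real (Suc n) * (u - real_of_rat (q n)) \<le> 0"
        using q(1)[of n] True by (intro mult_nonneg_nonpos) auto
      then show ?thesis by (simp add: ramp_def)
    qed
    then show ?thesis using True by simp
  next
    case False
    then have "(u - x) / 2 > 0" by simp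
    then obtain N where N: "inverse (real (Suc N)) < (u - x) / 2"
      using reals_Archimedean by blast
    have "?r n u = 0" if "n \<ge> N" for n
    proof -
      define a where "a = 1 / real (Suc n)"
      have "a \<le> inverse (real (Suc N))" using that by (simp add: a_def field_simps)
      then have "a \<le> u - real_of_rat (q n)" using q(2)[of n] N unfolding a_def[symmetric] by argo
      then have "1 / real (Suc n) \<le> u - real_of_rat (q n)" by (simp only: a_def)
      then have "1 \<le> real (Suc n) * (u - real_of_rat (q n))" by (simp add: field_simps)
      then show ?thesis by (simp add: ramp_def)
    qed
    then show ?thesis using False
      by (intro tendsto_eventually) (auto simp: eventually_sequentially intro!: exI[of _ N])
  qed
  show ?thesis
  proof (rule ramp_closure_limit[where h = ?r])
    show "indicat_real {..x} \<in> L2 f"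
      by (rule L2_bounded[where B = 1]) (auto simp: indicator_def)
    show "(\<lambda>n. L2norm f (\<lambda>u. indicat_real {..x} u - ?r n u)) \<longlonglongrightarrow> 0"
    proof (rule L2norm_tendsto_dominated[OF L2_const[of 1]])
      show "AE u in \<mu>. \<bar>indicat_real {..x} u - ?r n u\<bar> \<le> \<bar>1\<bar>" for n
        using ramp_bounds[of "real_of_rat (q n)" "Suc n"]
        by (intro AE_I2) (simp add: indicator_def)
    qed (use lim in auto)
  qed (rule ramp_in_closure)
qed

text \<open>Half-lines are stable under intersection, and the sets with indicator in the closure
  form a Dynkin system: complements need the constant 1, itself a limit of half-lines, and disjoint
  unions follow by dominated convergence.\<close>

lemma indicator_in_closure:
  assumes "A \<in> sets borel"
  shows "indicat_real A \<in> ramp_closure"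
proof -
  have sb: "\<And>A. A \<in> sigma_sets UNIV (range atMost) \<Longrightarrow> A \<in> sets (borel :: real measure)"
    by (simp add: borel_eq_atMost)
  have one: "(\<lambda>u. 1) \<in> ramp_closure"
  proof (rule ramp_closure_limit[where h = "\<lambda>n. indicat_real {..real n}"])
    show "(\<lambda>n. L2norm f (\<lambda>u. 1 - indicat_real {..real n} u)) \<longlonglongrightarrow> 0"
    proof (rule L2norm_tendsto_dominated[OF L2_const[of 1]])
      have "(\<lambda>n. 1 - indicat_real {..real n} u) \<longlonglongrightarrow> 0" for u
      proof -
        obtain N where "u \<le> real N" using real_arch_simple by blast
        then show ?thesis
          by (intro tendsto_eventually) (auto simp: eventually_sequentially intro!: exI[of _ N])
      qed
      then show "AE u in \<mu>. (\<lambda>n. 1 - indicat_real {..real n} u) \<longlonglongrightarrow> 0" by simp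
    qed (auto simp: indicator_def)
  qed (auto simp: L2_const indicator_atMost_in_closure)
  have "Int_stable (range (atMost :: real \<Rightarrow> real set))"
    by (auto simp: Int_stable_def)
  moreover have "range (atMost :: real \<Rightarrow> real set) \<subseteq> Pow UNIV" by simp
  moreover have "A \<in> sigma_sets UNIV (range atMost)" using assms by (simp add: borel_eq_atMost)
  ultimately show ?thesis
  proof (induction rule: sigma_sets_induct_disjoint)
    case (basic A)
    then show ?case using indicator_atMost_in_closure by auto
  next
    case empty
    then show ?case using ramp_closure_0 by simp
  next
    case (compl A)
    have "indicat_real (UNIV - A) = (\<lambda>u. 1 + (-1) * indicat_real A u)"
      by (auto simp: indicator_def)
    then show ?case using ramp_closure_add[OF one ramp_closure_scale[OF compl(2), of "-1"]] by simp
  next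
    case (union A)
    have [measurable]: "A i \<in> sets borel" for i using sb union(2) by blast
    have fin: "(\<lambda>u. \<Sum>i<n. indicat_real (A i) u) \<in> ramp_closure" for n
      by (induction n) (auto intro: ramp_closure_0 ramp_closure_add union(3))
    have eq: "(\<Sum>i<n. indicat_real (A i) u) = indicat_real (\<Union>i<n. A i) u" for n u
    proof -
      have "disjoint_family_on A {..<n}" using union(1) by (auto simp: disjoint_family_on_def)
      then show ?thesis by (simp add: indicator_UN_disjoint)
    qed
    show ?case
    proof (rule ramp_closure_limit[where h = "\<lambda>n u. \<Sum>i<n. indicat_real (A i) u"])
      show "indicat_real (\<Union> (range A)) \<in> L2 f"
        by (rule L2_bounded[where B = 1]) (auto simp: indicator_def)
      show "(\<lambda>n. L2norm f (\<lambda>u. indicat_real (\<Union> (range A)) u - (\<Sum>i<n. indicat_real (A i) u))) \<longlonglongrightarrow> 0"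
      proof (rule L2norm_tendsto_dominated[OF L2_const[of 1]])
        have "(\<lambda>n. indicat_real (\<Union> (range A)) u - (\<Sum>i<n. indicat_real (A i) u)) \<longlonglongrightarrow> 0" for u
          unfolding eq using tendsto_diff[OF tendsto_const[of "indicat_real (\<Union> (range A)) u"] LIMSEQ_indicator_UN[of A u]] by simp
        then show "AE u in \<mu>. (\<lambda>n. indicat_real (\<Union> (range A)) u - (\<Sum>i<n. indicat_real (A i) u)) \<longlonglongrightarrow> 0"
          by simp
      qed (unfold eq, auto simp: indicator_def)
    qed (rule fin)
  qed
qed

lemma nonneg_L2_in_closure:
  assumes "u \<in> borel_measurable borel" "\<And>x. 0 \<le> u x" "u \<in> L2 f"
  shows "u \<in> ramp_closure"
proof -
  \<comment> \<open>The induction runs over all nonnegative Borel functions, so square integrability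
    becomes a premise of the claim; each building block inherits it by domination from the function
    built.\<close>
  from assms(1,2) have "u \<in> L2 f \<longrightarrow> u \<in> ramp_closure"
  proof (induction rule: borel_measurable_induct_real)
    case (set A)
    then show ?case using indicator_in_closure by simp
  next
    case (mult u c)
    show ?case
    proof (cases "c = 0")
      case True
      then show ?thesis using ramp_closure_0 by simp
    next
      case False
      then show ?thesis
        using L2_scale[of "\<lambda>x. c * u x" "1/c"] mult ramp_closure_scale[of u c] by auto
    qed
  next
    case (add u v)
    show ?case
    proof
      assume s: "(\<lambda>x. v x + u x) \<in> L2 f"
      have "u \<in> L2 f" "v \<in> L2 f"
        using add by (auto intro!: L2_bound[OF s] AE_I2)
      then show "(\<lambda>x. v x + u x) \<in> ramp_closure"
        using add ramp_closure_add by auto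
    qed
  next
    case (seq U)
    show ?case
    proof
      assume u: "u \<in> L2 f"
      have le: "U i x \<le> u x" for i x
        using incseq_le[of "\<lambda>i. U i x" "u x"] seq by (auto simp: incseq_def le_fun_def)
      have U: "U i \<in> ramp_closure" for i
        using seq le L2_bound[OF u, of "U i"] by (auto intro!: AE_I2 simp: abs_of_nonneg order_trans[OF seq(2) le])
      show "u \<in> ramp_closure"
      proof (rule ramp_closure_limit[OF u U])
        show "(\<lambda>n. L2norm f (\<lambda>x. u x - U n x)) \<longlonglongrightarrow> 0"
        proof (rule L2norm_tendsto_dominated[OF u])
          show "AE x in \<mu>. (\<lambda>n. u x - U n x) \<longlonglongrightarrow> 0"
            using seq by (auto intro!: AE_I2 tendsto_eq_intros)
          show "AE x in \<mu>. \<bar>u x - U n x\<bar> \<le> \<bar>u x\<bar>" for n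
            using le seq(2) by (intro AE_I2) (simp add: abs_if, smt (verit))
        qed (use seq L2_measurable[OF u] in auto)
      qed
    qed
  qed
  then show ?thesis using assms(3) by simp
qed

text \<open>Separability of \<open>L2 f\<close>, used both to identify the tangent space and to show
  that sums of random elements are measurable.\<close>

lemma ramp_comb_dense:
  assumes g: "g \<in> L2 f" and e: "e > 0"
  shows "\<exists>l. L2norm f (\<lambda>u. g u - ramp_comb l u) < e"
proof -
  note [measurable] = L2_measurable[OF g]
  have p: "(\<lambda>u. max 0 (g u)) \<in> ramp_closure" "(\<lambda>u. max 0 (- g u)) \<in> ramp_closure"
    by (auto intro!: nonneg_L2_in_closure L2_bound[OF g] AE_I2)
  have "(\<lambda>u. max 0 (g u) + (-1) * max 0 (- g u)) = g" by (auto simp: max_def)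
  then have "g \<in> ramp_closure"
    using ramp_closure_add[OF p(1) ramp_closure_scale[OF p(2), of "-1"]] by simp
  then show ?thesis using e by (simp add: ramp_closure_def)
qed

end

subsection \<open>The tangent space\<close>

context w2_density
begin

text \<open>Optimality by duality: for the convex potential \<open>\<phi>\<close> with \<open>\<phi>' = T\<close> and its Legendre
  conjugate \<open>\<psi>\<close>, Young's inequality \<open>x * y \<le> \<phi> x + \<psi> y\<close> is an equality at \<open>y = T x\<close>, and
  the integral of \<open>\<psi> \<circ> S\<close> only depends on the image measure under \<open>S\<close>.\<close>

lemma optimal_map_lipschitz_perturbation:
  assumes bd: "\<And>x. \<bar>h x\<bar> \<le> B" and K: "K < 1" and lip: "\<And>x y. \<bar>h x - h y\<bar> \<le> K * \<bar>x - y\<bar>"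
  defines "T \<equiv> \<lambda>x. x + h x"
  shows "optimal_map \<mu> (distr \<mu> borel T) T" and "W2_measure (distr \<mu> borel T)"
proof -
  have "(max K 0)-lipschitz_on UNIV h"
  proof (rule lipschitz_onI)
    fix x y
    have "K * \<bar>x - y\<bar> \<le> max K 0 * \<bar>x - y\<bar>" by (intro mult_right_mono) auto
    then show "dist (h x) (h y) \<le> max K 0 * dist x y"
      using lip[of x y] by (simp add: dist_real_def)
  qed simp
  then have "continuous_on UNIV h" by (rule lipschitz_on_continuous_on)
  then have contT: "continuous_on UNIV T" unfolding T_def by (intro continuous_intros)
  then have [measurable]: "T \<in> borel_measurable borel" by (rule borel_measurable_continuous_onI)
  have [measurable]: "h \<in> borel_measurable borel"
    by (rule borel_measurable_continuous_onI) fact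
  have less: "T x < T y" if "x < y" for x y
  proof -
    have "(1 - K) * (y - x) > 0" using K that by simp
    then show ?thesis using lip[of y x] that by (simp add: T_def algebra_simps)
  qed
  then have sm: "strict_mono T" by (simp add: strict_mono_def)
  \<comment> \<open>Boundedness of \<open>h\<close> enters: \<open>T (y - B)\<close> and
    \<open>T (y + B)\<close> enclose \<open>y\<close>, so the intermediate value theorem
    applies.\<close>
  have surj: "\<exists>x. T x = y" for y
  proof -
    have "B \<ge> 0" using bd[of 0] by linarith
    moreover have "T (y - B) \<le> y" "y \<le> T (y + B)"
      using bd[of "y - B"] bd[of "y + B"] by (auto simp: T_def)
    ultimately show ?thesis
      using IVT'[of T "y - B" y "y + B"] continuous_on_subset[OF contT] by fastforce
  qed
  define R where "R = inv T"
  have RT: "R (T x) = x" and TR: "T (R y) = y" for x y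
    using strict_mono_imp_inj_on[OF sm] surj by (auto simp: R_def inv_f_f f_inv_into_f image_iff) (metis f_inv_into_f rangeI surj)
  have "mono R"
    by (rule monoI) (metis TR less not_le)
  then have [measurable]: "R \<in> borel_measurable borel" by (rule borel_measurable_mono)
  have "\<exists>\<phi>. \<forall>x::real. - \<infinity> < ereal x \<longrightarrow> ereal x < \<infinity> \<longrightarrow> (\<phi> has_vector_derivative T x) (at x)"
    using contT by (intro einterval_antiderivative) (auto simp: continuous_on_eq_continuous_at)
  then obtain \<phi> where \<phi>: "\<And>x. (\<phi> has_real_derivative T x) (at x)"
    by (auto simp: has_real_derivative_iff_has_vector_derivative)
  then have [measurable]: "\<phi> \<in> borel_measurable borel"
    by (intro borel_measurable_continuous_onI)
      (auto intro!: DERIV_isCont simp: continuous_on_eq_continuous_at)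
  have convex: "\<phi> z + T z * (x - z) \<le> \<phi> x" for x z
  proof (cases rule: linorder_cases[of x z])
    case less
    then obtain c where c: "x < c" "c < z" "\<phi> z - \<phi> x = (z - x) * T c"
      using MVT2[of x z \<phi> T] \<phi> by auto
    have "(z - x) * T c \<le> (z - x) * T z"
      using less c strict_mono_less_eq[OF sm, of c z] by (intro mult_left_mono) auto
    then show ?thesis using c by (simp add: algebra_simps)
  next
    case greater
    then obtain c where c: "z < c" "c < x" "\<phi> x - \<phi> z = (x - z) * T c"
      using MVT2[of z x \<phi> T] \<phi> by auto
    have "(x - z) * T c \<ge> (x - z) * T z"
      using greater c strict_mono_less_eq[OF sm, of z c] by (intro mult_left_mono) auto
    then show ?thesis using c by (simp add: algebra_simps)
  qed simp
  define \<psi> where "\<psi> y = y * R y - \<phi> (R y)" for y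
  have [measurable]: "\<psi> \<in> borel_measurable borel" unfolding \<psi>_def by measurable
  have young: "x * y \<le> \<phi> x + \<psi> y" for x y
    using convex[of "R y" x] by (simp add: \<psi>_def TR algebra_simps)
  have \<psi>T: "\<psi> (T x) = x * T x - \<phi> x" for x
    by (simp add: \<psi>_def RT)
  have hL2: "h \<in> L2 f" by (rule L2_bounded[OF _ bd]) simp
  have TL2: "T \<in> L2 f" unfolding T_def by (rule L2_add[OF id_in_L2 hL2])
  have xT: "integrable \<mu> (\<lambda>x. x * T x)" by (rule L2_mult_integrable[OF id_in_L2 TL2])
  have int_x: "integrable \<mu> (\<lambda>x. x)" using L2_mult_integrable[OF id_in_L2 L2_const[of 1]] by simp
  have int_\<phi>: "integrable \<mu> \<phi>"
  proof (rule Bochner_Integration.integrable_bound)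
    show "integrable \<mu> (\<lambda>x. \<bar>\<phi> 0\<bar> + \<bar>x * T x\<bar> + \<bar>T 0\<bar> * \<bar>x\<bar>)"
      using xT int_x by (intro Bochner_Integration.integrable_add integrable_abs integrable_mult_right) auto
    \<comment> \<open>The tangent line at 0 bounds \<open>\<phi> x\<close> from below; the tangent
      line at \<open>x\<close>, evaluated at 0, bounds it from above.\<close>
    have "\<bar>\<phi> x\<bar> \<le> \<bar>\<phi> 0\<bar> + \<bar>x * T x\<bar> + \<bar>T 0\<bar> * \<bar>x\<bar>" for x
      using convex[of 0 x] convex[of x 0] abs_mult[of "T 0" x] by (simp add: mult.commute)
    then show "AE x in \<mu>. norm (\<phi> x) \<le> norm (\<bar>\<phi> 0\<bar> + \<bar>x * T x\<bar> + \<bar>T 0\<bar> * \<bar>x\<bar>)"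
      by (intro AE_I2) (smt (verit) real_norm_def)
  qed simp
  have int_\<psi>T: "integrable \<mu> (\<lambda>x. \<psi> (T x))"
    unfolding \<psi>T by (intro Bochner_Integration.integrable_diff xT int_\<phi>)
  \<comment> \<open>A competitor with the same image measure has the same second moment, so
    comparing costs amounts to comparing the integrals of \<open>x * S x\<close>.\<close>
  have sq: "(\<integral>\<^sup>+ x. ennreal ((S x - x)\<^sup>2) \<partial>\<mu>)
      = ennreal ((\<integral>x. (S x)\<^sup>2 \<partial>\<mu>) - 2 * (\<integral>x. x * S x \<partial>\<mu>) + (\<integral>x. x\<^sup>2 \<partial>\<mu>))"
    if S: "S \<in> L2 f" for S
  proof -
    have i: "integrable \<mu> (\<lambda>x. (S x)\<^sup>2)" "integrable \<mu> (\<lambda>x. x\<^sup>2)" "integrable \<mu> (\<lambda>x. x * S x)"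
      using L2_integrable[OF S] L2_integrable[OF id_in_L2] L2_mult_integrable[OF id_in_L2 S] by auto
    have eq: "(S x - x)\<^sup>2 = (S x)\<^sup>2 - 2 * (x * S x) + x\<^sup>2" for x
      by (simp add: power2_diff)
    have "integrable \<mu> (\<lambda>x. (S x - x)\<^sup>2)"
      using L2_integrable[OF L2_diff[OF S id_in_L2]] .
    then have "(\<integral>\<^sup>+ x. ennreal ((S x - x)\<^sup>2) \<partial>\<mu>) = ennreal (\<integral>x. (S x - x)\<^sup>2 \<partial>\<mu>)"
      by (rule nn_integral_eq_integral) simp
    also have "(\<integral>x. (S x - x)\<^sup>2 \<partial>\<mu>) = (\<integral>x. (S x)\<^sup>2 \<partial>\<mu>) - 2 * (\<integral>x. x * S x \<partial>\<mu>) + (\<integral>x. x\<^sup>2 \<partial>\<mu>)"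
      unfolding eq using i by simp
    finally show ?thesis .
  qed
  show "optimal_map \<mu> (distr \<mu> borel T) T"
    unfolding optimal_map_def
  proof (intro conjI ballI impI)
    fix S :: "real \<Rightarrow> real"
    assume S[measurable]: "S \<in> borel_measurable borel" and eq: "distr \<mu> borel S = distr \<mu> borel T"
    \<comment> \<open>Equal image measures give equal integrals of every function of the image
      point. This supplies the square integrability of \<open>S\<close>, which optimality does not
      presuppose, and the integral of \<open>\<psi> (S x)\<close>.\<close>
    have transfer: "integrable \<mu> (\<lambda>x. k (S x)) \<and> (\<integral>x. k (S x) \<partial>\<mu>) = (\<integral>x. k (T x) \<partial>\<mu>)"
      if [measurable]: "k \<in> borel_measurable borel" and i: "integrable \<mu> (\<lambda>x. k (T x))"
      for k :: "real \<Rightarrow> real"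
    proof -
      have "integrable (distr \<mu> borel T) k" using i by (subst integrable_distr_eq) auto
      then have "integrable (distr \<mu> borel S) k" unfolding eq .
      then have "integrable \<mu> (\<lambda>x. k (S x))" by (subst (asm) integrable_distr_eq) auto
      moreover have "(\<integral>y. k y \<partial>distr \<mu> borel S) = (\<integral>y. k y \<partial>distr \<mu> borel T)" unfolding eq ..
      then have "(\<integral>x. k (S x) \<partial>\<mu>) = (\<integral>x. k (T x) \<partial>\<mu>)"
        by (subst (asm) (1 2) integral_distr) auto
      ultimately show ?thesis by simp
    qed
    have S2: "integrable \<mu> (\<lambda>x. (S x)\<^sup>2)" "(\<integral>x. (S x)\<^sup>2 \<partial>\<mu>) = (\<integral>x. (T x)\<^sup>2 \<partial>\<mu>)"
      using transfer[of "\<lambda>y. y\<^sup>2"] L2_integrable[OF TL2] by auto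
    have SL2: "S \<in> L2 f" using S2(1) by (simp add: L2_def)
    have S\<psi>: "integrable \<mu> (\<lambda>x. \<psi> (S x))" "(\<integral>x. \<psi> (S x) \<partial>\<mu>) = (\<integral>x. \<psi> (T x) \<partial>\<mu>)"
      using transfer[of \<psi>] int_\<psi>T by auto
    have "(\<integral>x. x * S x \<partial>\<mu>) \<le> (\<integral>x. \<phi> x + \<psi> (S x) \<partial>\<mu>)"
      using young by (intro integral_mono Bochner_Integration.integrable_add L2_mult_integrable[OF id_in_L2 SL2] int_\<phi> S\<psi>) auto
    also have "\<dots> = (\<integral>x. \<phi> x \<partial>\<mu>) + (\<integral>x. \<psi> (T x) \<partial>\<mu>)"
      using int_\<phi> S\<psi> by simp
    also have "\<dots> = (\<integral>x. x * T x \<partial>\<mu>)"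
      unfolding \<psi>T using int_\<phi> xT by simp
    finally show "(\<integral>\<^sup>+ x. ennreal ((T x - x)\<^sup>2) \<partial>\<mu>) \<le> (\<integral>\<^sup>+ x. ennreal ((S x - x)\<^sup>2) \<partial>\<mu>)"
      unfolding sq[OF TL2] sq[OF SL2] S2(2) by (intro ennreal_leI) simp
  qed auto
  show "W2_measure (distr \<mu> borel T)"
    unfolding W2_measure_def
  proof (intro conjI)
    show "prob_space (distr \<mu> borel T)" by (rule prob_space_distr) simp
    show "(\<integral>\<^sup>+ x. ennreal (x\<^sup>2) \<partial>distr \<mu> borel T) < \<infinity>"
      using TL2 by (subst nn_integral_distr) (auto simp: L2_iff_nn_integral)
  qed simp
qed

text \<open>A dense set of functions already has the form \<open>lam * (T - id)\<close> with
  \<open>T\<close> optimal: divide a Lipschitz function by a constant that brings its Lipschitz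
  constant below 1.\<close>

lemma tangent_eq_L2: "tangent f = L2 f"
proof -
  have "g \<in> tangent f \<longleftrightarrow> g \<in> L2 f" for g
  proof
    assume "g \<in> tangent f"
    then show "g \<in> L2 f"
      by (auto simp: tangent_def L2_iff_nn_integral nn_integral_weight)
  next
    assume g: "g \<in> L2 f"
    have "\<exists>lam>0. \<exists>\<nu> T. W2_measure \<nu> \<and> optimal_map \<mu> \<nu> T \<and> L2norm f (\<lambda>u. g u - lam * (T u - u)) < e"
      if e: "e > 0" for e
    proof -
      obtain l where l: "L2norm f (\<lambda>u. g u - ramp_comb l u) < e"
        using ramp_comb_dense[OF g e] by blast
      obtain B K where BK: "0 \<le> B" "0 \<le> K" "\<And>x. \<bar>ramp_comb l x\<bar> \<le> B"
        "\<And>x y. \<bar>ramp_comb l x - ramp_comb l y\<bar> \<le> K * \<bar>x - y\<bar>"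
        using ramp_comb_bounded_lipschitz[of l] by blast
      \<comment> \<open>\<open>K + 1\<close> gives the Lipschitz constant
        \<open>K / (K + 1)\<close>, which is below 1, and stays positive when \<open>K\<close> is
        0.\<close>
      define lam where "lam = K + 1"
      have lam: "lam > 0" using BK by (simp add: lam_def)
      define h where "h x = ramp_comb l x / lam" for x
      have 1: "\<bar>h x\<bar> \<le> B / lam" for x
        using BK(3)[of x] lam by (simp add: h_def divide_right_mono)
      have 2: "\<bar>h x - h y\<bar> \<le> K / lam * \<bar>x - y\<bar>" for x y
      proof -
        have "\<bar>h x - h y\<bar> = \<bar>ramp_comb l x - ramp_comb l y\<bar> / lam"
          using lam by (simp add: h_def flip: diff_divide_distrib)
        also have "\<dots> \<le> (K * \<bar>x - y\<bar>) / lam"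
          using BK(4)[of x y] lam by (intro divide_right_mono) auto
        finally show ?thesis by simp
      qed
      have 3: "K / lam < 1" using BK by (simp add: lam_def)
      have "(\<lambda>u. g u - lam * (u + h u - u)) = (\<lambda>u. g u - ramp_comb l u)"
        using lam by (auto simp: h_def)
      then show ?thesis
        using optimal_map_lipschitz_perturbation[OF 1 3 2] lam l by metis
    qed
    then show "g \<in> tangent f"
      using g by (auto simp: tangent_def L2_iff_nn_integral nn_integral_weight)
  qed
  then show ?thesis by blast
qed

end

subsection \<open>Strict stationarity and measurability in the tangent space\<close>

lemma measurable_coord_shift:
  assumes "\<And>t::int. X t \<in> measurable M N"
  shows "(\<lambda>\<omega> t. X (t + h) \<omega>) \<in> measurable M (PiM UNIV (\<lambda>_. N))"
  using assms by (intro measurable_PiM_single') (auto dest: measurable_space)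

text \<open>Independence makes the path law a product of copies of one marginal, and such a product
  is invariant under reindexing by an injective map, here the shift.\<close>

lemma strictly_stationary_iid:
  fixes X :: "int \<Rightarrow> 'a \<Rightarrow> 'b"
  assumes P: "prob_space M" and meas: "\<And>t. X t \<in> measurable M N"
    and indep: "prob_space.indep_vars M (\<lambda>_. N) X UNIV"
    and ident: "\<And>t. distr M N (X t) = distr M N (X 0)"
  shows "strictly_stationary M N X"
proof -
  interpret prob_space M by (rule P)
  have "distr M (PiM UNIV (\<lambda>_. N)) (\<lambda>\<omega> t. X (t + h) \<omega>) = PiM UNIV (\<lambda>_. distr M N (X 0))" for h
  proof -
    let ?D = "distr M N (X 0)" and ?N = "PiM (UNIV::int set) (\<lambda>_. N)"
    have "distr M ?N (\<lambda>\<omega> t. X (t + 0) \<omega>) = PiM UNIV (\<lambda>t. distr M N (X t))"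
      using indep_vars_iff_distr_eq_PiM[where I = UNIV and M' = "\<lambda>_. N" and X = X] meas indep by (simp add: restrict_UNIV)
    also have "\<dots> = PiM UNIV (\<lambda>_. ?D)"
      by (intro PiM_cong refl ident)
    finally have 0: "distr M ?N (\<lambda>\<omega> t. X (t + 0) \<omega>) = PiM UNIV (\<lambda>_. ?D)" .
    have "distr M ?N (\<lambda>\<omega> t. X (t + h) \<omega>)
        = distr (distr M ?N (\<lambda>\<omega> t. X (t + 0) \<omega>)) ?N (\<lambda>x t. x (t + h))"
      using measurable_coord_shift[of X, OF meas, of 0]
      by (subst distr_distr) (auto simp: comp_def intro!: measurable_coord_shift)
    also have "\<dots> = distr (PiM UNIV (\<lambda>_. ?D)) (PiM UNIV (\<lambda>_. ?D)) (\<lambda>x. \<lambda>t\<in>UNIV. x (t + h))"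
      unfolding 0 restrict_UNIV by (intro distr_cong sets_PiM_cong refl) simp
    also have "\<dots> = PiM UNIV (\<lambda>_. ?D)"
      using meas[of 0] by (intro distr_PiM_reindex) (auto simp: inj_on_def prob_space_distr)
    finally show ?thesis .
  qed
  from this this[of 0] show ?thesis
    using meas by (simp add: strictly_stationary_def)
qed

text \<open>The path events of \<open>X\<close> that agree, up to null sets and compatibly with every shift, with a
  path event of \<open>Y\<close> form a \<open>\<sigma>\<close>-algebra, so it suffices to treat generators; no intersection-stable
  generator is needed.\<close>

lemma strictly_stationary_transfer:
  fixes X :: "int \<Rightarrow> 'a \<Rightarrow> 'b" and Y :: "int \<Rightarrow> 'a \<Rightarrow> 'c"
  assumes Y: "strictly_stationary M N Y"
    and G: "G \<subseteq> Pow \<Omega>"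
    and X: "\<And>t. X t \<in> measurable M (sigma \<Omega> G)"
    and gen: "\<And>t A. A \<in> G \<Longrightarrow> \<exists>B\<in>sets (PiM UNIV (\<lambda>_. N)). \<forall>h.
                AE \<omega> in M. X (t + h) \<omega> \<in> A \<longleftrightarrow> (\<lambda>s. Y (s + h) \<omega>) \<in> B"
  shows "strictly_stationary M (sigma \<Omega> G) X"
proof -
  let ?PN = "PiM (UNIV::int set) (\<lambda>_. N)" and ?PX = "PiM (UNIV::int set) (\<lambda>_. sigma \<Omega> G)"
  have Ym: "Y t \<in> measurable M N" for t using Y by (simp add: strictly_stationary_def)
  have X\<Omega>: "X t \<omega> \<in> \<Omega>" if "\<omega> \<in> space M" for t \<omega>
    using measurable_space[OF X that] G by (simp add: space_measure_of)
  have Ysp: "(\<lambda>s. Y (s + h) \<omega>) \<in> space ?PN" if "\<omega> \<in> space M" for h \<omega>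
    using measurable_space[OF measurable_coord_shift[of Y, OF Ym] that] .
  have Xsp: "(\<lambda>s. X (s + h) \<omega>) \<in> space ?PX" if "\<omega> \<in> space M" for h \<omega>
    using measurable_space[OF measurable_coord_shift[of X, OF X] that] .
  \<comment> \<open>One event \<open>B\<close> has to serve all shifts \<open>h\<close>. Unions
    combine countably many exceptional null sets separately for each \<open>h\<close>. The argument
    is carried out for single coordinates first and repeated for path events below.\<close>
  have coord: "\<exists>B\<in>sets ?PN. \<forall>h. AE \<omega> in M. X (t + h) \<omega> \<in> A \<longleftrightarrow> (\<lambda>s. Y (s + h) \<omega>) \<in> B"
    if "A \<in> sigma_sets \<Omega> G" for t A
    using that
  proof (induction rule: sigma_sets.induct)
    case (Basic A)
    then show ?case by (rule gen)
  next
    case Empty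
    show ?case by (intro bexI[of _ "{}"]) auto
  next
    case (Compl A)
    then obtain B where B: "B \<in> sets ?PN" "\<And>h. AE \<omega> in M. X (t + h) \<omega> \<in> A \<longleftrightarrow> (\<lambda>s. Y (s + h) \<omega>) \<in> B"
      by blast
    have "AE \<omega> in M. X (t + h) \<omega> \<in> \<Omega> - A \<longleftrightarrow> (\<lambda>s. Y (s + h) \<omega>) \<in> space ?PN - B" for h
      using B(2)[of h] AE_space by eventually_elim (use X\<Omega> Ysp in auto)
    then show ?case using B(1) by (intro bexI[of _ "space ?PN - B"] allI sets.compl_sets)
  next
    case (Union A)
    have "\<forall>i. \<exists>B. B \<in> sets ?PN \<and> (\<forall>h. AE \<omega> in M. X (t + h) \<omega> \<in> A i \<longleftrightarrow> (\<lambda>s. Y (s + h) \<omega>) \<in> B)"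
      using Union.IH by blast
    from choice[OF this] obtain B where B: "\<And>i. B i \<in> sets ?PN"
      "\<And>i h. AE \<omega> in M. X (t + h) \<omega> \<in> A i \<longleftrightarrow> (\<lambda>s. Y (s + h) \<omega>) \<in> B i"
      by blast
    have "AE \<omega> in M. X (t + h) \<omega> \<in> (\<Union>i. A i) \<longleftrightarrow> (\<lambda>s. Y (s + h) \<omega>) \<in> (\<Union>i. B i)" for h
    proof -
      have "AE \<omega> in M. \<forall>i. X (t + h) \<omega> \<in> A i \<longleftrightarrow> (\<lambda>s. Y (s + h) \<omega>) \<in> B i"
        using B(2) by (subst AE_all_countable) auto
      then show ?thesis by eventually_elim auto
    qed
    then show ?case using B(1) by (intro bexI[of _ "\<Union>i. B i"] allI sets.countable_UN) auto
  qed
  have path: "\<exists>B\<in>sets ?PN. \<forall>h. AE \<omega> in M. (\<lambda>s. X (s + h) \<omega>) \<in> A \<longleftrightarrow> (\<lambda>s. Y (s + h) \<omega>) \<in> B"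
    if "A \<in> sets ?PX" for A
  proof -
    from that have "A \<in> sigma_sets (\<Pi>\<^sub>E i\<in>UNIV. space (sigma \<Omega> G))
        {{f \<in> \<Pi>\<^sub>E i\<in>UNIV. space (sigma \<Omega> G). f i \<in> A} | i A. i \<in> UNIV \<and> A \<in> sets (sigma \<Omega> G)}"
      unfolding sets_PiM_single .
    then show ?thesis
    proof (induction rule: sigma_sets.induct)
      case (Basic A)
      then obtain t C where C: "A = {f \<in> \<Pi>\<^sub>E i\<in>UNIV. space (sigma \<Omega> G). f t \<in> C}" "C \<in> sigma_sets \<Omega> G"
        using G by (auto simp: sets_measure_of)
      obtain B where B: "B \<in> sets ?PN" "\<And>h. AE \<omega> in M. X (t + h) \<omega> \<in> C \<longleftrightarrow> (\<lambda>s. Y (s + h) \<omega>) \<in> B"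
        using coord[OF C(2)] by blast
      have "AE \<omega> in M. (\<lambda>s. X (s + h) \<omega>) \<in> A \<longleftrightarrow> (\<lambda>s. Y (s + h) \<omega>) \<in> B" for h
        using B(2)[of h] AE_space
      proof eventually_elim
        case (elim \<omega>)
        then show ?case using Xsp[of \<omega> h] unfolding C(1) space_PiM by blast
      qed
      then show ?case using B(1) by (intro bexI[of _ B] allI)
    next
      case Empty
      show ?case by (intro bexI[of _ "{}"]) auto
    next
      case (Compl A)
      then obtain B where B: "B \<in> sets ?PN"
        "\<And>h. AE \<omega> in M. (\<lambda>s. X (s + h) \<omega>) \<in> A \<longleftrightarrow> (\<lambda>s. Y (s + h) \<omega>) \<in> B"
        by blast
      have "AE \<omega> in M. (\<lambda>s. X (s + h) \<omega>) \<in> (\<Pi>\<^sub>E i\<in>UNIV. space (sigma \<Omega> G)) - A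
          \<longleftrightarrow> (\<lambda>s. Y (s + h) \<omega>) \<in> space ?PN - B" for h
        using B(2)[of h] AE_space
      proof eventually_elim
        case (elim \<omega>)
        then show ?case using Xsp[of \<omega> h] Ysp[of \<omega> h] unfolding space_PiM by blast
      qed
      then show ?case using B(1) by (intro bexI[of _ "space ?PN - B"] allI sets.compl_sets)
    next
      case (Union A)
      have "\<forall>i. \<exists>B. B \<in> sets ?PN \<and> (\<forall>h. AE \<omega> in M. (\<lambda>s. X (s + h) \<omega>) \<in> A i \<longleftrightarrow> (\<lambda>s. Y (s + h) \<omega>) \<in> B)"
        using Union.IH by blast
      from choice[OF this] obtain B where B: "\<And>i. B i \<in> sets ?PN"
        "\<And>i h. AE \<omega> in M. (\<lambda>s. X (s + h) \<omega>) \<in> A i \<longleftrightarrow> (\<lambda>s. Y (s + h) \<omega>) \<in> B i"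
        by blast
      have "AE \<omega> in M. (\<lambda>s. X (s + h) \<omega>) \<in> (\<Union>i. A i) \<longleftrightarrow> (\<lambda>s. Y (s + h) \<omega>) \<in> (\<Union>i. B i)" for h
      proof -
        have "AE \<omega> in M. \<forall>i. (\<lambda>s. X (s + h) \<omega>) \<in> A i \<longleftrightarrow> (\<lambda>s. Y (s + h) \<omega>) \<in> B i"
          using B(2) by (subst AE_all_countable) auto
        then show ?thesis by eventually_elim auto
      qed
      then show ?case using B(1) by (intro bexI[of _ "\<Union>i. B i"] allI sets.countable_UN) auto
    qed
  qed
  have "distr M ?PX (\<lambda>\<omega> t. X (t + h) \<omega>) = distr M ?PX (\<lambda>\<omega> t. X t \<omega>)" for h
  proof (rule measure_eqI)
    fix A assume "A \<in> sets (distr M ?PX (\<lambda>\<omega> t. X (t + h) \<omega>))"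
    then have A: "A \<in> sets ?PX" by simp
    obtain B where B: "B \<in> sets ?PN"
      "\<And>h. AE \<omega> in M. (\<lambda>s. X (s + h) \<omega>) \<in> A \<longleftrightarrow> (\<lambda>s. Y (s + h) \<omega>) \<in> B"
      using path[OF A] by blast
    \<comment> \<open>As \<open>B\<close> does not depend on \<open>h\<close>, the shifted laws of
      \<open>X\<close> at \<open>A\<close> are the shifted laws of \<open>Y\<close> at one fixed
      event, and these coincide.\<close>
    have eq: "emeasure (distr M ?PX (\<lambda>\<omega> t. X (t + h) \<omega>)) A = emeasure (distr M ?PN (\<lambda>\<omega> t. Y (t + h) \<omega>)) B" for h
    proof -
      note mX = measurable_coord_shift[of X, OF X, of h] and mY = measurable_coord_shift[of Y, OF Ym, of h]
      show ?thesis
        unfolding emeasure_distr[OF mX A] emeasure_distr[OF mY B(1)]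
        using B(2)[of h] measurable_sets[OF mX A] measurable_sets[OF mY B(1)]
        by (intro emeasure_eq_AE) auto
    qed
    have "distr M ?PN (\<lambda>\<omega> t. Y (t + h) \<omega>) = distr M ?PN (\<lambda>\<omega> t. Y (t + 0) \<omega>)"
      using Y by (simp add: strictly_stationary_def)
    then show "emeasure (distr M ?PX (\<lambda>\<omega> t. X (t + h) \<omega>)) A = emeasure (distr M ?PX (\<lambda>\<omega> t. X t \<omega>)) A"
      using eq[of h] eq[of 0] by simp
  qed simp
  then show ?thesis using X by (simp add: strictly_stationary_def)
qed

text \<open>The value at time \<open>t\<close> is coordinate 0 of the path shifted by
  \<open>t\<close>.\<close>

lemma strictly_stationary_distr_eq:
  assumes X: "strictly_stationary M N X" and \<phi>: "\<phi> \<in> measurable N L"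
  shows "distr M L (\<lambda>\<omega>. \<phi> (X t \<omega>)) = distr M L (\<lambda>\<omega>. \<phi> (X 0 \<omega>))"
proof -
  have Xm: "X t \<in> measurable M N" for t using X by (simp add: strictly_stationary_def)
  have "distr M L (\<lambda>\<omega>. \<phi> (X (0 + h) \<omega>))
      = distr (distr M (PiM UNIV (\<lambda>_. N)) (\<lambda>\<omega> t. X (t + h) \<omega>)) L (\<lambda>x. \<phi> (x 0))" for h
    using measurable_coord_shift[of X, OF Xm, of h] \<phi>
    by (subst distr_distr) (auto simp: comp_def)
  from this[of t] this[of 0] X show ?thesis
    by (simp add: strictly_stationary_def)
qed

context w2_density
begin

section \<open>Measurability for the ball \<sigma>-algebra\<close>

lemma space_tangent_borel [simp]: "space (tangent_borel f) = L2 f"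
  unfolding tangent_borel_def tangent_eq_L2 by (rule space_measure_of) auto

lemma L2norm_diff_measurable:
  assumes "g \<in> L2 f"
  shows "(\<lambda>h. L2norm f (\<lambda>u. h u - g u)) \<in> borel_measurable (tangent_borel f)"
  unfolding borel_measurable_iff_less
proof
  fix a
  have "L2 f \<inter> {h. L2norm f (\<lambda>u. h u - g u) < a} \<in> sets (tangent_borel f)"
    unfolding tangent_borel_def tangent_eq_L2 using assms
    by (intro in_measure_of) auto
  moreover have "L2 f \<inter> {h. L2norm f (\<lambda>u. h u - g u) < a} = {w \<in> L2 f. L2norm f (\<lambda>u. w u - g u) < a}" by auto
  ultimately show "{w \<in> space (tangent_borel f). L2norm f (\<lambda>u. w u - g u) < a} \<in> sets (tangent_borel f)"
    by simp
qed

lemma L2norm_measurable: "L2norm f \<in> borel_measurable (tangent_borel f)"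
  using L2norm_diff_measurable[OF L2_const[of 0]] by simp

text \<open>Preimages of the generating balls are sublevel sets of distances to fixed
  functions.\<close>

lemma measurable_tangent_borelI:
  assumes "\<And>\<omega>. \<omega> \<in> space N \<Longrightarrow> X \<omega> \<in> L2 f"
    and "\<And>g. g \<in> L2 f \<Longrightarrow> (\<lambda>\<omega>. L2norm f (\<lambda>u. X \<omega> u - g u)) \<in> borel_measurable N"
  shows "X \<in> measurable N (tangent_borel f)"
  unfolding tangent_borel_def tangent_eq_L2
proof (rule measurable_measure_of)
  show "X \<in> space N \<rightarrow> L2 f" using assms(1) by auto
  fix y assume "y \<in> {L2 f \<inter> {h. L2norm f (\<lambda>u. h u - g u) < r} |g r. g \<in> L2 f}"
  then obtain g r where y: "y = L2 f \<inter> {h. L2norm f (\<lambda>u. h u - g u) < r}" "g \<in> L2 f" by auto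
  have "X -` y \<inter> space N = {\<omega> \<in> space N. L2norm f (\<lambda>u. X \<omega> u - g u) < r}"
    using assms(1) by (auto simp: y(1))
  also have "\<dots> \<in> sets N" using assms(2)[OF y(2)] by measurable
  finally show "X -` y \<inter> space N \<in> sets N" .
qed auto

text \<open>The condition that \<open>X + Y\<close> lies within \<open>r\<close> of \<open>g\<close>
  is a countable union, over approximants \<open>l\<close> of \<open>X\<close>, of conditions on
  \<open>X\<close> and \<open>Y\<close> separately: distance of \<open>X\<close> to \<open>l\<close>
  plus distance of \<open>Y\<close> to \<open>g - l\<close> below \<open>r\<close>.\<close>

lemma tangent_borel_add:
  assumes X: "X \<in> measurable N (tangent_borel f)" and Y: "Y \<in> measurable N (tangent_borel f)"
  shows "(\<lambda>\<omega> u. X \<omega> u + Y \<omega> u) \<in> measurable N (tangent_borel f)"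
proof (rule measurable_tangent_borelI)
  have XL: "X \<omega> \<in> L2 f" and YL: "Y \<omega> \<in> L2 f" if "\<omega> \<in> space N" for \<omega>
    using measurable_space[OF X that] measurable_space[OF Y that] by auto
  then show "(\<lambda>u. X \<omega> u + Y \<omega> u) \<in> L2 f" if "\<omega> \<in> space N" for \<omega>
    using that by (intro L2_add) auto
  fix g assume g: "g \<in> L2 f"
  let ?a = "\<lambda>l \<omega>. L2norm f (\<lambda>u. X \<omega> u - ramp_comb l u)"
  let ?b = "\<lambda>l \<omega>. L2norm f (\<lambda>u. Y \<omega> u - (g u - ramp_comb l u))"
  have [measurable]: "?a l \<in> borel_measurable N" "?b l \<in> borel_measurable N" for l
    using measurable_compose[OF X L2norm_diff_measurable[OF ramp_comb_L2]]
      measurable_compose[OF Y L2norm_diff_measurable[OF L2_diff[OF g ramp_comb_L2]]] by auto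
  have "{\<omega> \<in> space N. L2norm f (\<lambda>u. X \<omega> u + Y \<omega> u - g u) < r}
      = (\<Union>l. {\<omega> \<in> space N. ?a l \<omega> + ?b l \<omega> < r})" for r
  proof safe
    fix \<omega> assume \<omega>: "\<omega> \<in> space N"
    note xl = L2_diff[OF XL[OF \<omega>] ramp_comb_L2]
    { assume "L2norm f (\<lambda>u. X \<omega> u + Y \<omega> u - g u) < r"
      \<comment> \<open>Half of the slack is enough: \<open>?b l \<omega>\<close> exceeds the
        distance of the sum to \<open>g\<close> by at most \<open>?a l \<omega>\<close>, so
        \<open>?a l \<omega>\<close> is spent twice.\<close>
      then obtain l where l: "?a l \<omega> < (r - L2norm f (\<lambda>u. X \<omega> u + Y \<omega> u - g u)) / 2"
        using ramp_comb_dense[OF XL[OF \<omega>]] by (metis diff_gt_0_iff_gt half_gt_zero)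
      have "?b l \<omega> \<le> L2norm f (\<lambda>u. X \<omega> u + Y \<omega> u - g u) + L2norm f (\<lambda>u. - 1 * (X \<omega> u - ramp_comb l u))"
        using L2norm_triangle[OF L2_diff[OF L2_add[OF XL[OF \<omega>] YL[OF \<omega>]] g] L2_scale[OF xl[of l], of "-1"]]
        by (simp add: algebra_simps)
      also have "L2norm f (\<lambda>u. - 1 * (X \<omega> u - ramp_comb l u)) = ?a l \<omega>"
        by (subst L2norm_scale[OF L2_measurable[OF xl]]) simp
      finally show "\<omega> \<in> (\<Union>l. {\<omega> \<in> space N. ?a l \<omega> + ?b l \<omega> < r})"
        using l \<omega> by (auto intro!: exI[of _ l]) }
    { fix l assume "?a l \<omega> + ?b l \<omega> < r"
      moreover have "L2norm f (\<lambda>u. X \<omega> u + Y \<omega> u - g u) \<le> ?a l \<omega> + ?b l \<omega>"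
        using L2norm_triangle[OF xl[of l] L2_diff[OF YL[OF \<omega>] L2_diff[OF g ramp_comb_L2[of l]]]]
        by (simp add: algebra_simps)
      ultimately show "L2norm f (\<lambda>u. X \<omega> u + Y \<omega> u - g u) < r" by simp }
  qed
  moreover have "(\<Union>l. {\<omega> \<in> space N. ?a l \<omega> + ?b l \<omega> < r}) \<in> sets N" for r
    by (intro sets.countable_UN'') auto
  ultimately show "(\<lambda>\<omega>. L2norm f (\<lambda>u. X \<omega> u + Y \<omega> u - g u)) \<in> borel_measurable N"
    by (simp add: borel_measurable_iff_less)
qed

lemma tangent_borel_scale:
  assumes X: "X \<in> measurable N (tangent_borel f)"
  shows "(\<lambda>\<omega> u. c * X \<omega> u) \<in> measurable N (tangent_borel f)"
proof (rule measurable_tangent_borelI)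
  have XL: "X \<omega> \<in> L2 f" if "\<omega> \<in> space N" for \<omega>
    using measurable_space[OF X that] by auto
  then show "(\<lambda>u. c * X \<omega> u) \<in> L2 f" if "\<omega> \<in> space N" for \<omega>
    using that by (intro L2_scale) auto
  fix g assume g: "g \<in> L2 f"
  show "(\<lambda>\<omega>. L2norm f (\<lambda>u. c * X \<omega> u - g u)) \<in> borel_measurable N"
  proof (cases "c = 0")
    case False
    have "L2norm f (\<lambda>u. c * X \<omega> u - g u) = \<bar>c\<bar> * L2norm f (\<lambda>u. X \<omega> u - 1 / c * g u)"
      if "\<omega> \<in> space N" for \<omega>
      using L2norm_scale[OF L2_measurable[OF L2_diff[OF XL[OF that] L2_scale[OF g, of "1/c"]]], of c] False
      by (simp add: algebra_simps)
    moreover have "(\<lambda>\<omega>. \<bar>c\<bar> * L2norm f (\<lambda>u. X \<omega> u - 1 / c * g u)) \<in> borel_measurable N"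
      using measurable_compose[OF X L2norm_diff_measurable[OF L2_scale[OF g, of "1/c"]]] by simp
    ultimately show ?thesis by (subst measurable_cong) auto
  qed simp
qed

lemma tangent_borel_sum:
  assumes "finite I" "\<And>i. i \<in> I \<Longrightarrow> X i \<in> measurable N (tangent_borel f)"
  shows "(\<lambda>\<omega> u. \<Sum>i\<in>I. c i * X i \<omega> u) \<in> measurable N (tangent_borel f)"
  using assms
proof (induction I rule: finite_induct)
  case empty
  then show ?case by (simp add: L2_const)
next
  case (insert i I)
  then show ?case
    using tangent_borel_add[OF tangent_borel_scale[of "X i" N "c i"] insert.IH] by simp
qed

end

subsection \<open>The autoregressive series\<close>

text \<open>Cauchy-Schwarz for the counting measure, with the summand split as
  \<open>sqrt (b i)\<close> times \<open>sqrt (b i) * x i\<close>.\<close>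

lemma suminf_weighted_power2_le:
  fixes b x :: "nat \<Rightarrow> real"
  assumes "\<And>i. 0 \<le> b i" "\<And>i. 0 \<le> x i"
  shows "(\<Sum>i. ennreal (b i * x i))\<^sup>2 \<le> (\<Sum>i. ennreal (b i)) * (\<Sum>i. ennreal (b i * (x i)\<^sup>2))"
proof -
  have "(\<integral>\<^sup>+i. ennreal (sqrt (b i)) * ennreal (sqrt (b i) * x i) \<partial>count_space UNIV)\<^sup>2
     \<le> (\<integral>\<^sup>+i. (ennreal (sqrt (b i)))\<^sup>2 \<partial>count_space UNIV) * (\<integral>\<^sup>+i. (ennreal (sqrt (b i) * x i))\<^sup>2 \<partial>count_space UNIV)"
    by (rule Cauchy_Schwarz_nn_integral) auto
  moreover have "ennreal (sqrt (b i)) * ennreal (sqrt (b i) * x i) = ennreal (b i * x i)"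
    "(ennreal (sqrt (b i)))\<^sup>2 = ennreal (b i)" "(ennreal (sqrt (b i) * x i))\<^sup>2 = ennreal (b i * (x i)\<^sup>2)" for i
    using assms[of i] by (auto simp: ennreal_mult[symmetric] ennreal_power power_mult_distrib mult.assoc[symmetric])
  ultimately show ?thesis
    by (simp add: nn_integral_count_space_nat)
qed

lemma enn2real_power2_le: "ennreal ((enn2real x)\<^sup>2) \<le> x\<^sup>2"
  by (cases x) (auto simp: ennreal_power)

text \<open>Joint measurability permits exchanging the integrals over \<omega> and \<open>u\<close>.
  As the noise is centred on the support, the second moment appearing in \<open>cov\<close> is the
  variance \<open>C_eps(u, u)\<close> there.\<close>

locale ar_model = w2_density f + M: prob_space M for f and M :: "'a measure" +
  fixes \<beta> :: real and \<epsilon> :: "int \<Rightarrow> 'a \<Rightarrow> real \<Rightarrow> real"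
  assumes eps_L2: "\<And>t \<omega>. \<epsilon> t \<omega> \<in> L2 f"
    and eps_meas: "\<And>t. \<epsilon> t \<in> measurable M (tangent_borel f)"
    and eps_joint: "\<And>t. (\<lambda>(\<omega>, u). \<epsilon> t \<omega> u) \<in> borel_measurable (M \<Otimes>\<^sub>M lborel)"
    and eps_mean: "\<And>t u. u \<in> dens_support f \<Longrightarrow>
                      integrable M (\<lambda>\<omega>. \<epsilon> t \<omega> u) \<and> (\<integral>\<omega>. \<epsilon> t \<omega> u \<partial>M) = 0"
    and beta: "\<bar>\<beta>\<bar> < 1"
    and indep: "M.indep_vars (\<lambda>_. tangent_borel f) \<epsilon> UNIV"
    and ident: "\<And>t. distr M (tangent_borel f) (\<epsilon> t) = distr M (tangent_borel f) (\<epsilon> 0)"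
    and cov: "\<And>t. (\<integral>\<^sup>+ u. ennreal (f u) * (\<integral>\<^sup>+ \<omega>. ennreal ((\<epsilon> t \<omega> u)\<^sup>2) \<partial>M) \<partial>lborel) < \<infinity>"
begin

sublocale PS: pair_sigma_finite M \<mu> ..

lemma eps_joint_\<mu> [measurable]: "(\<lambda>p. \<epsilon> t (fst p) (snd p)) \<in> borel_measurable (M \<Otimes>\<^sub>M \<mu>)"
proof -
  have "sets (M \<Otimes>\<^sub>M lborel) = sets (M \<Otimes>\<^sub>M \<mu>)" by (intro sets_pair_measure_cong) auto
  then show ?thesis
    using eps_joint[of t] by (simp add: split_beta' cong: measurable_cong_sets)
qed

lemma section_\<omega>: "k \<in> borel_measurable (M \<Otimes>\<^sub>M \<mu>) \<Longrightarrow> (\<lambda>\<omega>. k (\<omega>, u)) \<in> borel_measurable M"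
  by (rule measurable_compose[OF measurable_Pair2']) auto

lemma section_u: "k \<in> borel_measurable (M \<Otimes>\<^sub>M \<mu>) \<Longrightarrow> \<omega> \<in> space M \<Longrightarrow> (\<lambda>u. k (\<omega>, u)) \<in> borel_measurable borel"
  using measurable_compose[OF measurable_Pair1'[of \<omega> M \<mu>], of k] by simp

definition noise_energy :: ennreal where
  "noise_energy = (\<integral>\<^sup>+ \<omega>. ennreal ((L2norm f (\<epsilon> 0 \<omega>))\<^sup>2) \<partial>M)"

text \<open>The energy is determined by the law of \<open>\<epsilon> t\<close> on the tangent space,
  so identical distribution makes it independent of \<open>t\<close>.\<close>

lemma nn_integral_eps: "(\<integral>\<^sup>+ \<omega>. \<integral>\<^sup>+ u. ennreal ((\<epsilon> t \<omega> u)\<^sup>2) \<partial>\<mu> \<partial>M) = noise_energy"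
proof -
  have [measurable]: "L2norm f \<in> borel_measurable (tangent_borel f)" by (rule L2norm_measurable)
  have *: "(\<integral>\<^sup>+ \<omega>. ennreal ((L2norm f (\<epsilon> t \<omega>))\<^sup>2) \<partial>M)
      = (\<integral>\<^sup>+ h. ennreal ((L2norm f h)\<^sup>2) \<partial>distr M (tangent_borel f) (\<epsilon> t))" for t
    using eps_meas[of t] by (subst nn_integral_distr) auto
  have "(\<integral>\<^sup>+ \<omega>. \<integral>\<^sup>+ u. ennreal ((\<epsilon> t \<omega> u)\<^sup>2) \<partial>\<mu> \<partial>M) = (\<integral>\<^sup>+ \<omega>. ennreal ((L2norm f (\<epsilon> t \<omega>))\<^sup>2) \<partial>M)"
    by (simp add: ennreal_L2norm_power2 eps_L2)
  also have "\<dots> = noise_energy"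
    unfolding noise_energy_def * ident[of t] ..
  finally show ?thesis .
qed

lemma noise_energy_finite: "noise_energy < \<infinity>"
proof -
  have "noise_energy = (\<integral>\<^sup>+ \<omega>. \<integral>\<^sup>+ u. ennreal ((\<epsilon> 0 \<omega> u)\<^sup>2) \<partial>\<mu> \<partial>M)" by (simp add: nn_integral_eps)
  also have "\<dots> = (\<integral>\<^sup>+ u. \<integral>\<^sup>+ \<omega>. ennreal ((\<epsilon> 0 \<omega> u)\<^sup>2) \<partial>M \<partial>\<mu>)"
    using PS.Fubini'[of "\<lambda>\<omega> u. ennreal ((\<epsilon> 0 \<omega> u)\<^sup>2)"] by (simp add: split_beta')
  also have "\<dots> = (\<integral>\<^sup>+ u. ennreal (f u) * (\<integral>\<^sup>+ \<omega>. ennreal ((\<epsilon> 0 \<omega> u)\<^sup>2) \<partial>M) \<partial>lborel)"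
  proof (rule nn_integral_density)
    have "(\<lambda>p. ennreal ((\<epsilon> 0 (snd p) (fst p))\<^sup>2)) \<in> borel_measurable (\<mu> \<Otimes>\<^sub>M M)"
      using measurable_compose[OF measurable_pair_swap' eps_joint_\<mu>[of 0]] by (simp add: split_beta')
    then have "(\<lambda>u. \<integral>\<^sup>+ \<omega>. ennreal ((\<epsilon> 0 \<omega> u)\<^sup>2) \<partial>M) \<in> borel_measurable \<mu>"
      using M.borel_measurable_nn_integral[of "\<lambda>u \<omega>. ennreal ((\<epsilon> 0 \<omega> u)\<^sup>2)" \<mu>] by (simp add: split_beta')
    then show "(\<lambda>u. \<integral>\<^sup>+ \<omega>. ennreal ((\<epsilon> 0 \<omega> u)\<^sup>2) \<partial>M) \<in> borel_measurable lborel" by simp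
  qed simp
  also have "\<dots> < \<infinity>" by (rule cov)
  finally show ?thesis .
qed

text \<open>Values in \<open>ennreal\<close> make the sum exist before any convergence is known; its
  finiteness is then read off from its energy.\<close>

definition majorant :: "int \<Rightarrow> 'a \<Rightarrow> real \<Rightarrow> ennreal" where
  "majorant t \<omega> u = (\<Sum>i. ennreal (\<bar>\<beta>\<bar> ^ i * \<bar>\<epsilon> (t - int i) \<omega> u\<bar>))"

lemma majorant_measurable [measurable]: "(\<lambda>p. majorant t (fst p) (snd p)) \<in> borel_measurable (M \<Otimes>\<^sub>M \<mu>)"
  unfolding majorant_def by measurable

lemma majorant_energy_finite: "(\<integral>\<^sup>+ \<omega>. \<integral>\<^sup>+ u. (majorant t \<omega> u)\<^sup>2 \<partial>\<mu> \<partial>M) < \<infinity>"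
proof -
  let ?S = "\<Sum>i. ennreal (\<bar>\<beta>\<bar> ^ i)"
  have sg: "summable (\<lambda>i. \<bar>\<beta>\<bar> ^ i)" using beta by (intro summable_geometric) simp
  have S: "?S < \<infinity>"
    using sg by (subst suminf_ennreal2) auto
  have *: "(\<integral>\<^sup>+ p. ennreal ((\<epsilon> s (fst p) (snd p))\<^sup>2) \<partial>(M \<Otimes>\<^sub>M \<mu>)) = noise_energy" for s
    by (subst nn_integral_fst[symmetric]) (simp_all add: nn_integral_eps)
  have "(\<integral>\<^sup>+ \<omega>. \<integral>\<^sup>+ u. (majorant t \<omega> u)\<^sup>2 \<partial>\<mu> \<partial>M) = (\<integral>\<^sup>+ p. (majorant t (fst p) (snd p))\<^sup>2 \<partial>(M \<Otimes>\<^sub>M \<mu>))"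
    by (subst nn_integral_fst[symmetric]) simp_all
  also have "\<dots> \<le> (\<integral>\<^sup>+ p. ?S * (\<Sum>i. ennreal (\<bar>\<beta>\<bar> ^ i) * ennreal ((\<epsilon> (t - int i) (fst p) (snd p))\<^sup>2)) \<partial>(M \<Otimes>\<^sub>M \<mu>))"
  proof (rule nn_integral_mono)
    fix p
    show "(majorant t (fst p) (snd p))\<^sup>2 \<le> ?S * (\<Sum>i. ennreal (\<bar>\<beta>\<bar> ^ i) * ennreal ((\<epsilon> (t - int i) (fst p) (snd p))\<^sup>2))"
    proof -
      let ?x = "\<lambda>i. \<epsilon> (t - int i) (fst p) (snd p)"
      have "(\<Sum>i. ennreal (\<bar>\<beta>\<bar> ^ i * \<bar>?x i\<bar>))\<^sup>2 \<le> ?S * (\<Sum>i. ennreal (\<bar>\<beta>\<bar> ^ i * \<bar>?x i\<bar>\<^sup>2))"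
        by (rule suminf_weighted_power2_le) auto
      moreover have "ennreal (\<bar>\<beta>\<bar> ^ i * \<bar>?x i\<bar>\<^sup>2) = ennreal (\<bar>\<beta>\<bar> ^ i) * ennreal ((?x i)\<^sup>2)" for i
        by (simp add: ennreal_mult)
      ultimately show ?thesis unfolding majorant_def by (simp only:)
    qed
  qed
  also have "\<dots> = ?S * (\<Sum>i. ennreal (\<bar>\<beta>\<bar> ^ i) * noise_energy)"
    by (simp add: nn_integral_cmult nn_integral_suminf *)
  \<comment> \<open>One factor \<open>?S\<close> stems from Cauchy-Schwarz, the other from adding up
    the equal noise energies with the weights.\<close>
  also have "\<dots> = ?S * (?S * noise_energy)"
    by (simp add: ennreal_suminf_multc)
  also have "\<dots> < \<infinity>"
    using S noise_energy_finite by (simp add: ennreal_mult_less_top)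
  finally show ?thesis .
qed

section \<open>The solution and the convergence of its series\<close>

definition good :: "int \<Rightarrow> 'a \<Rightarrow> bool" where
  "good t \<omega> \<longleftrightarrow> \<omega> \<in> space M \<and> (\<integral>\<^sup>+ u. (majorant t \<omega> u)\<^sup>2 \<partial>\<mu>) < \<infinity>"

lemma nn_integral_majorant_measurable [measurable]: "(\<lambda>\<omega>. \<integral>\<^sup>+ u. (majorant t \<omega> u)\<^sup>2 \<partial>\<mu>) \<in> borel_measurable M"
  using borel_measurable_nn_integral[of "\<lambda>\<omega> u. (majorant t \<omega> u)\<^sup>2" M] by (simp add: split_beta')

lemma AE_good: "AE \<omega> in M. good t \<omega>"
proof -
  have "AE \<omega> in M. (\<integral>\<^sup>+ u. (majorant t \<omega> u)\<^sup>2 \<partial>\<mu>) \<noteq> \<infinity>"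
    using majorant_energy_finite[of t] by (intro nn_integral_PInf_AE) auto
  then show ?thesis using AE_space
    by eventually_elim (auto simp: good_def top.not_eq_extremum)
qed

text \<open>With the default value 0, \<open>sol\<close> is bounded by the majorant at every point
  and jointly measurable, and each of its paths lies in \<open>L2 f\<close>, not merely almost every
  one.\<close>

definition sol :: "int \<Rightarrow> 'a \<Rightarrow> real \<Rightarrow> real" where
  "sol t \<omega> u = (if good t \<omega> \<and> majorant t \<omega> u < \<infinity> then (\<Sum>i. \<beta> ^ i * \<epsilon> (t - int i) \<omega> u) else 0)"

abbreviation partial_sol :: "int \<Rightarrow> nat \<Rightarrow> 'a \<Rightarrow> real \<Rightarrow> real" where
  "partial_sol t n \<omega> u \<equiv> \<Sum>i\<le>n. \<beta> ^ i * \<epsilon> (t - int i) \<omega> u"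

lemma sol_measurable [measurable]: "(\<lambda>p. sol t (fst p) (snd p)) \<in> borel_measurable (M \<Otimes>\<^sub>M \<mu>)"
proof -
  have "Measurable.pred M (good t)" unfolding good_def by measurable
  then have [measurable]: "Measurable.pred (M \<Otimes>\<^sub>M \<mu>) (\<lambda>p. good t (fst p))"
    by (rule measurable_compose[OF measurable_fst])
  show ?thesis unfolding sol_def by measurable
qed

lemma majorant_finiteD:
  assumes "majorant t \<omega> u < \<infinity>"
  shows "summable (\<lambda>i. \<beta> ^ i * \<epsilon> (t - int i) \<omega> u)"
    and "\<bar>partial_sol t n \<omega> u\<bar> \<le> enn2real (majorant t \<omega> u)"
    and "\<bar>(\<Sum>i. \<beta> ^ i * \<epsilon> (t - int i) \<omega> u) - partial_sol t n \<omega> u\<bar> \<le> enn2real (majorant t \<omega> u)"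
    and "\<bar>\<Sum>i. \<beta> ^ i * \<epsilon> (t - int i) \<omega> u\<bar> \<le> enn2real (majorant t \<omega> u)"
proof -
  let ?a = "\<lambda>i. \<beta> ^ i * \<epsilon> (t - int i) \<omega> u"
  have abs: "\<bar>?a i\<bar> = \<bar>\<beta>\<bar> ^ i * \<bar>\<epsilon> (t - int i) \<omega> u\<bar>" for i by (simp add: abs_mult power_abs)
  have s: "summable (\<lambda>i. \<bar>?a i\<bar>)"
    using assms unfolding majorant_def abs by (intro summable_suminf_not_top) auto
  then have e: "enn2real (majorant t \<omega> u) = (\<Sum>i. \<bar>?a i\<bar>)"
    unfolding majorant_def abs by (subst suminf_ennreal2) (auto simp: suminf_nonneg)
  show sa: "summable ?a" using s by (rule summable_rabs_cancel)
  have "\<bar>partial_sol t n \<omega> u\<bar> \<le> (\<Sum>i\<le>n. \<bar>?a i\<bar>)" by (rule sum_abs)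
  also have "\<dots> \<le> (\<Sum>i. \<bar>?a i\<bar>)" by (rule sum_le_suminf[OF s]) auto
  finally show "\<bar>partial_sol t n \<omega> u\<bar> \<le> enn2real (majorant t \<omega> u)" by (simp add: e)
  show "\<bar>\<Sum>i. ?a i\<bar> \<le> enn2real (majorant t \<omega> u)" unfolding e by (rule summable_rabs[OF s])
  have "(\<Sum>i. ?a i) - partial_sol t n \<omega> u = (\<Sum>i. ?a (i + Suc n))"
    using suminf_split_initial_segment[OF sa, of "Suc n"] by (simp add: lessThan_Suc_atMost)
  also have "\<bar>\<dots>\<bar> \<le> (\<Sum>i. \<bar>?a (i + Suc n)\<bar>)"
    using s by (intro summable_rabs) (subst summable_iff_shift)
  also have "\<dots> \<le> (\<Sum>i. \<bar>?a i\<bar>)"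
    using suminf_split_initial_segment[OF s, of "Suc n"] by (simp add: sum_nonneg)
  finally show "\<bar>(\<Sum>i. ?a i) - partial_sol t n \<omega> u\<bar> \<le> enn2real (majorant t \<omega> u)" by (simp add: e)
qed

lemma good_majorant:
  assumes "good t \<omega>"
  shows "AE u in \<mu>. majorant t \<omega> u < \<infinity>" and "(\<lambda>u. enn2real (majorant t \<omega> u)) \<in> L2 f"
proof -
  have \<omega>: "\<omega> \<in> space M" and fin: "(\<integral>\<^sup>+ u. (majorant t \<omega> u)\<^sup>2 \<partial>\<mu>) < \<infinity>"
    using assms by (auto simp: good_def)
  have [measurable]: "majorant t \<omega> \<in> borel_measurable borel"
    using section_u[OF majorant_measurable \<omega>] by simp
  have "AE u in \<mu>. (majorant t \<omega> u)\<^sup>2 \<noteq> \<infinity>"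
    using fin by (intro nn_integral_PInf_AE) auto
  then show "AE u in \<mu>. majorant t \<omega> u < \<infinity>"
    by eventually_elim (auto simp: less_top[symmetric] power2_eq_square)
  have "(\<integral>\<^sup>+ u. ennreal ((enn2real (majorant t \<omega> u))\<^sup>2) \<partial>\<mu>) \<le> (\<integral>\<^sup>+ u. (majorant t \<omega> u)\<^sup>2 \<partial>\<mu>)"
    by (intro nn_integral_mono enn2real_power2_le)
  then show "(\<lambda>u. enn2real (majorant t \<omega> u)) \<in> L2 f"
    using fin by (auto simp: L2_iff_nn_integral)
qed

lemma sol_L2: "sol t \<omega> \<in> L2 f"
proof (cases "good t \<omega>")
  case True
  have "sol t \<omega> \<in> borel_measurable borel"
    using section_u[OF sol_measurable, of \<omega>] True by (simp add: good_def)
  moreover have "AE u in \<mu>. \<bar>sol t \<omega> u\<bar> \<le> \<bar>enn2real (majorant t \<omega> u)\<bar>"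
    by (intro AE_I2) (auto simp: sol_def majorant_finiteD)
  ultimately show ?thesis by (rule L2_bound[OF good_majorant(2)[OF True]])
next
  case False
  then have "sol t \<omega> = (\<lambda>u. 0)" by (auto simp: sol_def)
  then show ?thesis by (simp add: L2_const)
qed

lemma partial_sol_L2: "partial_sol t n \<omega> \<in> L2 f"
  by (intro L2_sum L2_scale eps_L2) simp

lemma sol_minus_partial_bound:
  assumes "good t \<omega>"
  shows "AE u in \<mu>. \<bar>sol t \<omega> u - partial_sol t n \<omega> u\<bar> \<le> \<bar>enn2real (majorant t \<omega> u)\<bar>"
  using good_majorant(1)[OF assms] by eventually_elim (auto simp: sol_def assms majorant_finiteD)

lemma sol_series_tendsto:
  assumes "good t \<omega>"
  shows "(\<lambda>n. L2norm f (\<lambda>u. sol t \<omega> u - partial_sol t n \<omega> u)) \<longlonglongrightarrow> 0"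
proof (rule L2norm_tendsto_dominated[OF good_majorant(2)[OF assms]])
  show "AE u in \<mu>. (\<lambda>n. sol t \<omega> u - partial_sol t n \<omega> u) \<longlonglongrightarrow> 0"
    using good_majorant(1)[OF assms]
  proof eventually_elim
    case (elim u)
    have "(\<lambda>n. partial_sol t n \<omega> u) \<longlonglongrightarrow> sol t \<omega> u"
      using summable_LIMSEQ'[OF majorant_finiteD(1)[OF elim]] assms elim by (simp add: sol_def)
    then show ?case by (auto intro!: tendsto_eq_intros)
  qed
  show "(\<lambda>u. sol t \<omega> u - partial_sol t n \<omega> u) \<in> borel_measurable borel" for n
    by (intro L2_measurable L2_diff sol_L2 partial_sol_L2)
qed (rule sol_minus_partial_bound[OF assms])

lemma sol_equation:
  assumes "good t \<omega>" "good (t - 1) \<omega>"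
  shows "L2norm f (\<lambda>u. sol t \<omega> u - (\<beta> * sol (t - 1) \<omega> u + \<epsilon> t \<omega> u)) = 0"
proof -
  have "AE u in \<mu>. sol t \<omega> u - (\<beta> * sol (t - 1) \<omega> u + \<epsilon> t \<omega> u) = 0"
    using good_majorant(1)[OF assms(1)] good_majorant(1)[OF assms(2)]
  proof eventually_elim
    case (elim u)
    let ?a = "\<lambda>i. \<beta> ^ i * \<epsilon> (t - int i) \<omega> u"
    have "(\<Sum>i. ?a i) = (\<Sum>i. ?a (Suc i)) + ?a 0"
      using suminf_split_head[OF majorant_finiteD(1)[OF elim(1)]] by simp
    also have "(\<Sum>i. ?a (Suc i)) = \<beta> * (\<Sum>i. \<beta> ^ i * \<epsilon> (t - 1 - int i) \<omega> u)"
      using suminf_mult[OF majorant_finiteD(1)[OF elim(2)], of \<beta>] by (simp add: mult.assoc algebra_simps)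
    finally show ?case using assms elim by (simp add: sol_def)
  qed
  then show ?thesis
    by (subst L2norm_eq_0_iff) (intro L2_diff L2_add L2_scale sol_L2 eps_L2)
qed

lemma sol_tangent_measurable: "sol t \<in> measurable M (tangent_borel f)"
proof (rule measurable_tangent_borelI)
  fix g assume g: "g \<in> L2 f"
  then have [measurable]: "g \<in> borel_measurable borel" by (rule L2_measurable)
  have "(\<lambda>\<omega>. \<integral>\<^sup>+ u. ennreal ((sol t \<omega> u - g u)\<^sup>2) \<partial>\<mu>) \<in> borel_measurable M"
    using borel_measurable_nn_integral[of "\<lambda>\<omega> u. ennreal ((sol t \<omega> u - g u)\<^sup>2)" M] by (simp add: split_beta')
  then have "(\<lambda>\<omega>. sqrt (enn2real (\<integral>\<^sup>+ u. ennreal ((sol t \<omega> u - g u)\<^sup>2) \<partial>\<mu>))) \<in> borel_measurable M" by simp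
  then show "(\<lambda>\<omega>. L2norm f (\<lambda>u. sol t \<omega> u - g u)) \<in> borel_measurable M"
    unfolding L2norm_def by (simp add: nn_integral_weight L2_measurable L2_diff sol_L2 g)
qed (rule sol_L2)

lemma partial_sol_tangent_measurable: "partial_sol t n \<in> measurable M (tangent_borel f)"
  by (intro tangent_borel_sum eps_meas) simp

lemma L2norm_sol_minus_partial_measurable [measurable]:
  "(\<lambda>\<omega>. L2norm f (\<lambda>u. sol t \<omega> u - partial_sol t n \<omega> u)) \<in> borel_measurable M"
proof -
  have "(\<lambda>\<omega> u. sol t \<omega> u + (-1) * partial_sol t n \<omega> u) \<in> measurable M (tangent_borel f)"
    by (intro tangent_borel_add tangent_borel_scale sol_tangent_measurable partial_sol_tangent_measurable)
  from measurable_compose[OF this L2norm_measurable] show ?thesis by simp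
qed

lemma sol_mean_square:
  "(\<lambda>n. \<integral>\<^sup>+ \<omega>. ennreal ((L2norm f (\<lambda>u. sol t \<omega> u - partial_sol t n \<omega> u))\<^sup>2) \<partial>M) \<longlonglongrightarrow> 0"
proof -
  have "(\<lambda>n. \<integral>\<^sup>+ \<omega>. ennreal ((L2norm f (\<lambda>u. sol t \<omega> u - partial_sol t n \<omega> u))\<^sup>2) \<partial>M) \<longlonglongrightarrow> (\<integral>\<^sup>+ \<omega>. 0 \<partial>M)"
  proof (rule nn_integral_dominated_convergence[where w = "\<lambda>\<omega>. \<integral>\<^sup>+ u. (majorant t \<omega> u)\<^sup>2 \<partial>\<mu>"])
    show "AE \<omega> in M. ennreal ((L2norm f (\<lambda>u. sol t \<omega> u - partial_sol t n \<omega> u))\<^sup>2) \<le> (\<integral>\<^sup>+ u. (majorant t \<omega> u)\<^sup>2 \<partial>\<mu>)" for n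
      using AE_good[of t]
    proof eventually_elim
      case (elim \<omega>)
      have "(\<integral>\<^sup>+ u. ennreal ((sol t \<omega> u - partial_sol t n \<omega> u)\<^sup>2) \<partial>\<mu>) \<le> (\<integral>\<^sup>+ u. (majorant t \<omega> u)\<^sup>2 \<partial>\<mu>)"
      proof (rule nn_integral_mono_AE)
        show "AE u in \<mu>. ennreal ((sol t \<omega> u - partial_sol t n \<omega> u)\<^sup>2) \<le> (majorant t \<omega> u)\<^sup>2"
          using sol_minus_partial_bound[OF elim, of n] good_majorant(1)[OF elim]
        proof eventually_elim
          case (elim u)
          have "ennreal ((sol t \<omega> u - partial_sol t n \<omega> u)\<^sup>2) \<le> ennreal ((enn2real (majorant t \<omega> u))\<^sup>2)"
            using abs_le_square_iff[THEN iffD1, OF elim(1)] by (rule ennreal_leI)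
          also have "\<dots> = (majorant t \<omega> u)\<^sup>2"
            using elim(2) by (simp add: ennreal_power[symmetric])
          finally show ?case .
        qed
      qed
      then show ?case by (simp add: ennreal_L2norm_power2 L2_diff sol_L2 partial_sol_L2)
    qed
    show "AE \<omega> in M. (\<lambda>n. ennreal ((L2norm f (\<lambda>u. sol t \<omega> u - partial_sol t n \<omega> u))\<^sup>2)) \<longlonglongrightarrow> 0"
      using AE_good[of t]
    proof eventually_elim
      case (elim \<omega>)
      have "(\<lambda>n. (L2norm f (\<lambda>u. sol t \<omega> u - partial_sol t n \<omega> u))\<^sup>2) \<longlonglongrightarrow> 0"
        using sol_series_tendsto[OF elim] by (auto intro!: tendsto_eq_intros)
      from tendsto_ennrealI[OF this] show ?case by simp
    qed
  qed (use majorant_energy_finite in auto)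
  then show ?thesis by simp
qed

section \<open>Stationarity and uniqueness\<close>

lemma eps_stationary: "strictly_stationary M (tangent_borel f) \<epsilon>"
  by (rule strictly_stationary_iid[OF M.prob_space_axioms eps_meas indep ident])

text \<open>The distance to \<open>g\<close> is 1-Lipschitz. Applied to two limits of the same
  sequence, this shows that they have the same distance to every \<open>g\<close>.\<close>

lemma L2norm_diff_continuous:
  assumes "(\<lambda>n. L2norm f (\<lambda>u. v u - s n u)) \<longlonglongrightarrow> 0" "v \<in> L2 f" "\<And>n. s n \<in> L2 f" "g \<in> L2 f"
  shows "(\<lambda>n. L2norm f (\<lambda>u. s n u - g u)) \<longlonglongrightarrow> L2norm f (\<lambda>u. v u - g u)"
proof -
  have "\<bar>L2norm f (\<lambda>u. s n u - g u) - L2norm f (\<lambda>u. v u - g u)\<bar> \<le> L2norm f (\<lambda>u. v u - s n u)" for n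
    using L2norm_triangle_diff[OF assms(2,3,4), of n] L2norm_triangle_diff[OF assms(3,2,4), of n]
      L2norm_minus_commute[of v "s n"] by linarith
  then have "(\<lambda>n. L2norm f (\<lambda>u. s n u - g u) - L2norm f (\<lambda>u. v u - g u)) \<longlonglongrightarrow> 0"
    by (intro tendsto_0_le[OF assms(1), of _ 1]) simp
  then show ?thesis by (rule LIM_zero_cancel)
qed

text \<open>The distance from the limit to a fixed \<open>g\<close> is the limit of the distances of the partial
  sums, hence a measurable and shift-equivariant function of the noise.\<close>

lemma series_limit_stationary:
  assumes V: "\<And>t. V t \<in> measurable M (tangent_borel f)"
    and lim: "\<And>t. AE \<omega> in M. (\<lambda>n. L2norm f (\<lambda>u. V t \<omega> u - partial_sol t n \<omega> u)) \<longlonglongrightarrow> 0"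
  shows "strictly_stationary M (tangent_borel f) V"
  unfolding tangent_borel_def tangent_eq_L2
proof (rule strictly_stationary_transfer[OF eps_stationary])
  let ?PN = "PiM (UNIV::int set) (\<lambda>_. tangent_borel f)"
  show "V t \<in> measurable M (sigma (L2 f) {L2 f \<inter> {h. L2norm f (\<lambda>u. h u - g u) < r} |g r. g \<in> L2 f})" for t
    using V[of t] unfolding tangent_borel_def tangent_eq_L2 .
  fix t A assume "A \<in> {L2 f \<inter> {h. L2norm f (\<lambda>u. h u - g u) < r} |g r. g \<in> L2 f}"
  then obtain g r where A: "A = L2 f \<inter> {h. L2norm f (\<lambda>u. h u - g u) < r}" and g: "g \<in> L2 f" by blast
  define \<Phi> where "\<Phi> n x = L2norm f (\<lambda>u. (\<Sum>i\<le>n. \<beta> ^ i * x (t - int i) u) - g u)" for n and x :: "int \<Rightarrow> real \<Rightarrow> real"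
  have [measurable]: "\<Phi> n \<in> borel_measurable ?PN" for n
  proof -
    have "(\<lambda>x u. \<Sum>i\<le>n. \<beta> ^ i * x (t - int i) u) \<in> measurable ?PN (tangent_borel f)"
      by (intro tangent_borel_sum measurable_component_singleton) auto
    from measurable_compose[OF this L2norm_diff_measurable[OF g]] show ?thesis by (simp add: \<Phi>_def[abs_def])
  qed
  \<comment> \<open>\<open>lim\<close> is total, so \<open>B\<close> is a measurable set of paths
    without any convergence requirement; along almost every noise path the sequence converges and
    \<open>lim\<close> is the distance sought.\<close>
  define B where "B = {x \<in> space ?PN. lim (\<lambda>n. \<Phi> n x) < r}"
  have "B \<in> sets ?PN" unfolding B_def by measurable
  moreover have "AE \<omega> in M. V (t + h) \<omega> \<in> A \<longleftrightarrow> (\<lambda>s. \<epsilon> (s + h) \<omega>) \<in> B" for h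
    using lim[of "t + h"] AE_space
  proof eventually_elim
    case (elim \<omega>)
    have VL: "V (t + h) \<omega> \<in> L2 f" using measurable_space[OF V elim(2)] by simp
    have "\<Phi> n (\<lambda>s. \<epsilon> (s + h) \<omega>) = L2norm f (\<lambda>u. partial_sol (t + h) n \<omega> u - g u)" for n
      by (simp add: \<Phi>_def add.commute add_diff_eq)
    then have "(\<lambda>n. \<Phi> n (\<lambda>s. \<epsilon> (s + h) \<omega>)) \<longlonglongrightarrow> L2norm f (\<lambda>u. V (t + h) \<omega> u - g u)"
      using L2norm_diff_continuous[OF elim(1) VL partial_sol_L2 g] by simp
    then have "lim (\<lambda>n. \<Phi> n (\<lambda>s. \<epsilon> (s + h) \<omega>)) = L2norm f (\<lambda>u. V (t + h) \<omega> u - g u)"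
      by (rule limI)
    moreover have "(\<lambda>s. \<epsilon> (s + h) \<omega>) \<in> space ?PN"
      using measurable_space[OF measurable_coord_shift[of \<epsilon>, OF eps_meas] elim(2)] .
    ultimately show ?case using VL by (simp add: A B_def)
  qed
  ultimately show "\<exists>B\<in>sets ?PN. \<forall>h. AE \<omega> in M. V (t + h) \<omega> \<in> A \<longleftrightarrow> (\<lambda>s. \<epsilon> (s + h) \<omega>) \<in> B"
    by (intro bexI[of _ B] allI)
qed auto

lemma sol_stationary: "strictly_stationary M (tangent_borel f) sol"
proof (rule series_limit_stationary[OF sol_tangent_measurable])
  show "AE \<omega> in M. (\<lambda>n. L2norm f (\<lambda>u. sol t \<omega> u - partial_sol t n \<omega> u)) \<longlonglongrightarrow> 0" for t
    using AE_good[of t] by eventually_elim (rule sol_series_tendsto)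
qed

text \<open>No moment of \<open>W\<close> is assumed, hence the truncation at 1. By stationarity the
  time \<open>t - n\<close> may be replaced by 0, after which the integrand tends to 0 pointwise and
  is bounded.\<close>

lemma stationary_truncated_norm_tendsto:
  assumes W: "strictly_stationary M (tangent_borel f) W"
  shows "(\<lambda>n. \<integral>\<omega>. min 1 (\<bar>\<beta>\<bar> ^ n * L2norm f (W (t - int n) \<omega>)) \<partial>M) \<longlonglongrightarrow> 0"
proof -
  have Wm: "(\<lambda>\<omega>. L2norm f (W s \<omega>)) \<in> borel_measurable M" for s
    using W measurable_compose[OF _ L2norm_measurable] by (auto simp: strictly_stationary_def)
  have eq: "(\<integral>\<omega>. min 1 (\<bar>\<beta>\<bar> ^ n * L2norm f (W s \<omega>)) \<partial>M) = (\<integral>\<omega>. min 1 (\<bar>\<beta>\<bar> ^ n * L2norm f (W 0 \<omega>)) \<partial>M)" for n s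
  proof -
    have "(\<integral>\<omega>. min 1 (\<bar>\<beta>\<bar> ^ n * L2norm f (W s \<omega>)) \<partial>M)
        = (\<integral>x. min 1 (\<bar>\<beta>\<bar> ^ n * x) \<partial>distr M borel (\<lambda>\<omega>. L2norm f (W s \<omega>)))" for s
      using Wm by (subst integral_distr) auto
    then show ?thesis
      by (simp only: strictly_stationary_distr_eq[OF W L2norm_measurable, of s])
  qed
  have "(\<lambda>n. \<integral>\<omega>. min 1 (\<bar>\<beta>\<bar> ^ n * L2norm f (W 0 \<omega>)) \<partial>M) \<longlonglongrightarrow> (\<integral>\<omega>. 0 \<partial>M)"
  proof (rule integral_dominated_convergence[where w = "\<lambda>_. 1"])
    show "AE \<omega> in M. (\<lambda>n. min 1 (\<bar>\<beta>\<bar> ^ n * L2norm f (W 0 \<omega>))) \<longlonglongrightarrow> 0"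
    proof (rule AE_I2)
      fix \<omega>
      have "(\<lambda>n. \<bar>\<beta>\<bar> ^ n * L2norm f (W 0 \<omega>)) \<longlonglongrightarrow> 0"
        using beta by (intro tendsto_mult_left_zero LIMSEQ_power_zero) simp
      from tendsto_min[OF tendsto_const[of 1] this]
      show "(\<lambda>n. min 1 (\<bar>\<beta>\<bar> ^ n * L2norm f (W 0 \<omega>))) \<longlonglongrightarrow> 0" by simp
    qed
    show "AE \<omega> in M. norm (min 1 (\<bar>\<beta>\<bar> ^ n * L2norm f (W 0 \<omega>))) \<le> 1" for n
    proof (rule AE_I2)
      fix \<omega>
      have "0 \<le> \<bar>\<beta>\<bar> ^ n * L2norm f (W 0 \<omega>)" by simp
      then show "norm (min 1 (\<bar>\<beta>\<bar> ^ n * L2norm f (W 0 \<omega>))) \<le> 1" unfolding real_norm_def by linarith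
    qed
  qed (use Wm in auto)
  moreover have "(\<lambda>n. \<integral>\<omega>. min 1 (\<bar>\<beta>\<bar> ^ n * L2norm f (W (t - int n) \<omega>)) \<partial>M)
      = (\<lambda>n. \<integral>\<omega>. min 1 (\<bar>\<beta>\<bar> ^ n * L2norm f (W 0 \<omega>)) \<partial>M)"
    by (rule ext) (rule eq)
  ultimately show ?thesis by simp
qed

lemma sol_unique:
  assumes eqn: "\<And>t. AE \<omega> in M. L2norm f (\<lambda>u. W t \<omega> u - (\<beta> * W (t - 1) \<omega> u + \<epsilon> t \<omega> u)) = 0"
    and W: "strictly_stationary M (tangent_borel f) W"
  shows "AE \<omega> in M. L2norm f (\<lambda>u. W t \<omega> u - sol t \<omega> u) = 0"
proof -
  have Wm: "W s \<in> measurable M (tangent_borel f)" for s using W by (simp add: strictly_stationary_def)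
  define D where "D s \<omega> = L2norm f (\<lambda>u. W s \<omega> u - sol s \<omega> u)" for s \<omega>
  have Dm [measurable]: "D s \<in> borel_measurable M" for s
  proof -
    have "(\<lambda>\<omega> u. W s \<omega> u + (-1) * sol s \<omega> u) \<in> measurable M (tangent_borel f)"
      by (intro tangent_borel_add tangent_borel_scale sol_tangent_measurable Wm)
    from measurable_compose[OF this L2norm_measurable] show ?thesis by (simp add: D_def[abs_def])
  qed
  have nm [measurable]: "(\<lambda>\<omega>. L2norm f (W s \<omega>)) \<in> borel_measurable M"
    "(\<lambda>\<omega>. L2norm f (sol s \<omega>)) \<in> borel_measurable M" for s
    using measurable_compose[OF Wm L2norm_measurable]
      measurable_compose[OF sol_tangent_measurable L2norm_measurable] by auto
  have step: "AE \<omega> in M. D s \<omega> \<le> \<bar>\<beta>\<bar> * D (s - 1) \<omega>" for s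
    using eqn[of s] AE_good[of s] AE_good[of "s - 1"] AE_space
  proof eventually_elim
    case (elim \<omega>)
    have WL: "W s \<omega> \<in> L2 f" for s using measurable_space[OF Wm elim(4)] by simp
    let ?w = "\<lambda>u. W s \<omega> u - (\<beta> * W (s - 1) \<omega> u + \<epsilon> s \<omega> u)"
    let ?v = "\<lambda>u. sol s \<omega> u - (\<beta> * sol (s - 1) \<omega> u + \<epsilon> s \<omega> u)"
    let ?d = "\<lambda>u. \<beta> * (W (s - 1) \<omega> u - sol (s - 1) \<omega> u)"
    have wv: "?w \<in> L2 f" "?v \<in> L2 f" "?d \<in> L2 f"
      by (intro L2_diff L2_add L2_scale WL sol_L2 eps_L2)+
    \<comment> \<open>The difference is rewritten as the residuals of the two equations, both of
      norm 0, plus \<open>\<beta>\<close> times the difference one time step earlier.\<close>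
    have "D s \<omega> = L2norm f (\<lambda>u. (?w u - ?v u) + ?d u)"
      unfolding D_def by (simp add: algebra_simps)
    also have "\<dots> \<le> L2norm f (\<lambda>u. ?w u - ?v u) + L2norm f ?d"
      by (intro L2norm_triangle L2_diff[of ?w ?v] wv)
    also have "L2norm f (\<lambda>u. ?w u - ?v u) \<le> L2norm f ?w + L2norm f (\<lambda>u. - 1 * ?v u)"
      using L2norm_triangle[OF wv(1) L2_scale[OF wv(2), of "-1"]] by simp
    also have "\<dots> = 0"
      using elim(1) sol_equation[OF elim(2,3)] L2norm_scale[OF L2_measurable[OF wv(2)], of "-1"] by simp
    also have "L2norm f ?d = \<bar>\<beta>\<bar> * D (s - 1) \<omega>"
      unfolding D_def by (intro L2norm_scale L2_measurable L2_diff WL sol_L2)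
    finally show ?case by simp
  qed
  have iter: "AE \<omega> in M. D t \<omega> \<le> \<bar>\<beta>\<bar> ^ n * D (t - int n) \<omega>" for n
  proof (induction n)
    case (Suc n)
    show ?case using Suc.IH step[of "t - int n"]
    proof eventually_elim
      case (elim \<omega>)
      have "\<bar>\<beta>\<bar> ^ n * D (t - int n) \<omega> \<le> \<bar>\<beta>\<bar> ^ n * (\<bar>\<beta>\<bar> * D (t - int n - 1) \<omega>)"
        using elim(2) by (intro mult_left_mono) auto
      moreover have "t - int n - 1 = t - int (Suc n)" by simp
      ultimately show ?case using elim(1) by (simp add: mult.assoc mult.left_commute)
    qed
  qed simp
  have int: "integrable M (\<lambda>\<omega>. min 1 (k \<omega>))" if "k \<in> borel_measurable M" "\<And>\<omega>. 0 \<le> k \<omega>" for k :: "'a \<Rightarrow> real"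
  proof (intro M.integrable_const_bound[where B = 1] AE_I2)
    show "norm (min 1 (k \<omega>)) \<le> 1" for \<omega> using that(2)[of \<omega>] by (simp add: min_def)
  qed (use that(1) in simp)
  have D0: "0 \<le> D s \<omega>" for s \<omega> by (simp add: D_def)
  \<comment> \<open>The joint law of \<open>W\<close> and \<open>sol\<close> is not controlled, so
    \<open>D\<close> is split into the two norms, each of which has a law independent of time;
    \<open>min 1\<close> is subadditive on nonnegative numbers.\<close>
  have le: "(\<integral>\<omega>. min 1 (D t \<omega>) \<partial>M) \<le> (\<integral>\<omega>. min 1 (\<bar>\<beta>\<bar> ^ n * L2norm f (W (t - int n) \<omega>)) \<partial>M)
      + (\<integral>\<omega>. min 1 (\<bar>\<beta>\<bar> ^ n * L2norm f (sol (t - int n) \<omega>)) \<partial>M)" for n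
  proof -
    let ?a = "\<lambda>\<omega>. \<bar>\<beta>\<bar> ^ n * L2norm f (W (t - int n) \<omega>)" and ?b = "\<lambda>\<omega>. \<bar>\<beta>\<bar> ^ n * L2norm f (sol (t - int n) \<omega>)"
    have "(\<integral>\<omega>. min 1 (D t \<omega>) \<partial>M) \<le> (\<integral>\<omega>. min 1 (?a \<omega>) + min 1 (?b \<omega>) \<partial>M)"
    proof (rule integral_mono_AE)
      show "AE \<omega> in M. min 1 (D t \<omega>) \<le> min 1 (?a \<omega>) + min 1 (?b \<omega>)"
        using iter[of n] AE_space
      proof eventually_elim
        case (elim \<omega>)
        have WL: "W s \<omega> \<in> L2 f" for s using measurable_space[OF Wm elim(2)] by simp
        have "D (t - int n) \<omega> \<le> L2norm f (W (t - int n) \<omega>) + L2norm f (sol (t - int n) \<omega>)"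
          using L2norm_triangle[OF WL[of "t - int n"] L2_scale[OF sol_L2[of "t - int n" \<omega>], of "-1"]]
            L2norm_scale[OF L2_measurable[OF sol_L2[of "t - int n" \<omega>]], of "-1"] by (simp add: D_def)
        then have "\<bar>\<beta>\<bar> ^ n * D (t - int n) \<omega> \<le> ?a \<omega> + ?b \<omega>"
          by (simp add: mult_left_mono flip: distrib_left)
        moreover have "0 \<le> ?a \<omega>" "0 \<le> ?b \<omega>" by auto
        ultimately show ?case using elim(1) by linarith
      qed
    qed (auto intro!: int D0 Bochner_Integration.integrable_add)
    also have "\<dots> = (\<integral>\<omega>. min 1 (?a \<omega>) \<partial>M) + (\<integral>\<omega>. min 1 (?b \<omega>) \<partial>M)"
      by (intro Bochner_Integration.integral_add int) auto
    finally show ?thesis .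
  qed
  have "(\<lambda>n. (\<integral>\<omega>. min 1 (\<bar>\<beta>\<bar> ^ n * L2norm f (W (t - int n) \<omega>)) \<partial>M)
      + (\<integral>\<omega>. min 1 (\<bar>\<beta>\<bar> ^ n * L2norm f (sol (t - int n) \<omega>)) \<partial>M)) \<longlonglongrightarrow> 0 + 0"
    by (intro tendsto_add stationary_truncated_norm_tendsto W sol_stationary)
  then have "(\<integral>\<omega>. min 1 (D t \<omega>) \<partial>M) \<le> 0"
    by (intro LIMSEQ_le_const[where X = "\<lambda>n. _ n + _ n"]) (auto intro: le)
  moreover have "0 \<le> (\<integral>\<omega>. min 1 (D t \<omega>) \<partial>M)" using D0 by (intro Bochner_Integration.integral_nonneg) simp
  ultimately have "(\<integral>\<omega>. min 1 (D t \<omega>) \<partial>M) = 0" by simp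
  then have "AE \<omega> in M. min 1 (D t \<omega>) = 0"
    using D0 by (subst (asm) integral_nonneg_eq_0_iff_AE) (auto intro!: int)
  then show ?thesis by eventually_elim (auto simp: D_def min_def split: if_splits)
qed

end

subsection \<open>The second moment of the solution\<close>

context w2_density
begin

text \<open>The complement of the support is covered by countably many null intervals with rational
  endpoints.\<close>

lemma AE_in_support: "AE u in \<mu>. u \<in> dens_support f"
proof -
  define K where "K = {p :: rat \<times> rat. emeasure \<mu> {real_of_rat (fst p)<..<real_of_rat (snd p)} = 0}"
  have "(\<Union>p\<in>K. {real_of_rat (fst p)<..<real_of_rat (snd p)}) \<in> null_sets \<mu>"
    by (intro null_sets_UN') (auto simp: K_def)
  then have "AE u in \<mu>. u \<notin> (\<Union>p\<in>K. {real_of_rat (fst p)<..<real_of_rat (snd p)})"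
    by (rule AE_not_in)
  then show ?thesis
  proof eventually_elim
    case (elim u)
    show ?case
      unfolding dens_support_def
    proof safe
      fix e :: real assume "e > 0"
      obtain a where a: "u - e < real_of_rat a" "real_of_rat a < u"
        using of_rat_dense[of "u - e" u] \<open>e > 0\<close> by auto
      obtain b where b: "u < real_of_rat b" "real_of_rat b < u + e"
        using of_rat_dense[of u "u + e"] \<open>e > 0\<close> by auto
      have "(a, b) \<notin> K" using elim a b by auto
      then have "emeasure \<mu> {real_of_rat a<..<real_of_rat b} > 0" by (auto simp: K_def zero_less_iff_neq_zero)
      also have "\<dots> \<le> emeasure \<mu> (ball u e)"
        using a b by (intro emeasure_mono) (auto simp: ball_def dist_real_def)
      finally show "0 < emeasure \<mu> (ball u e)" .
    qed
  qed
qed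

end

context ar_model
begin

lemma nn_integral_section_measurable:
  assumes "(\<lambda>p. k (fst p) (snd p)) \<in> borel_measurable (M \<Otimes>\<^sub>M \<mu>)"
  shows "(\<lambda>u. \<integral>\<^sup>+ \<omega>. k \<omega> u \<partial>M) \<in> borel_measurable \<mu>"
proof -
  have "(\<lambda>p. k (snd p) (fst p)) \<in> borel_measurable (\<mu> \<Otimes>\<^sub>M M)"
    using measurable_compose[OF measurable_pair_swap' assms] by (simp add: split_beta')
  then show ?thesis
    using M.borel_measurable_nn_integral[of "\<lambda>u \<omega>. k \<omega> u" \<mu>] by (simp add: split_beta')
qed

lemma sol_energy_finite: "(\<integral>\<^sup>+ \<omega>. ennreal ((L2norm f (sol t \<omega>))\<^sup>2) \<partial>M) < \<infinity>"
proof -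
  have "ennreal ((sol t \<omega> u)\<^sup>2) \<le> (majorant t \<omega> u)\<^sup>2" for \<omega> u
  proof (cases "good t \<omega> \<and> majorant t \<omega> u < \<infinity>")
    case True
    then have "\<bar>sol t \<omega> u\<bar> \<le> \<bar>enn2real (majorant t \<omega> u)\<bar>" by (simp add: sol_def majorant_finiteD)
    then have "ennreal ((sol t \<omega> u)\<^sup>2) \<le> ennreal ((enn2real (majorant t \<omega> u))\<^sup>2)"
      unfolding abs_le_square_iff by (rule ennreal_leI)
    also have "\<dots> = (majorant t \<omega> u)\<^sup>2" using True by (simp add: ennreal_power[symmetric])
    finally show ?thesis .
  qed (auto simp: sol_def)
  then have "(\<integral>\<^sup>+ \<omega>. ennreal ((L2norm f (sol t \<omega>))\<^sup>2) \<partial>M) \<le> (\<integral>\<^sup>+ \<omega>. \<integral>\<^sup>+ u. (majorant t \<omega> u)\<^sup>2 \<partial>\<mu> \<partial>M)"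
    by (simp add: ennreal_L2norm_power2 sol_L2 nn_integral_mono)
  then show ?thesis using majorant_energy_finite[of t] by simp
qed

text \<open>For almost every \<open>u\<close> in the support the majorant is square integrable in
  \<omega>. It dominates the centred partial sums, so the limit is centred too and the cross term
  vanishes. The quantifier over \<open>c\<close> stands inside the almost-everywhere statement so
  that \<open>c\<close> may later depend on \<open>u\<close>.\<close>

lemma sol_section_second_moment:
  "AE u in \<mu>. \<forall>c. (\<integral>\<^sup>+ \<omega>. ennreal ((sol t \<omega> u - c)\<^sup>2) \<partial>M) = (\<integral>\<^sup>+ \<omega>. ennreal ((sol t \<omega> u)\<^sup>2) \<partial>M) + ennreal (c\<^sup>2)"
proof -
  have "(\<integral>\<^sup>+ u. \<integral>\<^sup>+ \<omega>. (majorant t \<omega> u)\<^sup>2 \<partial>M \<partial>\<mu>) = (\<integral>\<^sup>+ \<omega>. \<integral>\<^sup>+ u. (majorant t \<omega> u)\<^sup>2 \<partial>\<mu> \<partial>M)"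
    using PS.Fubini'[of "\<lambda>\<omega> u. (majorant t \<omega> u)\<^sup>2"] by (simp add: split_beta')
  then have "AE u in \<mu>. (\<integral>\<^sup>+ \<omega>. (majorant t \<omega> u)\<^sup>2 \<partial>M) \<noteq> \<infinity>"
    using majorant_energy_finite[of t]
    by (intro nn_integral_PInf_AE nn_integral_section_measurable) auto
  then show ?thesis using AE_in_support
  proof eventually_elim
    case (elim u)
    define m where "m \<omega> = enn2real (majorant t \<omega> u)" for \<omega>
    have majM [measurable]: "(\<lambda>\<omega>. majorant t \<omega> u) \<in> borel_measurable M"
      using section_\<omega>[OF majorant_measurable] by simp
    have [measurable]: "(\<lambda>\<omega>. sol t \<omega> u) \<in> borel_measurable M"
      using section_\<omega>[OF sol_measurable] by simp
    have [measurable]: "(\<lambda>\<omega>. \<epsilon> s \<omega> u) \<in> borel_measurable M" for s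
      using section_\<omega>[OF eps_joint_\<mu>] by simp
    have [measurable]: "m \<in> borel_measurable M" unfolding m_def by measurable
    have "AE \<omega> in M. (majorant t \<omega> u)\<^sup>2 \<noteq> \<infinity>"
      using elim(1) by (intro nn_integral_PInf_AE) auto
    then have fin: "AE \<omega> in M. majorant t \<omega> u < \<infinity>"
      by eventually_elim (auto simp: less_top[symmetric] power2_eq_square)
    have "(\<integral>\<^sup>+ \<omega>. ennreal ((m \<omega>)\<^sup>2) \<partial>M) \<le> (\<integral>\<^sup>+ \<omega>. (majorant t \<omega> u)\<^sup>2 \<partial>M)"
      unfolding m_def by (intro nn_integral_mono enn2real_power2_le)
    also have "\<dots> < \<infinity>" using elim(1) by (simp only: infinity_ennreal_def less_top)
    finally have fin_m: "(\<integral>\<^sup>+ \<omega>. ennreal ((m \<omega>)\<^sup>2) \<partial>M) < \<infinity>" .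
    have m2: "integrable M (\<lambda>\<omega>. (m \<omega>)\<^sup>2)"
    proof (rule integrableI_bounded)
      show "(\<lambda>\<omega>. (m \<omega>)\<^sup>2) \<in> borel_measurable M" by measurable
      show "(\<integral>\<^sup>+ \<omega>. ennreal (norm ((m \<omega>)\<^sup>2)) \<partial>M) < \<infinity>"
        using fin_m unfolding real_norm_def abs_power2 .
    qed
    have m1: "integrable M m"
      by (rule M.square_integrable_imp_integrable[OF _ m2]) simp
    have lim: "AE \<omega> in M. (\<lambda>n. partial_sol t n \<omega> u) \<longlonglongrightarrow> sol t \<omega> u"
      using fin AE_good[of t]
    proof eventually_elim
      case (elim \<omega>)
      show ?case
        using summable_LIMSEQ'[OF majorant_finiteD(1)[OF elim(1)]] elim by (simp add: sol_def)
    qed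
    have bd: "AE \<omega> in M. norm (partial_sol t n \<omega> u) \<le> m \<omega>" for n
      using fin by eventually_elim (simp add: m_def majorant_finiteD)
    have sol1: "integrable M (\<lambda>\<omega>. sol t \<omega> u)"
      by (rule integrable_dominated_convergence[OF _ _ m1 lim bd]) auto
    have "(\<lambda>n. \<integral>\<omega>. partial_sol t n \<omega> u \<partial>M) \<longlonglongrightarrow> (\<integral>\<omega>. sol t \<omega> u \<partial>M)"
      by (rule integral_dominated_convergence[OF _ _ m1 lim bd]) auto
    moreover have "(\<integral>\<omega>. partial_sol t n \<omega> u \<partial>M) = 0" for n
      using eps_mean[OF elim(2)] by (subst Bochner_Integration.integral_sum) auto
    ultimately have mean0: "(\<integral>\<omega>. sol t \<omega> u \<partial>M) = 0"
      by (simp add: LIMSEQ_const_iff)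
    have sol2: "integrable M (\<lambda>\<omega>. (sol t \<omega> u)\<^sup>2)"
    proof (rule Bochner_Integration.integrable_bound[OF m2])
      show "AE \<omega> in M. norm ((sol t \<omega> u)\<^sup>2) \<le> norm ((m \<omega>)\<^sup>2)"
      proof (rule AE_I2)
        fix \<omega>
        have "\<bar>sol t \<omega> u\<bar> \<le> \<bar>m \<omega>\<bar>" by (auto simp: sol_def m_def majorant_finiteD)
        then show "norm ((sol t \<omega> u)\<^sup>2) \<le> norm ((m \<omega>)\<^sup>2)" by (simp add: abs_le_square_iff)
      qed
    qed simp
    show ?case
    proof
      fix c
      have eq: "(sol t \<omega> u - c)\<^sup>2 = (sol t \<omega> u)\<^sup>2 - (2 * c) * sol t \<omega> u + c\<^sup>2" for \<omega>
        by (simp add: power2_diff)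
      have i: "integrable M (\<lambda>\<omega>. (sol t \<omega> u - c)\<^sup>2)"
        unfolding eq using sol1 sol2 by simp
      have "(\<integral>\<^sup>+ \<omega>. ennreal ((sol t \<omega> u - c)\<^sup>2) \<partial>M) = ennreal (\<integral>\<omega>. (sol t \<omega> u - c)\<^sup>2 \<partial>M)"
        by (rule nn_integral_eq_integral[OF i]) simp
      also have "(\<integral>\<omega>. (sol t \<omega> u - c)\<^sup>2 \<partial>M) = (\<integral>\<omega>. (sol t \<omega> u)\<^sup>2 \<partial>M) + c\<^sup>2"
        unfolding eq using sol1 sol2 mean0 by (simp add: M.prob_space)
      also have "ennreal \<dots> = (\<integral>\<^sup>+ \<omega>. ennreal ((sol t \<omega> u)\<^sup>2) \<partial>M) + ennreal (c\<^sup>2)"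
        using sol2 by (simp add: nn_integral_eq_integral)
      finally show "(\<integral>\<^sup>+ \<omega>. ennreal ((sol t \<omega> u - c)\<^sup>2) \<partial>M) = (\<integral>\<^sup>+ \<omega>. ennreal ((sol t \<omega> u)\<^sup>2) \<partial>M) + ennreal (c\<^sup>2)" .
    qed
  qed
qed

text \<open>Pythagoras: exchange the integrals and take \<open>c\<close> to be
  \<open>\<psi> u\<close> in each section.\<close>

lemma sol_energy_decomposition:
  assumes \<psi>: "\<psi> \<in> L2 f"
  shows "(\<integral>\<^sup>+ \<omega>. ennreal ((L2norm f (\<lambda>u. sol t \<omega> u - \<psi> u))\<^sup>2) \<partial>M)
    = (\<integral>\<^sup>+ \<omega>. ennreal ((L2norm f (sol t \<omega>))\<^sup>2) \<partial>M) + ennreal ((L2norm f \<psi>)\<^sup>2)"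
proof -
  have [measurable]: "\<psi> \<in> borel_measurable borel" by (rule L2_measurable[OF \<psi>])
  have *: "(\<lambda>u. \<integral>\<^sup>+ \<omega>. ennreal ((sol t \<omega> u)\<^sup>2) \<partial>M) \<in> borel_measurable \<mu>"
    by (rule nn_integral_section_measurable) simp
  have "(\<integral>\<^sup>+ \<omega>. ennreal ((L2norm f (\<lambda>u. sol t \<omega> u - \<psi> u))\<^sup>2) \<partial>M)
      = (\<integral>\<^sup>+ \<omega>. \<integral>\<^sup>+ u. ennreal ((sol t \<omega> u - \<psi> u)\<^sup>2) \<partial>\<mu> \<partial>M)"
    by (simp add: ennreal_L2norm_power2 L2_diff sol_L2 \<psi>)
  also have "\<dots> = (\<integral>\<^sup>+ u. \<integral>\<^sup>+ \<omega>. ennreal ((sol t \<omega> u - \<psi> u)\<^sup>2) \<partial>M \<partial>\<mu>)"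
    using PS.Fubini'[of "\<lambda>\<omega> u. ennreal ((sol t \<omega> u - \<psi> u)\<^sup>2)"] by (simp add: split_beta')
  also have "\<dots> = (\<integral>\<^sup>+ u. (\<integral>\<^sup>+ \<omega>. ennreal ((sol t \<omega> u)\<^sup>2) \<partial>M) + ennreal ((\<psi> u)\<^sup>2) \<partial>\<mu>)"
    by (rule nn_integral_cong_AE) (use sol_section_second_moment[of t] in \<open>eventually_elim, blast\<close>)
  also have "\<dots> = (\<integral>\<^sup>+ u. \<integral>\<^sup>+ \<omega>. ennreal ((sol t \<omega> u)\<^sup>2) \<partial>M \<partial>\<mu>) + (\<integral>\<^sup>+ u. ennreal ((\<psi> u)\<^sup>2) \<partial>\<mu>)"
    using * by (intro nn_integral_add) auto
  also have "(\<integral>\<^sup>+ u. \<integral>\<^sup>+ \<omega>. ennreal ((sol t \<omega> u)\<^sup>2) \<partial>M \<partial>\<mu>) = (\<integral>\<^sup>+ \<omega>. \<integral>\<^sup>+ u. ennreal ((sol t \<omega> u)\<^sup>2) \<partial>\<mu> \<partial>M)"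
    using PS.Fubini'[of "\<lambda>\<omega> u. ennreal ((sol t \<omega> u)\<^sup>2)"] by (simp add: split_beta')
  also have "\<dots> = (\<integral>\<^sup>+ \<omega>. ennreal ((L2norm f (sol t \<omega>))\<^sup>2) \<partial>M)"
    by (simp add: ennreal_L2norm_power2 sol_L2)
  finally show ?thesis by (simp add: ennreal_L2norm_power2 \<psi>)
qed

end

subsection \<open>Quantile functions and transport\<close>

context w2_density
begin

lemma cdf_distribution: "cdf_distribution \<mu>"
  by (simp add: cdf_distribution_def real_distribution_def real_distribution_axioms_def prob_space_axioms)

lemma dens_cdf_eq: "dens_cdf f = cdf \<mu>"
  by (simp add: fun_eq_iff dens_cdf_def cdf_def)

lemma quantile_le_iff:
  assumes "0 < s" "s < 1"
  shows "dens_quantile f s \<le> x \<longleftrightarrow> s \<le> dens_cdf f x"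
proof -
  interpret cdf_distribution \<mu> by (rule cdf_distribution)
  show ?thesis using pseudoinverse[OF assms, of x] by (simp add: dens_quantile_def dens_cdf_eq)
qed

lemma dens_cdf_mono: "mono (dens_cdf f)"
  by (rule monoI) (auto simp: dens_cdf_def intro!: finite_measure_mono)

lemma dens_cdf_measurable [measurable]: "dens_cdf f \<in> borel_measurable borel"
  by (rule borel_measurable_mono[OF dens_cdf_mono])

lemma dens_cdf_bounds: "0 \<le> dens_cdf f x" "dens_cdf f x \<le> 1"
  by (auto simp: dens_cdf_def)

lemma dens_quantile_measurable [measurable]: "dens_quantile f \<in> borel_measurable borel"
proof -
  interpret cdf_distribution \<mu> by (rule cdf_distribution)
  \<comment> \<open>Outside the unit interval the infimum is over all reals or over the empty set,
    so the total function is constant on either side and is glued from Borel pieces.\<close>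
  have 0: "dens_quantile f s = dens_quantile f 0" if "s \<le> 0" for s
  proof -
    have "s \<le> dens_cdf f x" for x using that dens_cdf_bounds(1)[of x] by simp
    then show ?thesis using dens_cdf_bounds(1) by (simp add: dens_quantile_def)
  qed
  have 1: "dens_quantile f s = dens_quantile f 2" if "s > 1" for s
  proof -
    have "\<not> s \<le> dens_cdf f x" "\<not> 2 \<le> dens_cdf f x" for x using that dens_cdf_bounds(2)[of x] by auto
    then show ?thesis by (simp add: dens_quantile_def)
  qed
  have "dens_quantile f \<in> borel_measurable (restrict_space borel {0<..<1})"
    using measurable_CI by (simp add: dens_quantile_def[abs_def] dens_cdf_eq)
  then have "(\<lambda>s. indicator {0<..<1} s *\<^sub>R dens_quantile f s) \<in> borel_measurable borel"
    by (subst (asm) borel_measurable_restrict_space_iff) auto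
  moreover have "(\<lambda>s. indicator {0<..<1} s *\<^sub>R dens_quantile f s) = (\<lambda>s. if s \<in> {0<..<1} then dens_quantile f s else 0)"
    by (auto simp: indicator_def)
  ultimately have "(\<lambda>s. if s \<in> {0<..<1} then dens_quantile f s else 0) \<in> borel_measurable borel"
    by simp
  then have "(\<lambda>s. if s \<le> 0 then dens_quantile f 0 else if s < 1 then (if s \<in> {0<..<1} then dens_quantile f s else 0)
      else if s = 1 then dens_quantile f 1 else dens_quantile f 2) \<in> borel_measurable borel"
    by measurable
  moreover have "dens_quantile f = (\<lambda>s. if s \<le> 0 then dens_quantile f 0 else if s < 1 then (if s \<in> {0<..<1} then dens_quantile f s else 0)
      else if s = 1 then dens_quantile f 1 else dens_quantile f 2)"
    (is "_ = ?q")
  proof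
    fix s :: real
    consider "s \<le> 0" | "0 < s" "s < 1" | "s = 1" | "s > 1" by linarith
    then show "dens_quantile f s = ?q s"
      using 0[of s] 1[of s] by cases auto
  qed
  ultimately show ?thesis by simp
qed

lemma distr_quantile: "distr (restrict_space lborel {0<..<1}) borel (dens_quantile f) = \<mu>"
proof -
  interpret cdf_distribution \<mu> by (rule cdf_distribution)
  show ?thesis using distr_I_eq_M by (simp add: dens_quantile_def[abs_def] dens_cdf_eq)
qed

lemma nn_integral_quantile:
  assumes [measurable]: "k \<in> borel_measurable borel"
  shows "(\<integral>\<^sup>+ s. k (dens_quantile f s) * indicator {0<..<1} s \<partial>lborel) = (\<integral>\<^sup>+ u. k u \<partial>\<mu>)"
proof -
  have "(\<integral>\<^sup>+ u. k u \<partial>\<mu>) = (\<integral>\<^sup>+ u. k u \<partial>distr (restrict_space lborel {0<..<1}) borel (dens_quantile f))"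
    by (simp add: distr_quantile)
  also have "\<dots> = (\<integral>\<^sup>+ s. k (dens_quantile f s) \<partial>restrict_space lborel {0<..<1})"
    by (rule nn_integral_distr) (auto intro: measurable_restrict_space1)
  also have "\<dots> = (\<integral>\<^sup>+ s. k (dens_quantile f s) * indicator {0<..<1} s \<partial>lborel)"
    by (rule nn_integral_restrict_space) simp
  finally show ?thesis by simp
qed

lemma emeasure_singleton [simp]: "emeasure \<mu> {x} = 0"
  by (subst emeasure_density) (auto simp: nn_integral_indicator_singleton)

text \<open>A measure with a density has no atoms, so the cdf is continuous; it stays below
  \<open>s\<close> to the left of the quantile, and the left limit gives the upper bound.\<close>

lemma cdf_quantile:
  assumes s: "0 < s" "s < 1"
  shows "dens_cdf f (dens_quantile f s) = s"
proof (rule antisym)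
  interpret cdf_distribution \<mu> by (rule cdf_distribution)
  show "s \<le> dens_cdf f (dens_quantile f s)"
    using quantile_le_iff[OF s] by blast
  have "isCont (dens_cdf f) (dens_quantile f s)"
    unfolding dens_cdf_eq by (subst isCont_cdf) (simp add: measure_def)
  then have "((dens_cdf f) \<longlongrightarrow> dens_cdf f (dens_quantile f s)) (at_left (dens_quantile f s))"
    by (simp add: isCont_def filterlim_at_split)
  then show "dens_cdf f (dens_quantile f s) \<le> s"
  proof (rule tendsto_upperbound)
    show "\<forall>\<^sub>F x in at_left (dens_quantile f s). dens_cdf f x \<le> s"
      unfolding eventually_at_filter
      using quantile_le_iff[OF s] by (intro always_eventually) (metis lessThan_iff linorder_not_le order_less_imp_le)
  qed simp
qed

text \<open>Probability integral transform: the cdf pushes the measure to the uniform law on the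
  unit interval.\<close>

lemma nn_integral_cdf:
  assumes [measurable]: "k \<in> borel_measurable borel"
  shows "(\<integral>\<^sup>+ u. k (dens_cdf f u) \<partial>\<mu>) = (\<integral>\<^sup>+ s. k s * indicator {0<..<1} s \<partial>lborel)"
proof -
  have "(\<integral>\<^sup>+ u. k (dens_cdf f u) \<partial>\<mu>) = (\<integral>\<^sup>+ s. k (dens_cdf f (dens_quantile f s)) * indicator {0<..<1} s \<partial>lborel)"
    by (rule nn_integral_quantile[symmetric]) simp
  also have "\<dots> = (\<integral>\<^sup>+ s. k s * indicator {0<..<1} s \<partial>lborel)"
    by (intro nn_integral_cong) (auto simp: indicator_def cdf_quantile)
  finally show ?thesis .
qed

lemma AE_cdf_in_unit: "AE u in \<mu>. dens_cdf f u \<in> {0<..<1}"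
proof -
  have "(\<integral>\<^sup>+ u. indicator (- {0<..<1}) (dens_cdf f u) \<partial>\<mu>) = (\<integral>\<^sup>+ s. indicator (- {0<..<1}) s * indicator {0<..<1::real} s \<partial>lborel)"
    by (rule nn_integral_cdf) simp
  also have "\<dots> = (\<integral>\<^sup>+ s. 0 \<partial>(lborel :: real measure))" by (intro nn_integral_cong) (auto simp: indicator_def)
  finally have "(\<integral>\<^sup>+ u. indicator (- {0<..<1}) (dens_cdf f u) \<partial>\<mu>) = 0" by simp
  then have "AE u in \<mu>. (indicator (- {0<..<1}) (dens_cdf f u) :: ennreal) = 0"
    by (subst (asm) nn_integral_0_iff_AE) auto
  then show ?thesis by eventually_elim (auto simp: indicator_def split: if_splits)
qed

text \<open>Pulling both quantile functions back along the cdf of the base density embeds densities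
  isometrically, through their transport maps, into \<open>L2 f\<close>.\<close>

lemma dW_eq_L2norm:
  assumes "w2_density g" "w2_density h"
  shows "dW h g = L2norm f (\<lambda>u. dens_quantile g (dens_cdf f u) - dens_quantile h (dens_cdf f u))"
proof -
  have [measurable]: "dens_quantile g \<in> borel_measurable borel" "dens_quantile h \<in> borel_measurable borel"
    using w2_density.dens_quantile_measurable assms by auto
  show ?thesis
    unfolding dW_def L2norm_def
    by (subst nn_integral_weight)
      (auto simp: nn_integral_cdf[of "\<lambda>s. ennreal ((dens_quantile g s - dens_quantile h s)\<^sup>2)"] ennreal_mult' ennreal_indicator[symmetric])
qed

lemma
  assumes g: "w2_density g"
  shows distr_transport: "distr \<mu> borel (\<lambda>u. dens_quantile g (dens_cdf f u)) = dmeas g"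
    and transport_L2: "(\<lambda>u. dens_quantile g (dens_cdf f u)) \<in> L2 f"
proof -
  have [measurable]: "dens_quantile g \<in> borel_measurable borel"
    using w2_density.dens_quantile_measurable g by auto
  have *: "(\<integral>\<^sup>+ u. k (dens_quantile g (dens_cdf f u)) \<partial>\<mu>) = (\<integral>\<^sup>+ x. k x \<partial>dmeas g)"
    if [measurable]: "k \<in> borel_measurable borel" for k
    using nn_integral_cdf[of "\<lambda>s. k (dens_quantile g s)"] w2_density.nn_integral_quantile[OF g that] by simp
  show "distr \<mu> borel (\<lambda>u. dens_quantile g (dens_cdf f u)) = dmeas g"
  proof (rule measure_eqI)
    fix A assume "A \<in> sets (distr \<mu> borel (\<lambda>u. dens_quantile g (dens_cdf f u)))"
    then have [measurable]: "A \<in> sets borel" by simp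
    have "emeasure (distr \<mu> borel (\<lambda>u. dens_quantile g (dens_cdf f u))) A
        = (\<integral>\<^sup>+ y. indicator A y \<partial>distr \<mu> borel (\<lambda>u. dens_quantile g (dens_cdf f u)))"
      by (subst nn_integral_indicator) auto
    also have "\<dots> = (\<integral>\<^sup>+ u. indicator A (dens_quantile g (dens_cdf f u)) \<partial>\<mu>)"
      by (subst nn_integral_distr) auto
    also have "\<dots> = (\<integral>\<^sup>+ x. indicator A x \<partial>dmeas g)" by (rule *) simp
    also have "\<dots> = emeasure (dmeas g) A" by (subst nn_integral_indicator) auto
    finally show "emeasure (distr \<mu> borel (\<lambda>u. dens_quantile g (dens_cdf f u))) A = emeasure (dmeas g) A" .
  qed simp
  have "(\<integral>\<^sup>+ u. ennreal ((dens_quantile g (dens_cdf f u))\<^sup>2) \<partial>\<mu>) = (\<integral>\<^sup>+ x. ennreal (x\<^sup>2) \<partial>dmeas g)"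
    by (rule *) simp
  also have "\<dots> < \<infinity>"
    using g by (simp add: w2_density_def dens_W2_def W2_measure_def)
  finally show "(\<lambda>u. dens_quantile g (dens_cdf f u)) \<in> L2 f"
    by (simp add: L2_iff_nn_integral)
qed

lemma support_ball_pos:
  assumes "w \<in> dens_support f" "e > 0"
  shows "0 < measure \<mu> (ball w e)"
  using assms by (auto simp: dens_support_def emeasure_eq_measure)

text \<open>Monotonicity on the support gives \<open>G (T u) = F u\<close>, hence one inequality. If
  the quantile \<open>y\<close> were below \<open>T u\<close>, continuity would give an interval
  just left of \<open>u\<close> that \<open>T\<close> maps above \<open>y\<close>; its positive mass
  contradicts \<open>F u \<le> G y\<close>.\<close>

lemma quantile_cdf_eq_monotone_map:
  assumes D: "is_interval (dens_support f)"
    and sm: "strict_mono_on (dens_support f) T" and cont: "continuous_on (dens_support f) T"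
    and [measurable]: "T \<in> borel_measurable borel"
    and g: "w2_density g" and distr: "distr \<mu> borel T = dmeas g"
  shows "AE u in \<mu>. dens_quantile g (dens_cdf f u) = T u"
  using AE_in_support AE_cdf_in_unit
proof eventually_elim
  case (elim u)
  let ?D = "dens_support f"
  interpret g: w2_density g by (rule g)
  have le_iff: "T x \<le> T u \<longleftrightarrow> x \<le> u" if "x \<in> ?D" for x
    using strict_mono_on_leD[OF sm] strict_mono_onD[OF sm] that elim(1) by (metis linorder_not_le)
  have cdf_g: "dens_cdf g y = measure \<mu> {x. T x \<le> y}" for y
  proof -
    have "dens_cdf g y = measure (distr \<mu> borel T) {..y}" by (simp add: dens_cdf_def distr)
    also have "\<dots> = measure \<mu> {x. T x \<le> y}" by (subst measure_distr) (auto simp: vimage_def)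
    finally show ?thesis .
  qed
  have q: "dens_quantile g (dens_cdf f u) \<le> y \<longleftrightarrow> dens_cdf f u \<le> dens_cdf g y" for y
    using g.quantile_le_iff[of "dens_cdf f u"] elim(2) by simp
  have "AE x in \<mu>. x \<in> {x. T x \<le> T u} \<longleftrightarrow> x \<in> {..u}"
    using AE_in_support by eventually_elim (simp add: le_iff)
  then have "measure \<mu> {x. T x \<le> T u} = measure \<mu> {..u}"
    by (rule finite_measure_eq_AE) auto
  then have "dens_cdf g (T u) = dens_cdf f u"
    by (simp add: cdf_g dens_cdf_def[of f])
  then have le: "dens_quantile g (dens_cdf f u) \<le> T u" by (simp add: q)
  show ?case
  proof (rule antisym[OF le], rule ccontr)
    define y where "y = dens_quantile g (dens_cdf f u)"
    assume "\<not> T u \<le> dens_quantile g (dens_cdf f u)"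
    then have y: "y < T u" by (simp add: y_def)
    have Fy: "dens_cdf f u \<le> dens_cdf g y" using q[of y] by (simp add: y_def)
    \<comment> \<open>Otherwise \<open>{..u}\<close> would carry only the mass of the point
      \<open>u\<close>, and the cdf would vanish there.\<close>
    have "\<exists>x0\<in>?D. x0 < u"
    proof (rule ccontr)
      assume *: "\<not> (\<exists>x0\<in>?D. x0 < u)"
      have "AE x in \<mu>. x \<in> {..u} \<longleftrightarrow> x \<in> {u}"
        using AE_in_support by eventually_elim (use * in force)
      then have "measure \<mu> {..u} = measure \<mu> {u}"
        by (rule finite_measure_eq_AE) auto
      then show False using elim(2) by (simp add: dens_cdf_def measure_def)
    qed
    then obtain x0 where x0: "x0 \<in> ?D" "x0 < u" by blast
    obtain \<delta> where \<delta>: "\<delta> > 0" "\<And>x. x \<in> ?D \<Longrightarrow> dist x u < \<delta> \<Longrightarrow> dist (T x) (T u) < T u - y"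
      using cont elim(1) y unfolding continuous_on_iff by (metis diff_gt_0_iff_gt)
    \<comment> \<open>Right of \<open>x0\<close>, the interval from \<open>a\<close> to
      \<open>u\<close> lies in the support; within \<delta> of \<open>u\<close>, its image stays
      above \<open>y\<close>.\<close>
    define a where "a = max x0 (u - \<delta>)"
    have a: "a < u" using x0 \<delta> by (simp add: a_def)
    define w where "w = (a + u) / 2"
    define e where "e = (u - a) / 2"
    have e: "e > 0" using a by (simp add: e_def)
    have ball: "ball w e = {a<..<u}"
      by (auto simp: ball_def dist_real_def w_def e_def abs_less_iff field_simps)
    have inD: "x \<in> ?D" if "a < x" "x < u" for x
      using mem_is_interval_1_I[OF D x0(1) elim(1), of x] that by (auto simp: a_def)
    have gt: "y < T x" if "a < x" "x < u" for x
      using \<delta>(2)[OF inD[OF that]] that by (auto simp: a_def dist_real_def abs_less_iff)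
    have wD: "w \<in> ?D" using a by (intro inD) (auto simp: w_def)
    have "0 < measure \<mu> {a<..<u}" using support_ball_pos[OF wD e] by (simp add: ball)
    moreover have "dens_cdf g y + measure \<mu> {a<..<u} \<le> dens_cdf f u"
    proof -
      have "dens_cdf g y + measure \<mu> {a<..<u} = measure \<mu> ({x. T x \<le> y} \<union> {a<..<u})"
        unfolding cdf_g using gt by (subst finite_measure_Union) (auto simp: not_less[symmetric])
      also have "\<dots> \<le> measure \<mu> {..u}"
      proof (rule finite_measure_mono_AE)
        show "AE x in \<mu>. x \<in> {x. T x \<le> y} \<union> {a<..<u} \<longrightarrow> x \<in> {..u}"
          using AE_in_support
        proof eventually_elim
          case (elim x)
          then show ?case using le_iff[of x] y by auto
        qed
      qed simp
      finally show ?thesis by (simp add: dens_cdf_def)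
    qed
    ultimately show False using Fy by simp
  qed
qed

lemma quantile_cdf_eq_id:
  assumes "is_interval (dens_support f)"
  shows "AE u in \<mu>. dens_quantile f (dens_cdf f u) = u"
  using assms
  by (rule quantile_cdf_eq_monotone_map)
    (auto simp: strict_mono_on_def w2_density_axioms distr_id2)

end

subsection \<open>Densities of the image measures\<close>

text \<open>Near \<open>x\<close> the difference quotient of \<open>T\<close> exceeds half the
  derivative, so the inverse satisfies a Lipschitz bound at \<open>T x\<close> with constant
  \<open>2 / d\<close>. The constant varies with \<open>x\<close>, so the local Lipschitz criterion
  for null images is applied to the inverse.\<close>

lemma negligible_vimage_pos_derivative:
  fixes T :: "real \<Rightarrow> real"
  assumes J: "open J" and sm: "strict_mono_on J T"
    and der: "\<And>x. x \<in> J \<Longrightarrow> \<exists>d>0. (T has_real_derivative d) (at x)"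
    and N: "negligible N"
  shows "negligible (J \<inter> T -` N)"
proof -
  let ?E = "J \<inter> T -` N"
  define R where "R = the_inv_into J T"
  have inj: "inj_on T J" by (rule strict_mono_on_imp_inj_on[OF sm])
  have RT: "R (T x) = x" if "x \<in> J" for x using that inj by (simp add: R_def the_inv_into_f_f)
  have "negligible (R ` (T ` ?E))"
  proof (rule negligible_locally_Lipschitz_image)
    show "negligible (T ` ?E)" using N by (rule negligible_subset) auto
    fix z assume "z \<in> T ` ?E"
    then obtain x where x: "x \<in> J" "z = T x" by auto
    obtain d where d: "d > 0" "(T has_real_derivative d) (at x)" using der[OF x(1)] by blast
    have "((\<lambda>y. (T y - T x) / (y - x)) \<longlongrightarrow> d) (at x)"
      using d(2) by (simp add: has_field_derivative_iff)
    then have "\<forall>\<^sub>F y in at x. d / 2 < (T y - T x) / (y - x)"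
      using d(1) by (intro order_tendstoD(1)) auto
    moreover have "\<forall>\<^sub>F y in at x. y \<in> J"
      using J x(1) by (rule eventually_at_in_open')
    ultimately have "\<forall>\<^sub>F y in at x. y \<in> J \<and> d / 2 < (T y - T x) / (y - x)"
      by eventually_elim simp
    then obtain \<delta> where \<delta>: "\<delta> > 0"
      "\<And>y. y \<noteq> x \<Longrightarrow> dist y x < \<delta> \<Longrightarrow> y \<in> J \<and> d / 2 < (T y - T x) / (y - x)"
      unfolding eventually_at by auto
    define a b where "a = x - \<delta> / 2" and "b = x + \<delta> / 2"
    have ab: "a \<in> J" "b \<in> J" "a < x" "x < b"
      using \<delta>(1) \<delta>(2)[of a] \<delta>(2)[of b] by (auto simp: a_def b_def dist_real_def)
    \<comment> \<open>Strict monotonicity turns closeness of values into closeness of arguments: a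
      value between \<open>T a\<close> and \<open>T b\<close> comes from a point between
      \<open>a\<close> and \<open>b\<close>, where the bound on the quotient holds.\<close>
    have "norm (R z' - R z) \<le> 2 / d * norm (z' - z)" if "z' \<in> T ` ?E \<inter> {T a<..<T b}" for z'
    proof -
      obtain y where y: "y \<in> J" "z' = T y" "T a < T y" "T y < T b" using \<open>z' \<in> _\<close> by auto
      have "a < y" "y < b"
        using strict_mono_on_less[OF sm] y ab by auto
      then have close: "dist y x < \<delta>" using \<delta>(1) by (auto simp: a_def b_def dist_real_def abs_less_iff)
      show ?thesis
      proof (cases "y = x")
        case False
        then have "d / 2 < (T y - T x) / (y - x)" using \<delta>(2) close by blast
        then have "d / 2 \<le> \<bar>T y - T x\<bar> / \<bar>y - x\<bar>"
          by (metis abs_divide abs_ge_self order_less_imp_le order_trans)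
        then have "d / 2 * \<bar>y - x\<bar> \<le> \<bar>T y - T x\<bar>"
          using False by (simp add: field_simps)
        then show ?thesis using d(1) x y by (simp add: RT field_simps)
      qed (use x y in simp)
    qed
    moreover have "T a < z" "z < T b"
      using strict_mono_onD[OF sm] ab x by auto
    ultimately show "\<exists>U B. open U \<and> z \<in> U \<and> (\<forall>z'\<in>T ` ?E \<inter> U. norm (R z' - R z) \<le> B * norm (z' - z))"
      by (intro exI[of _ "{T a<..<T b}"] exI[of _ "2 / d"]) auto
  qed simp
  moreover have "R ` (T ` ?E) = ?E"
    using RT by (force simp: image_iff)
  ultimately show ?thesis by simp
qed

context w2_density
begin

lemma negligible_null:
  assumes "A \<in> sets borel" "negligible A"
  shows "A \<in> null_sets \<mu>"
proof -
  have "A \<in> null_sets lborel"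
    using assms by (simp add: negligible_iff_null_sets null_sets_completion_iff)
  then have "AE x in lborel. x \<notin> A" by (rule AE_not_in)
  then have "AE x in \<mu>. x \<notin> A" by (subst AE_density) (auto elim: eventually_mono)
  then show ?thesis using assms(1) by (subst (asm) AE_iff_null_sets[symmetric]) auto
qed

lemma increasing_map_image:
  assumes D: "is_interval (dens_support f)" and V: "V \<in> L2 f"
    and der: "\<And>u. u \<in> dens_support f \<Longrightarrow>
       \<exists>d. (V has_real_derivative d) (at u within dens_support f) \<and> d > -1"
  shows "strict_mono_on (dens_support f) (\<lambda>u. V u + u)"
    and "continuous_on (dens_support f) (\<lambda>u. V u + u)"
    and "\<exists>g\<in>Dens. Exp_map f V = dmeas g"
proof -
  let ?D = "dens_support f"
  define T where "T u = V u + u" for u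
  have [measurable]: "V \<in> borel_measurable borel" by (rule L2_measurable[OF V])
  have [measurable]: "T \<in> borel_measurable borel" unfolding T_def by measurable
  have derT: "\<exists>d>0. (T has_real_derivative d) (at u within ?D)" if u: "u \<in> ?D" for u
  proof -
    obtain d where d: "(V has_real_derivative d) (at u within ?D)" "d > -1" using der[OF u] by blast
    have "(T has_real_derivative (d + 1)) (at u within ?D)"
      unfolding T_def by (intro derivative_intros d)
    then show ?thesis using d(2) by (intro exI[of _ "d + 1"]) auto
  qed
  show cont: "continuous_on ?D (\<lambda>u. V u + u)"
    using derT unfolding T_def[symmetric]
    by (meson DERIV_continuous_on continuous_on_eq_continuous_within DERIV_continuous)
  \<comment> \<open>Derivatives are taken within the support, so they are two-sided only in its
    interior; at endpoints just continuity is used.\<close>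
  have derI: "\<exists>d>0. (T has_real_derivative d) (at u)" if "u \<in> interior ?D" for u
    using derT[of u] that at_within_interior[OF that] interior_subset by auto
  show sm: "strict_mono_on ?D (\<lambda>u. V u + u)"
    unfolding T_def[symmetric]
  proof (rule strict_mono_onI)
    fix r s assume rs: "r \<in> ?D" "s \<in> ?D" "r < s"
    have sub: "{r..s} \<subseteq> ?D" using mem_is_interval_1_I[OF D rs(1,2)] by auto
    show "T r < T s"
    proof (rule DERIV_pos_imp_increasing_open[OF rs(3)])
      show "continuous_on {r..s} T"
        using continuous_on_subset[OF cont sub] by (simp add: T_def[abs_def])
      fix x assume x: "r < x" "x < s"
      have "{r<..<s} \<subseteq> interior ?D" using sub by (intro interior_maximal) auto
      then have "x \<in> interior ?D" using x by auto
      then show "\<exists>y. (T has_real_derivative y) (at x) \<and> 0 < y" using derI by blast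
    qed
  qed
  have TL2: "T \<in> L2 f" unfolding T_def by (rule L2_add[OF V id_in_L2])
  let ?\<nu> = "distr \<mu> borel T"
  interpret \<nu>: prob_space ?\<nu> by (rule prob_space_distr) simp
  have ac: "absolutely_continuous lborel ?\<nu>"
    unfolding absolutely_continuous_def
  proof
    fix N :: "real set" assume N: "N \<in> null_sets lborel"
    then have [measurable]: "N \<in> sets borel" by auto
    \<comment> \<open>The preimage of \<open>N\<close> is split: inside the interval the positive
      derivative makes it null, and the frontier of the interval is null by itself.\<close>
    have "negligible N"
      using N by (simp add: negligible_iff_null_sets null_sets_completionI)
    then have "negligible (interior ?D \<inter> T -` N)"
      using monotone_on_subset[OF sm interior_subset] derI unfolding T_def[symmetric, abs_def]
      by (intro negligible_vimage_pos_derivative) (auto simp: T_def[abs_def])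
    moreover have "T -` N \<in> sets borel" using measurable_sets[of T borel borel N] by simp
    ultimately have 1: "interior ?D \<inter> T -` N \<in> null_sets \<mu>" by (intro negligible_null) auto
    have "negligible (frontier ?D)"
      using D by (intro negligible_convex_frontier) (simp add: is_interval_convex)
    then have 2: "frontier ?D \<in> null_sets \<mu>" by (intro negligible_null) auto
    have "AE x in \<mu>. x \<notin> T -` N"
      using AE_in_support AE_not_in[OF 1] AE_not_in[OF 2]
    proof eventually_elim
      case (elim x)
      then show ?case using closure_subset[of ?D] by (auto simp: frontier_def)
    qed
    then have "T -` N \<in> null_sets \<mu>"
      using \<open>T -` N \<in> sets borel\<close> by (subst (asm) AE_iff_null_sets[symmetric]) auto
    then have "emeasure ?\<nu> N = 0" by (subst emeasure_distr) auto
    then show "N \<in> null_sets ?\<nu>" by (auto simp: null_sets_def)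
  qed
  then obtain h where h [measurable]: "h \<in> borel_measurable borel" and h\<nu>: "density lborel h = ?\<nu>"
    using sigma_finite_measure.Radon_Nikodym[OF sigma_finite_lborel ac] by auto
  \<comment> \<open>The Radon-Nikodym density takes extended values; having integral 1, it is finite
    almost everywhere and can be replaced by a real function.\<close>
  define g where "g x = enn2real (h x)" for x
  have [measurable]: "g \<in> borel_measurable borel" unfolding g_def by measurable
  have "(\<integral>\<^sup>+ x. h x \<partial>lborel) = emeasure (density lborel h) UNIV" by (subst emeasure_density) auto
  also have "\<dots> = 1" unfolding h\<nu> using \<nu>.emeasure_space_1 by simp
  finally have h1: "(\<integral>\<^sup>+ x. h x \<partial>lborel) = 1" .
  then have "AE x in lborel. h x \<noteq> \<infinity>" by (intro nn_integral_PInf_AE) auto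
  then have gh: "AE x in lborel. ennreal (g x) = h x"
    by eventually_elim (simp add: g_def less_top)
  have g\<nu>: "dmeas g = ?\<nu>"
    unfolding h\<nu>[symmetric] using gh by (intro density_cong) auto
  have "(\<integral>\<^sup>+ x. ennreal (g x) \<partial>lborel) = 1"
    using h1 nn_integral_cong_AE[OF gh] by simp
  then have "is_density g" by (simp add: is_density_def g_def[abs_def])
  moreover have "W2_measure (dmeas g)"
    unfolding g\<nu> W2_measure_def using TL2 \<nu>.prob_space_axioms
    by (simp add: nn_integral_distr L2_iff_nn_integral)
  ultimately have "g \<in> Dens" by (simp add: Dens_def dens_W2_def)
  then show "\<exists>g\<in>Dens. Exp_map f V = dmeas g"
    using g\<nu> by (intro bexI[of _ g]) (auto simp: Exp_map_def T_def[abs_def])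
qed

end

section \<open>The image densities and their Wasserstein mean\<close>

lemma Dens_iff: "g \<in> Dens \<longleftrightarrow> w2_density g"
  by (simp add: Dens_def w2_density_def)

context ar_model
begin

lemma series_limit_image_densities:
  assumes D: "is_interval (dens_support f)"
    and VL: "\<And>t \<omega>. V t \<omega> \<in> L2 f"
    and Vm: "\<And>t. V t \<in> measurable M (tangent_borel f)"
    and lim: "\<And>t. AE \<omega> in M. (\<lambda>n. L2norm f (\<lambda>u. V t \<omega> u - partial_sol t n \<omega> u)) \<longlonglongrightarrow> 0"
    and der: "\<And>t. AE \<omega> in M. \<forall>u \<in> dens_support f.
           \<exists>d. (V t \<omega> has_real_derivative d) (at u within dens_support f) \<and> d > -1"
  shows "\<exists>ft :: int \<Rightarrow> 'a \<Rightarrow> real \<Rightarrow> real.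
          (\<forall>t. \<forall>\<omega>\<in>space M. ft t \<omega> \<in> Dens) \<and>
          (\<forall>t. AE \<omega> in M. Exp_map f (V t \<omega>) = dmeas (ft t \<omega>)) \<and>
          strictly_stationary M wass_borel ft \<and>
          (\<forall>t. wasserstein_mean M (ft t) f) \<and>
          (\<forall>t. AE \<omega> in M. L2norm f
               (\<lambda>u. V t \<omega> u - (dens_quantile (ft t \<omega>) (dens_cdf f u) - u)) = 0)"
proof -
  let ?D = "dens_support f"
  have fD: "f \<in> Dens" by (simp add: Dens_iff w2_density_axioms)
  have "\<exists>N. N \<in> null_sets M \<and> (\<forall>\<omega>\<in>space M - N. \<forall>u\<in>?D. \<exists>d. (V t \<omega> has_real_derivative d) (at u within ?D) \<and> d > -1)" for t
    using der[of t] by (elim AE_E3) blast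
  then obtain N where N: "\<And>t. N t \<in> null_sets M"
    and derN: "\<And>t \<omega> u. \<omega> \<in> space M - N t \<Longrightarrow> u \<in> ?D \<Longrightarrow>
        \<exists>d. (V t \<omega> has_real_derivative d) (at u within ?D) \<and> d > -1"
    by metis
  have [measurable]: "N t \<in> sets M" for t using N[of t] by auto
  have AE_N: "AE \<omega> in M. \<omega> \<in> space M - N t" for t
    using AE_not_in[OF N[of t]] AE_space by eventually_elim auto
  \<comment> \<open>The choice is made for each \<omega> separately, with no regard to
    measurability; on the null set \<open>N t\<close> the default \<open>f\<close> keeps the value
    in \<open>Dens\<close>.\<close>
  define ft where "ft t \<omega> = (if \<omega> \<in> space M - N t then SOME g. g \<in> Dens \<and> Exp_map f (V t \<omega>) = dmeas g else f)" for t \<omega>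
  have ft: "ft t \<omega> \<in> Dens" "Exp_map f (V t \<omega>) = dmeas (ft t \<omega>)" if \<omega>: "\<omega> \<in> space M - N t" for t \<omega>
  proof -
    have "\<exists>g. g \<in> Dens \<and> Exp_map f (V t \<omega>) = dmeas g"
      using increasing_map_image(3)[OF D VL derN[OF \<omega>]] by blast
    from someI_ex[OF this] show "ft t \<omega> \<in> Dens" "Exp_map f (V t \<omega>) = dmeas (ft t \<omega>)"
      using \<omega> by (auto simp: ft_def)
  qed
  have ftD: "ft t \<omega> \<in> Dens" for t \<omega>
    using ft(1)[of \<omega> t] fD by (cases "\<omega> \<in> space M - N t") (auto simp: ft_def)
  have transport: "AE u in \<mu>. dens_quantile (ft t \<omega>) (dens_cdf f u) = V t \<omega> u + u"
    if \<omega>: "\<omega> \<in> space M - N t" for t \<omega>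
  proof (rule quantile_cdf_eq_monotone_map[OF D])
    show "strict_mono_on ?D (\<lambda>u. V t \<omega> u + u)"
      by (rule increasing_map_image(1)[OF D VL derN[OF \<omega>]])
    show "continuous_on ?D (\<lambda>u. V t \<omega> u + u)"
      by (rule increasing_map_image(2)[OF D VL derN[OF \<omega>]])
    show "(\<lambda>u. V t \<omega> u + u) \<in> borel_measurable borel"
      using L2_measurable[OF VL[of t \<omega>]] by simp
    show "w2_density (ft t \<omega>)" using ftD by (simp add: Dens_iff)
    show "distr \<mu> borel (\<lambda>u. V t \<omega> u + u) = dmeas (ft t \<omega>)"
      using ft(2)[OF \<omega>] by (simp add: Exp_map_def)
  qed
  define \<psi> where "\<psi> g u = dens_quantile g (dens_cdf f u) - u" for g u
  have \<psi>L2: "\<psi> g \<in> L2 f" if "g \<in> Dens" for g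
    unfolding \<psi>_def using that by (intro L2_diff transport_L2 id_in_L2) (simp add: Dens_iff)
  have dW_eq: "dW g (ft t \<omega>) = L2norm f (\<lambda>u. V t \<omega> u - \<psi> g u)"
    if g: "g \<in> Dens" and \<omega>: "\<omega> \<in> space M - N t" for g t \<omega>
  proof -
    have wd: "w2_density g" "w2_density (ft t \<omega>)" using g ftD by (auto simp: Dens_iff)
    have "dW g (ft t \<omega>) = L2norm f (\<lambda>u. dens_quantile (ft t \<omega>) (dens_cdf f u) - dens_quantile g (dens_cdf f u))"
      by (rule dW_eq_L2norm[OF wd(2,1)])
    also have "\<dots> = L2norm f (\<lambda>u. V t \<omega> u - \<psi> g u)"
    proof (rule L2norm_cong_AE)
      show "AE u in \<mu>. dens_quantile (ft t \<omega>) (dens_cdf f u) - dens_quantile g (dens_cdf f u) = V t \<omega> u - \<psi> g u"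
        using transport[OF \<omega>] by eventually_elim (simp add: \<psi>_def)
    qed (intro L2_measurable L2_diff transport_L2 wd VL \<psi>L2 g)+
    finally show ?thesis .
  qed
  have dW_commute: "dW g h = dW h g" for g h
    by (simp add: dW_def power2_commute)
  \<comment> \<open>Off \<open>N t\<close>, distances from a fixed density to
    \<open>ft t \<omega>\<close> are norm distances from \<open>V t \<omega>\<close> to a fixed
    function, so the arbitrary choice of densities does no harm.\<close>
  have ft_meas: "ft t \<in> measurable M wass_borel" for t
    unfolding wass_borel_def
  proof (rule measurable_measure_of)
    fix A assume "A \<in> {Dens \<inter> {g. dW h g < r} |h r. h \<in> Dens}"
    then obtain h r where A: "A = Dens \<inter> {g. dW h g < r}" and h: "h \<in> Dens" by auto
    have [measurable]: "(\<lambda>\<omega>. L2norm f (\<lambda>u. V t \<omega> u - \<psi> h u)) \<in> borel_measurable M"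
      by (rule measurable_compose[OF Vm L2norm_diff_measurable[OF \<psi>L2[OF h]]])
    have "ft t -` A \<inter> space M = {\<omega> \<in> space M. (if \<omega> \<in> N t then dW h f else L2norm f (\<lambda>u. V t \<omega> u - \<psi> h u)) < r}"
    proof -
      have "dW h (ft t \<omega>) = (if \<omega> \<in> N t then dW h f else L2norm f (\<lambda>u. V t \<omega> u - \<psi> h u))"
        if "\<omega> \<in> space M" for \<omega>
        using that dW_eq[OF h, of \<omega> t] by (cases "\<omega> \<in> N t") (auto simp: ft_def)
      then show ?thesis using ftD by (auto simp: A)
    qed
    also have "\<dots> \<in> sets M" by measurable
    finally show "ft t -` A \<inter> space M \<in> sets M" .
  qed (use ftD in auto)
  have "strictly_stationary M wass_borel ft"
    unfolding wass_borel_def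
  proof (rule strictly_stationary_transfer[OF series_limit_stationary[OF Vm lim]])
    show "ft t \<in> measurable M (sigma Dens {Dens \<inter> {g. dW h g < r} |h r. h \<in> Dens})" for t
      using ft_meas[of t] unfolding wass_borel_def .
    let ?PN = "PiM (UNIV::int set) (\<lambda>_. tangent_borel f)"
    fix t A assume "A \<in> {Dens \<inter> {g. dW h g < r} |h r. h \<in> Dens}"
    then obtain h r where A: "A = Dens \<inter> {g. dW h g < r}" and h: "h \<in> Dens" by auto
    define B where "B = {x \<in> space ?PN. L2norm f (\<lambda>u. x t u - \<psi> h u) < r}"
    have [measurable]: "(\<lambda>x. L2norm f (\<lambda>u. x t u - \<psi> h u)) \<in> borel_measurable ?PN"
      by (rule measurable_compose[OF _ L2norm_diff_measurable[OF \<psi>L2[OF h]]])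
        (rule measurable_component_singleton, simp)
    have "B \<in> sets ?PN" unfolding B_def by measurable
    moreover have "AE \<omega> in M. ft (t + k) \<omega> \<in> A \<longleftrightarrow> (\<lambda>s. V (s + k) \<omega>) \<in> B" for k
      using AE_N[of "t + k"]
    proof eventually_elim
      case (elim \<omega>)
      have "(\<lambda>s. V (s + k) \<omega>) \<in> space ?PN"
        using measurable_space[OF measurable_coord_shift[of V, OF Vm], of \<omega>] elim by simp
      then show ?case using dW_eq[OF h elim] ftD by (simp add: A B_def)
    qed
    ultimately show "\<exists>B\<in>sets ?PN. \<forall>k. AE \<omega> in M. ft (t + k) \<omega> \<in> A \<longleftrightarrow> (\<lambda>s. V (s + k) \<omega>) \<in> B"
      by (intro bexI[of _ B] allI)
  qed auto
  moreover have "wasserstein_mean M (ft t) f" for t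
  proof -
    let ?E = "\<integral>\<^sup>+ \<omega>. ennreal ((L2norm f (sol t \<omega>))\<^sup>2) \<partial>M"
    have energy: "(\<integral>\<^sup>+ \<omega>. ennreal ((dW (ft t \<omega>) g)\<^sup>2) \<partial>M) = ?E + ennreal ((L2norm f (\<psi> g))\<^sup>2)"
      if g: "g \<in> Dens" for g
    proof -
      have "AE \<omega> in M. ennreal ((dW (ft t \<omega>) g)\<^sup>2) = ennreal ((L2norm f (\<lambda>u. sol t \<omega> u - \<psi> g u))\<^sup>2)"
        using AE_N[of t] lim[of t] AE_good[of t]
      proof eventually_elim
        case (elim \<omega>)
        \<comment> \<open>\<open>V t\<close> and \<open>sol t\<close> are limits of the same partial
          sums, so the expectation may be computed with the version whose sections are
          centred.\<close>
        have "L2norm f (\<lambda>u. V t \<omega> u - \<psi> g u) = L2norm f (\<lambda>u. sol t \<omega> u - \<psi> g u)"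
          using L2norm_diff_continuous[OF elim(2) VL partial_sol_L2 \<psi>L2[OF g]]
            L2norm_diff_continuous[OF sol_series_tendsto[OF elim(3)] sol_L2 partial_sol_L2 \<psi>L2[OF g]]
          by (rule LIMSEQ_unique)
        then show ?case using dW_eq[OF g elim(1)] by (simp add: dW_commute[of "ft t \<omega>"])
      qed
      then have "(\<integral>\<^sup>+ \<omega>. ennreal ((dW (ft t \<omega>) g)\<^sup>2) \<partial>M)
          = (\<integral>\<^sup>+ \<omega>. ennreal ((L2norm f (\<lambda>u. sol t \<omega> u - \<psi> g u))\<^sup>2) \<partial>M)"
        by (rule nn_integral_cong_AE)
      then show ?thesis by (simp only: sol_energy_decomposition[OF \<psi>L2[OF g]])
    qed
    have "AE u in \<mu>. \<psi> f u = 0"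
      using quantile_cdf_eq_id[OF D] by eventually_elim (simp add: \<psi>_def)
    then have "L2norm f (\<psi> f) = 0" using L2norm_eq_0_iff[OF \<psi>L2[OF fD]] by simp
    then have energy_f: "(\<integral>\<^sup>+ \<omega>. ennreal ((dW (ft t \<omega>) f)\<^sup>2) \<partial>M) = ?E"
      using energy[OF fD] by simp
    show ?thesis
      unfolding wasserstein_mean_def
    proof (intro conjI ballI impI)
      show "f \<in> Dens" by (rule fD)
      show "(\<integral>\<^sup>+ \<omega>. ennreal ((dW (ft t \<omega>) f)\<^sup>2) \<partial>M) < \<infinity>"
        unfolding energy_f by (rule sol_energy_finite)
      fix g assume g: "g \<in> Dens"
      show "(\<integral>\<^sup>+ \<omega>. ennreal ((dW (ft t \<omega>) f)\<^sup>2) \<partial>M) \<le> (\<integral>\<^sup>+ \<omega>. ennreal ((dW (ft t \<omega>) g)\<^sup>2) \<partial>M)"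
        unfolding energy_f energy[OF g] by simp
      assume "(\<integral>\<^sup>+ \<omega>. ennreal ((dW (ft t \<omega>) g)\<^sup>2) \<partial>M) = (\<integral>\<^sup>+ \<omega>. ennreal ((dW (ft t \<omega>) f)\<^sup>2) \<partial>M)"
      \<comment> \<open>The common term \<open>?E\<close> is finite and can be cancelled, forcing
        the displacement from \<open>f\<close> to \<open>g\<close> to vanish almost everywhere; the
        measure with density \<open>g\<close>, being the image under that transport, is then the
        base measure.\<close>
      then have "?E + ennreal ((L2norm f (\<psi> g))\<^sup>2) = ?E + 0"
        unfolding energy_f energy[OF g] by simp
      then have "ennreal ((L2norm f (\<psi> g))\<^sup>2) = 0"
        using sol_energy_finite[of t] by (subst (asm) ennreal_add_left_cancel) auto
      then have "L2norm f (\<psi> g) = 0" by simp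
      then have "AE u in \<mu>. \<psi> g u = 0" using L2norm_eq_0_iff[OF \<psi>L2[OF g]] by simp
      then have "AE u in \<mu>. dens_quantile g (dens_cdf f u) = u"
        by eventually_elim (simp add: \<psi>_def)
      moreover have "w2_density g" using g by (simp add: Dens_iff)
      ultimately have "distr \<mu> borel (\<lambda>u. dens_quantile g (dens_cdf f u)) = distr \<mu> borel (\<lambda>u. u)"
        using L2_measurable[OF transport_L2[of g]] by (intro distr_cong_AE) auto
      then show "dmeas g = dmeas f"
        using distr_transport[OF \<open>w2_density g\<close>] by (simp add: distr_id2)
    qed
  qed
  moreover have "AE \<omega> in M. L2norm f (\<lambda>u. V t \<omega> u - (dens_quantile (ft t \<omega>) (dens_cdf f u) - u)) = 0" for t
    using AE_N[of t]
  proof eventually_elim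
    case (elim \<omega>)
    have "AE u in \<mu>. V t \<omega> u - \<psi> (ft t \<omega>) u = 0"
      using transport[OF elim] by eventually_elim (simp add: \<psi>_def)
    then show ?case
      using L2norm_eq_0_iff[OF L2_diff[OF VL[of t \<omega>] \<psi>L2[OF ftD[of t \<omega>]]]] by (simp add: \<psi>_def)
  qed
  moreover have "AE \<omega> in M. Exp_map f (V t \<omega>) = dmeas (ft t \<omega>)" for t
    using AE_N[of t] by eventually_elim (rule ft(2))
  ultimately show ?thesis using ftD by (intro exI[of _ ft]) blast
qed

end

text \<open>Differentiability is not a property of a class modulo null sets. The second half
  therefore speaks of every measurable version \<open>V\<close> of the limit, so that (A3) can be
  asked of a version with smooth paths.\<close>

theorem theorem1:
  fixes M :: "'a measure" and f0 :: "real \<Rightarrow> real" and \<beta> :: real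
    and \<epsilon> :: "int \<Rightarrow> 'a \<Rightarrow> real \<Rightarrow> real"
  assumes P: "prob_space M"
    and f0: "dens_W2 f0"
    and D_int: "is_interval (dens_support f0)"
    and eps_tan: "\<And>t \<omega>. \<epsilon> t \<omega> \<in> tangent f0"
    and eps_meas: "\<And>t. \<epsilon> t \<in> measurable M (tangent_borel f0)"
    and eps_joint: "\<And>t. (\<lambda>(\<omega>, u). \<epsilon> t \<omega> u) \<in> borel_measurable (M \<Otimes>\<^sub>M lborel)"
    and eps_mean: "\<And>t u. u \<in> dens_support f0 \<Longrightarrow>
                      integrable M (\<lambda>\<omega>. \<epsilon> t \<omega> u) \<and> (\<integral>\<omega>. \<epsilon> t \<omega> u \<partial>M) = 0"
    and A1: "\<bar>\<beta>\<bar> < 1"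
    and A2_indep: "prob_space.indep_vars M (\<lambda>_. tangent_borel f0) \<epsilon> UNIV"
    and A2_ident: "\<And>t. distr M (tangent_borel f0) (\<epsilon> t) = distr M (tangent_borel f0) (\<epsilon> 0)"
    and A2_cov: "\<And>t. (\<integral>\<^sup>+ u. ennreal (f0 u) * (\<integral>\<^sup>+ \<omega>. ennreal ((\<epsilon> t \<omega> u)\<^sup>2) \<partial>M) \<partial>lborel) < \<infinity>"
  shows
   "(\<exists>V :: int \<Rightarrow> 'a \<Rightarrow> real \<Rightarrow> real.
       (\<forall>t \<omega>. V t \<omega> \<in> tangent f0) \<and>
       (\<forall>t. AE \<omega> in M. L2norm f0 (\<lambda>u. V t \<omega> u - (\<beta> * V (t - 1) \<omega> u + \<epsilon> t \<omega> u)) = 0) \<and>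
       strictly_stationary M (tangent_borel f0) V \<and>
       (\<forall>t. AE \<omega> in M. (\<lambda>n. L2norm f0 (\<lambda>u. V t \<omega> u - (\<Sum>i\<le>n. \<beta> ^ i * \<epsilon> (t - int i) \<omega> u)))
                \<longlonglongrightarrow> 0) \<and>
       (\<forall>t. (\<lambda>n. \<integral>\<^sup>+ \<omega>. ennreal ((L2norm f0 (\<lambda>u. V t \<omega> u - (\<Sum>i\<le>n. \<beta> ^ i * \<epsilon> (t - int i) \<omega> u)))\<^sup>2) \<partial>M)
                \<longlonglongrightarrow> 0) \<and>
       (\<forall>W :: int \<Rightarrow> 'a \<Rightarrow> real \<Rightarrow> real.
          (\<forall>t. AE \<omega> in M. L2norm f0 (\<lambda>u. W t \<omega> u - (\<beta> * W (t - 1) \<omega> u + \<epsilon> t \<omega> u)) = 0) \<and>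
          strictly_stationary M (tangent_borel f0) W \<longrightarrow>
          (\<forall>t. AE \<omega> in M. L2norm f0 (\<lambda>u. W t \<omega> u - V t \<omega> u) = 0)))
    \<and>
    (\<forall>V :: int \<Rightarrow> 'a \<Rightarrow> real \<Rightarrow> real.
       (\<forall>t \<omega>. V t \<omega> \<in> tangent f0) \<and>
       (\<forall>t. V t \<in> measurable M (tangent_borel f0)) \<and>
       (\<forall>t. AE \<omega> in M. (\<lambda>n. L2norm f0 (\<lambda>u. V t \<omega> u - (\<Sum>i\<le>n. \<beta> ^ i * \<epsilon> (t - int i) \<omega> u)))
                \<longlonglongrightarrow> 0) \<and>
       (\<forall>t. AE \<omega> in M. \<forall>u \<in> dens_support f0.
           \<exists>d. (V t \<omega> has_real_derivative d) (at u within dens_support f0) \<and> d > -1)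
     \<longrightarrow>
       (\<exists>ft :: int \<Rightarrow> 'a \<Rightarrow> real \<Rightarrow> real.
          (\<forall>t. \<forall>\<omega>\<in>space M. ft t \<omega> \<in> Dens) \<and>
          (\<forall>t. AE \<omega> in M. Exp_map f0 (V t \<omega>) = density lborel (ft t \<omega>)) \<and>
          strictly_stationary M wass_borel ft \<and>
          (\<forall>t. wasserstein_mean M (ft t) f0) \<and>
          (\<forall>t. AE \<omega> in M. L2norm f0
               (\<lambda>u. V t \<omega> u - (dens_quantile (ft t \<omega>) (dens_cdf f0 u) - u)) = 0)))"
proof -
  interpret w2_density f0 by (rule w2_density.intro) (rule f0)
  interpret P: prob_space M by (rule P)
  interpret ar_model f0 M \<beta> \<epsilon>
    using eps_tan eps_meas eps_joint eps_mean A1 A2_indep A2_ident A2_cov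
    by unfold_locales (auto simp: tangent_eq_L2)
  show ?thesis
    unfolding tangent_eq_L2
  proof (intro conjI allI impI; (elim conjE)?)
    show "\<exists>V :: int \<Rightarrow> 'a \<Rightarrow> real \<Rightarrow> real.
       (\<forall>t \<omega>. V t \<omega> \<in> L2 f0) \<and>
       (\<forall>t. AE \<omega> in M. L2norm f0 (\<lambda>u. V t \<omega> u - (\<beta> * V (t - 1) \<omega> u + \<epsilon> t \<omega> u)) = 0) \<and>
       strictly_stationary M (tangent_borel f0) V \<and>
       (\<forall>t. AE \<omega> in M. (\<lambda>n. L2norm f0 (\<lambda>u. V t \<omega> u - partial_sol t n \<omega> u)) \<longlonglongrightarrow> 0) \<and>
       (\<forall>t. (\<lambda>n. \<integral>\<^sup>+ \<omega>. ennreal ((L2norm f0 (\<lambda>u. V t \<omega> u - partial_sol t n \<omega> u))\<^sup>2) \<partial>M) \<longlonglongrightarrow> 0) \<and>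
       (\<forall>W :: int \<Rightarrow> 'a \<Rightarrow> real \<Rightarrow> real.
          (\<forall>t. AE \<omega> in M. L2norm f0 (\<lambda>u. W t \<omega> u - (\<beta> * W (t - 1) \<omega> u + \<epsilon> t \<omega> u)) = 0) \<and>
          strictly_stationary M (tangent_borel f0) W \<longrightarrow>
          (\<forall>t. AE \<omega> in M. L2norm f0 (\<lambda>u. W t \<omega> u - V t \<omega> u) = 0))"
    proof (intro exI[of _ sol] conjI allI impI; (elim conjE)?)
      fix t
      show "AE \<omega> in M. L2norm f0 (\<lambda>u. sol t \<omega> u - (\<beta> * sol (t - 1) \<omega> u + \<epsilon> t \<omega> u)) = 0"
        using AE_good[of t] AE_good[of "t - 1"] by eventually_elim (rule sol_equation)
      show "AE \<omega> in M. (\<lambda>n. L2norm f0 (\<lambda>u. sol t \<omega> u - partial_sol t n \<omega> u)) \<longlonglongrightarrow> 0"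
        using AE_good[of t] by eventually_elim (rule sol_series_tendsto)
    next
      fix W :: "int \<Rightarrow> 'a \<Rightarrow> real \<Rightarrow> real" and t
      assume "\<forall>t. AE \<omega> in M. L2norm f0 (\<lambda>u. W t \<omega> u - (\<beta> * W (t - 1) \<omega> u + \<epsilon> t \<omega> u)) = 0"
        and "strictly_stationary M (tangent_borel f0) W"
      then show "AE \<omega> in M. L2norm f0 (\<lambda>u. W t \<omega> u - sol t \<omega> u) = 0"
        by (intro sol_unique) auto
    qed (rule sol_L2 sol_stationary sol_mean_square)+
  next
    fix V :: "int \<Rightarrow> 'a \<Rightarrow> real \<Rightarrow> real"
    assume "\<forall>t \<omega>. V t \<omega> \<in> L2 f0" "\<forall>t. V t \<in> measurable M (tangent_borel f0)"
      "\<forall>t. AE \<omega> in M. (\<lambda>n. L2norm f0 (\<lambda>u. V t \<omega> u - partial_sol t n \<omega> u)) \<longlonglongrightarrow> 0"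
      "\<forall>t. AE \<omega> in M. \<forall>u \<in> dens_support f0.
           \<exists>d. (V t \<omega> has_real_derivative d) (at u within dens_support f0) \<and> d > -1"
    then show "\<exists>ft :: int \<Rightarrow> 'a \<Rightarrow> real \<Rightarrow> real.
          (\<forall>t. \<forall>\<omega>\<in>space M. ft t \<omega> \<in> Dens) \<and>
          (\<forall>t. AE \<omega> in M. Exp_map f0 (V t \<omega>) = dmeas (ft t \<omega>)) \<and>
          strictly_stationary M wass_borel ft \<and>
          (\<forall>t. wasserstein_mean M (ft t) f0) \<and>
          (\<forall>t. AE \<omega> in M. L2norm f0
               (\<lambda>u. V t \<omega> u - (dens_quantile (ft t \<omega>) (dens_cdf f0 u) - u)) = 0)"
      by (intro series_limit_image_densities[OF D_int]) auto
  qed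
qed

end
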